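(* Let $k$ be an algebraically closed field of characteristic $p \ge 3$, let $q \ge 5$ be a power of $p$, and let $\mathbb{F}_q \subset k$ be the subfield with $q$ elements. Let $\gamma \in \mathbb{F}_q \setminus \{0, 1, -1\}$, and let $C_3 \subset \mathbb{P}^2$ be the plane curve of degree $q+1$ over $k$ which is the image of the morphism $$\varphi_3: \mathbb{P}^1 \rightarrow \mathbb{P}^2; \quad (s:t) \mapsto \left(s^{\frac{q+1}{2}}t^{\frac{q+1}{2}} : (s+t)^{q+1} : s^{q+1}+\gamma t^{q+1}\right).$$ Then: (a) The point $P_1:=(0:1:0)$ is an outer Galois point for $C_3$ with $G_{P_1} \cong D_{q+1}$. (b) The point $P_2:=(1:0:0)$ is an outer Galois point for $C_3$ with $G_{P_2} \cong \mathbb{Z}/(q+1)\mathbb{Z}$. (c) The number of outer Galois points for $C_3$ is exactly two.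
   Context: Let $C \subset \mathbb{P}^2$ be an irreducible plane curve over an algebraically closed field $k$, with function field $k(C)$. For a point $P \in \mathbb{P}^2$, let $\pi_P: C \dashrightarrow \mathbb{P}^1$ denote the projection from $P$ (the restriction to $C$ of the linear projection $\mathbb{P}^2 \dashrightarrow \mathbb{P}^1$ with center $P$). The point $P$ is called a Galois point for $C$ if the function field extension $k(C)/\pi_P^*k(\mathbb{P}^1)$ induced by $\pi_P$ is Galois; in that case $G_P$ denotes the Galois group of this extension. A Galois point $P$ is called inner if $P$ is a smooth point of $C$, and outer if $P \in \mathbb{P}^2 \setminus C$. For an even integer $2m$, $D_{2m}$ denotes the dihedral group of order $2m$, i.e. $\langle a,b \mid a^m=b^2=(ab)^2=1\rangle$. *)

theory Defs
  imports "HOL-Algebra.Algebraic_Closure_Type" "HOL-Algebra.Bij" "HOL-Algebra.Elementary_Groups"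
begin

section \<open>Plane curves\<close>

text \<open>
  \<open>k[X,Y,Z]\<close> is represented by iterated univariate polynomials: \<open>X\<close> is the outermost
  variable and \<open>Z\<close> the innermost one.
\<close>

type_synonym 'k poly3 = "'k poly poly poly"

definition const3 :: "'k::comm_ring_1 \<Rightarrow> 'k poly3" where
  "const3 c = [:[:[:c:]:]:]"

definition eval3 :: "'k::comm_ring_1 poly3 \<Rightarrow> 'k \<times> 'k \<times> 'k \<Rightarrow> 'k" where
  "eval3 F = (\<lambda>(x, y, z). poly (poly (poly F [:[:x:]:]) [:y:]) z)"

definition homogeneous :: "nat \<Rightarrow> 'k::comm_ring_1 poly3 \<Rightarrow> bool" where
  "homogeneous d F \<longleftrightarrow>
     (\<forall>i j l. Polynomial.coeff (Polynomial.coeff (Polynomial.coeff F i) j) l \<noteq> 0 \<longrightarrow> i + j + l = d)"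

lemma eval3_simps [simp]:
  "eval3 (F + G) v = eval3 F v + eval3 G v"
  "eval3 (F - G) v = eval3 F v - eval3 G v"
  "eval3 (F * G) v = eval3 F v * eval3 G v"
  "eval3 (F ^ n) v = eval3 F v ^ n"
  "eval3 (const3 c) v = c" "eval3 0 v = 0" "eval3 1 v = 1"
  by (simp_all add: eval3_def const3_def split: prod.split)

lemma eval3_variables:
  "eval3 [:0, 1:] (x, y, z) = x" "eval3 [:[:0, 1:]:] (x, y, z) = y"
  "eval3 [:[:[:0, 1:]:]:] (x, y, z) = z"
  by (simp_all add: eval3_def)

text \<open>
  The point \<open>(x : y : z)\<close> is the set of all its homogeneous coordinate triples. Hence
  \<open>\<Union>C\<close> is the set of all homogeneous coordinates of points of \<open>C\<close>.
\<close>

definition proj_point :: "'k::field \<times> 'k \<times> 'k \<Rightarrow> ('k \<times> 'k \<times> 'k) set" where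
  "proj_point = (\<lambda>(x, y, z). {(c * x, c * y, c * z) | c. c \<noteq> 0})"

definition proj_plane :: "('k::field \<times> 'k \<times> 'k) set set" where
  "proj_plane = proj_point ` (UNIV - {(0, 0, 0)})"

definition zero_locus :: "'k::field poly3 \<Rightarrow> ('k \<times> 'k \<times> 'k) set set" where
  "zero_locus F = {proj_point v | v. v \<noteq> (0, 0, 0) \<and> eval3 F v = 0}"

definition irreducible_plane_curve :: "nat \<Rightarrow> ('k::field \<times> 'k \<times> 'k) set set \<Rightarrow> bool" where
  "irreducible_plane_curve d C \<longleftrightarrow>
     (\<exists>F. homogeneous d F \<and> Factorial_Ring.irreducible F \<and> C = zero_locus F)"

section \<open>The function field\<close>

text \<open>
  \<open>k(C)\<close> consists of the quotients \<open>G/H\<close> of forms of the same degree, with \<open>H\<close> not vanishing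
  identically on \<open>C\<close>, where \<open>G/H = G'/H'\<close> iff \<open>G H' - G' H\<close> vanishes on \<open>C\<close>.
\<close>

definition vanishes_on :: "('k::field \<times> 'k \<times> 'k) set set \<Rightarrow> 'k poly3 \<Rightarrow> bool" where
  "vanishes_on C F \<longleftrightarrow> (\<forall>v \<in> \<Union>C. eval3 F v = 0)"

definition fractions :: "('k::field \<times> 'k \<times> 'k) set set \<Rightarrow> ('k poly3 \<times> 'k poly3) set" where
  "fractions C = {(G, H). (\<exists>d. homogeneous d G \<and> homogeneous d H) \<and> \<not> vanishes_on C H}"

definition fraction_rel ::
  "('k::field \<times> 'k \<times> 'k) set set \<Rightarrow> (('k poly3 \<times> 'k poly3) \<times> ('k poly3 \<times> 'k poly3)) set" where
  "fraction_rel C = {((G, H), (G', H')).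
     (G, H) \<in> fractions C \<and> (G', H') \<in> fractions C \<and> vanishes_on C (G * H' - G' * H)}"

definition fraction ::
  "('k::field \<times> 'k \<times> 'k) set set \<Rightarrow> 'k poly3 \<Rightarrow> 'k poly3 \<Rightarrow> ('k poly3 \<times> 'k poly3) set" where
  "fraction C G H = fraction_rel C `` {(G, H)}"

definition function_field ::
  "('k::field \<times> 'k \<times> 'k) set set \<Rightarrow> ('k poly3 \<times> 'k poly3) set ring" where
  "function_field C =
     \<lparr> carrier = fractions C // fraction_rel C,
       monoid.mult = (\<lambda>A B. \<Union>(G, H) \<in> A. \<Union>(G', H') \<in> B. fraction C (G * G') (H * H')),
       one = fraction C 1 1,
       ring.zero = fraction C 0 1,
       add = (\<lambda>A B. \<Union>(G, H) \<in> A. \<Union>(G', H') \<in> B. fraction C (G * H' + G' * H) (H * H')) \<rparr>"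

section \<open>Projections and Galois points\<close>

text \<open>
  A projection with centre \<open>P\<close> is \<open>v \<mapsto> (L v : M v)\<close> for linear forms \<open>L\<close> and \<open>M\<close> with only
  common zero \<open>P\<close>. The field \<open>\<pi>\<^sub>P\<^sup>* k(\<PP>\<^sup>1)\<close> consists of the pullbacks \<open>A(L, M)/B(L, M)\<close> of the
  quotients \<open>A/B\<close> of binary forms \<open>A = \<Sum>\<^sub>i a\<^sub>i S\<^sup>i T\<^sup>d\<^sup>-\<^sup>i\<close> and \<open>B = \<Sum>\<^sub>i b\<^sub>i S\<^sup>i T\<^sup>d\<^sup>-\<^sup>i\<close>. Changing
  \<open>(L, M)\<close> amounts to a linear change of \<open>(S, T)\<close>, so the field does not depend on this choice.
\<close>

definition linear_projection ::
  "('k::field \<times> 'k \<times> 'k) set \<Rightarrow> 'k poly3 \<Rightarrow> 'k poly3 \<Rightarrow> bool" where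
  "linear_projection P L M \<longleftrightarrow> homogeneous 1 L \<and> homogeneous 1 M \<and>
     {v. v \<noteq> (0, 0, 0) \<and> eval3 L v = 0 \<and> eval3 M v = 0} = P"

definition subst_binary_form ::
  "nat \<Rightarrow> (nat \<Rightarrow> 'k::field) \<Rightarrow> 'k poly3 \<Rightarrow> 'k poly3 \<Rightarrow> 'k poly3" where
  "subst_binary_form d a L M = (\<Sum>i\<le>d. const3 (a i) * L ^ i * M ^ (d - i))"

definition projection_subfield ::
  "('k::field \<times> 'k \<times> 'k) set set \<Rightarrow> ('k \<times> 'k \<times> 'k) set \<Rightarrow> ('k poly3 \<times> 'k poly3) set set" where
  "projection_subfield C P =
     {fraction C (subst_binary_form d a L M) (subst_binary_form d b L M) | d a b L M.
        linear_projection P L M \<and> \<not> vanishes_on C (subst_binary_form d b L M)}"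

text \<open>
  An algebraic extension is Galois if it is normal and separable, i.e. if the minimal polynomial
  over \<open>K\<close> of every element of \<open>L\<close> splits in \<open>L\<close> (normality) without multiple roots
  (separability; all roots are in \<open>L\<close> by normality).
\<close>

definition galois_extension :: "('a, 'b) ring_scheme \<Rightarrow> 'a set \<Rightarrow> bool" where
  "galois_extension L K \<longleftrightarrow> field L \<and> subfield K L \<and>
     (\<forall>x \<in> carrier L. ring.algebraic L K x \<and>
        ring.splitted L (ring.Irr L K x) \<and>
        (\<forall>y \<in> carrier L. ring.alg_mult L (ring.Irr L K x) y \<le> 1))"

definition galois_group :: "('a, 'b) ring_scheme \<Rightarrow> 'a set \<Rightarrow> ('a \<Rightarrow> 'a) monoid" where
  "galois_group L K = BijGroup (carrier L)
     \<lparr>carrier := {\<sigma> \<in> Bij (carrier L). \<sigma> \<in> ring_hom L L \<and> (\<forall>x \<in> K. \<sigma> x = x)}\<rparr>"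

definition galois_point :: "('k::field \<times> 'k \<times> 'k) set set \<Rightarrow> ('k \<times> 'k \<times> 'k) set \<Rightarrow> bool" where
  "galois_point C P \<longleftrightarrow>
     P \<in> proj_plane \<and> galois_extension (function_field C) (projection_subfield C P)"

definition outer_galois_point :: "('k::field \<times> 'k \<times> 'k) set set \<Rightarrow> ('k \<times> 'k \<times> 'k) set \<Rightarrow> bool" where
  "outer_galois_point C P \<longleftrightarrow> galois_point C P \<and> P \<notin> C"

definition galois_point_group ::
  "('k::field \<times> 'k \<times> 'k) set set \<Rightarrow> ('k \<times> 'k \<times> 'k) set \<Rightarrow>
     (('k poly3 \<times> 'k poly3) set \<Rightarrow> ('k poly3 \<times> 'k poly3) set) monoid" where
  "galois_point_group C P = galois_group (function_field C) (projection_subfield C P)"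

section \<open>Dihedral groups\<close>

text \<open>
  The dihedral group of order \<open>2m\<close>; the pair \<open>(i, e)\<close> stands for \<open>a\<^sup>i\<close> if \<open>e\<close> is false and for
  \<open>a\<^sup>i b\<close> if \<open>e\<close> is true. The lemmas below show that for \<open>m > 0\<close> this is the group presented by
  \<open>\<langle>a, b | a\<^sup>m = b\<^sup>2 = (a b)\<^sup>2 = 1\<rangle>\<close>.
\<close>

definition dihedral_group :: "nat \<Rightarrow> (int \<times> bool) monoid" where
  "dihedral_group m =
     \<lparr> carrier = {0..<int m} \<times> UNIV,
       monoid.mult = (\<lambda>(i, e) (j, f). ((if e then i - j else i + j) mod int m, e \<noteq> f)),
       one = (0, False) \<rparr>"

definition dihedral_a :: "nat \<Rightarrow> int \<times> bool" where
  "dihedral_a m = (1 mod int m, False)"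

definition dihedral_b :: "int \<times> bool" where
  "dihedral_b = (0, True)"

lemma card_dihedral_group: "card (carrier (dihedral_group m)) = 2 * m"
  by (simp add: dihedral_group_def card_cartesian_product)

lemma group_dihedral_group:
  assumes "m > 0"
  shows "group (dihedral_group m)"
proof (rule groupI)
  fix x y z
  show "x \<otimes>\<^bsub>dihedral_group m\<^esub> y \<otimes>\<^bsub>dihedral_group m\<^esub> z =
    x \<otimes>\<^bsub>dihedral_group m\<^esub> (y \<otimes>\<^bsub>dihedral_group m\<^esub> z)"
    by (cases x; cases y; cases z) (auto simp: dihedral_group_def mod_simps algebra_simps)
next
  fix x assume "x \<in> carrier (dihedral_group m)"
  then obtain i e where x: "x = (i, e)" "0 \<le> i" "i < int m"
    by (auto simp: dihedral_group_def)
  show "\<exists>y\<in>carrier (dihedral_group m). y \<otimes>\<^bsub>dihedral_group m\<^esub> x = \<one>\<^bsub>dihedral_group m\<^esub>"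
    using assms x
    by (intro bexI[of _ "(if e then i else (- i) mod int m, e)"])
       (auto simp: dihedral_group_def mod_simps)
qed (use assms in \<open>auto simp: dihedral_group_def\<close>)

lemma dihedral_pow_a: "dihedral_a m [^]\<^bsub>dihedral_group m\<^esub> (n::nat) = (int n mod int m, False)"
  by (induction n) (auto simp: nat_pow_def dihedral_group_def dihedral_a_def mod_simps algebra_simps)

lemma dihedral_relations:
  assumes "m > 0"
  shows "dihedral_a m \<in> carrier (dihedral_group m)" "dihedral_b \<in> carrier (dihedral_group m)"
    and "dihedral_a m [^]\<^bsub>dihedral_group m\<^esub> m = \<one>\<^bsub>dihedral_group m\<^esub>"
    and "dihedral_b [^]\<^bsub>dihedral_group m\<^esub> (2::nat) = \<one>\<^bsub>dihedral_group m\<^esub>"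
    and "(dihedral_a m \<otimes>\<^bsub>dihedral_group m\<^esub> dihedral_b) [^]\<^bsub>dihedral_group m\<^esub> (2::nat) =
         \<one>\<^bsub>dihedral_group m\<^esub>"
  using assms unfolding dihedral_pow_a
  by (auto simp: dihedral_group_def dihedral_a_def dihedral_b_def nat_pow_def numeral_2_eq_2)

lemma dihedral_generators:
  assumes "x \<in> carrier (dihedral_group m)"
  shows "x = dihedral_a m [^]\<^bsub>dihedral_group m\<^esub> nat (fst x) \<otimes>\<^bsub>dihedral_group m\<^esub>
    (if snd x then dihedral_b else \<one>\<^bsub>dihedral_group m\<^esub>)"
  using assms unfolding dihedral_pow_a by (auto simp: dihedral_group_def dihedral_b_def)

lemma dihedral_universal:
  assumes "group H" and ab: "\<alpha> \<in> carrier H" "\<beta> \<in> carrier H" and m: "m > 0"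
    and rel: "\<alpha> [^]\<^bsub>H\<^esub> m = \<one>\<^bsub>H\<^esub>" "\<beta> [^]\<^bsub>H\<^esub> (2::nat) = \<one>\<^bsub>H\<^esub>" "(\<alpha> \<otimes>\<^bsub>H\<^esub> \<beta>) [^]\<^bsub>H\<^esub> (2::nat) = \<one>\<^bsub>H\<^esub>"
  shows "\<exists>h \<in> hom (dihedral_group m) H. h (dihedral_a m) = \<alpha> \<and> h dihedral_b = \<beta>"
proof -
  interpret H: group H by fact
  have bb: "\<beta> \<otimes>\<^bsub>H\<^esub> \<beta> = \<one>\<^bsub>H\<^esub>"
    using rel(2) ab by (simp add: numeral_2_eq_2)
  have abab: "\<alpha> \<otimes>\<^bsub>H\<^esub> \<beta> \<otimes>\<^bsub>H\<^esub> (\<alpha> \<otimes>\<^bsub>H\<^esub> \<beta>) = \<one>\<^bsub>H\<^esub>"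
    using rel(3) ab by (simp add: numeral_2_eq_2)
  have binv: "inv\<^bsub>H\<^esub> \<beta> = \<beta>"
    using bb ab by (simp add: H.inv_equality)
  have conj1: "\<beta> \<otimes>\<^bsub>H\<^esub> \<alpha> \<otimes>\<^bsub>H\<^esub> inv\<^bsub>H\<^esub> \<beta> = inv\<^bsub>H\<^esub> \<alpha>"
    using abab ab unfolding binv by (metis H.inv_equality H.m_assoc H.m_closed H.inv_comm)
  have period: "\<alpha> [^]\<^bsub>H\<^esub> (n mod int m) = \<alpha> [^]\<^bsub>H\<^esub> n" for n :: int
  proof -
    have "\<alpha> [^]\<^bsub>H\<^esub> n = \<alpha> [^]\<^bsub>H\<^esub> (int m * (n div int m) + n mod int m)"
      by simp
    also have "\<dots> = (\<alpha> [^]\<^bsub>H\<^esub> int m) [^]\<^bsub>H\<^esub> (n div int m) \<otimes>\<^bsub>H\<^esub> \<alpha> [^]\<^bsub>H\<^esub> (n mod int m)"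
      using ab by (simp only: H.int_pow_mult H.int_pow_pow)
    also have "\<dots> = \<alpha> [^]\<^bsub>H\<^esub> (n mod int m)"
      using ab rel(1) by (simp add: int_pow_int)
    finally show ?thesis by simp
  qed
  have swapn: "\<beta> \<otimes>\<^bsub>H\<^esub> \<alpha> [^]\<^bsub>H\<^esub> n \<otimes>\<^bsub>H\<^esub> \<beta> = inv\<^bsub>H\<^esub> (\<alpha> [^]\<^bsub>H\<^esub> n)" for n :: nat
  proof (induction n)
    case 0
    then show ?case using ab bb by simp
  next
    case (Suc n)
    have "\<beta> \<otimes>\<^bsub>H\<^esub> \<alpha> [^]\<^bsub>H\<^esub> Suc n \<otimes>\<^bsub>H\<^esub> \<beta> =
        (\<beta> \<otimes>\<^bsub>H\<^esub> \<alpha> [^]\<^bsub>H\<^esub> n \<otimes>\<^bsub>H\<^esub> \<beta>) \<otimes>\<^bsub>H\<^esub> (\<beta> \<otimes>\<^bsub>H\<^esub> \<alpha> \<otimes>\<^bsub>H\<^esub> inv\<^bsub>H\<^esub> \<beta>)"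
      using ab bb unfolding binv
      by (smt (verit, best) H.l_one H.m_assoc H.m_closed H.nat_pow_Suc H.nat_pow_closed)
    moreover have "inv\<^bsub>H\<^esub> (\<alpha> [^]\<^bsub>H\<^esub> Suc n) = inv\<^bsub>H\<^esub> (\<alpha> [^]\<^bsub>H\<^esub> n) \<otimes>\<^bsub>H\<^esub> inv\<^bsub>H\<^esub> \<alpha>"
      using ab by (simp only: H.nat_pow_Suc2 H.inv_mult_group H.nat_pow_closed)
    ultimately show ?case
      unfolding Suc conj1 by simp
  qed
  have swap: "\<beta> \<otimes>\<^bsub>H\<^esub> \<alpha> [^]\<^bsub>H\<^esub> n = \<alpha> [^]\<^bsub>H\<^esub> (- n) \<otimes>\<^bsub>H\<^esub> \<beta>" if "n \<ge> 0" for n :: int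
  proof -
    obtain k where k: "n = int k" using \<open>n \<ge> 0\<close> nonneg_int_cases by blast
    have "\<beta> \<otimes>\<^bsub>H\<^esub> \<alpha> [^]\<^bsub>H\<^esub> k = \<beta> \<otimes>\<^bsub>H\<^esub> \<alpha> [^]\<^bsub>H\<^esub> k \<otimes>\<^bsub>H\<^esub> \<beta> \<otimes>\<^bsub>H\<^esub> \<beta>"
      using ab bb by (simp add: H.m_assoc)
    then show ?thesis
      using ab k unfolding swapn by (simp add: int_pow_int H.int_pow_neg)
  qed
  define h where "h = (\<lambda>(i::int, e). \<alpha> [^]\<^bsub>H\<^esub> i \<otimes>\<^bsub>H\<^esub> (if e then \<beta> else \<one>\<^bsub>H\<^esub>))"
  have "h (x \<otimes>\<^bsub>dihedral_group m\<^esub> y) = h x \<otimes>\<^bsub>H\<^esub> h y"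
    if "x \<in> carrier (dihedral_group m)" "y \<in> carrier (dihedral_group m)" for x y
  proof -
    obtain i e j f where xy: "x = (i, e)" "y = (j, f)" by (metis surj_pair)
    have "j \<ge> 0" using that(2) xy by (simp add: dihedral_group_def)
    note s = swap[OF this]
    have e1: "\<alpha> [^]\<^bsub>H\<^esub> (i - j) \<otimes>\<^bsub>H\<^esub> \<beta> = \<alpha> [^]\<^bsub>H\<^esub> i \<otimes>\<^bsub>H\<^esub> \<beta> \<otimes>\<^bsub>H\<^esub> \<alpha> [^]\<^bsub>H\<^esub> j"
      using ab s by (simp add: H.m_assoc H.int_pow_mult diff_conv_add_uminus del: add_uminus_conv_diff)
    then have e2: "\<alpha> [^]\<^bsub>H\<^esub> (i - j) = \<alpha> [^]\<^bsub>H\<^esub> i \<otimes>\<^bsub>H\<^esub> \<beta> \<otimes>\<^bsub>H\<^esub> (\<alpha> [^]\<^bsub>H\<^esub> j \<otimes>\<^bsub>H\<^esub> \<beta>)"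
      using ab bb by (metis H.int_pow_closed H.m_assoc H.m_closed H.r_one)
    show ?thesis
      using ab e1 e2
      by (auto simp: xy h_def dihedral_group_def period H.int_pow_mult H.m_assoc)
  qed
  moreover have "h x \<in> carrier H" for x
    using ab by (cases x) (simp add: h_def)
  ultimately have "h \<in> hom (dihedral_group m) H"
    by (simp add: hom_def)
  moreover have "h (dihedral_a m) = \<alpha>" "h dihedral_b = \<beta>"
    using ab by (simp_all add: h_def dihedral_a_def dihedral_b_def period)
  ultimately show ?thesis by blast
qed

section \<open>The curve\<close>

definition curve_C3 :: "nat \<Rightarrow> 'k::field \<Rightarrow> ('k \<times> 'k \<times> 'k) set set" where
  "curve_C3 q \<gamma> =
     {proj_point (s ^ ((q + 1) div 2) * t ^ ((q + 1) div 2),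
                  (s + t) ^ (q + 1),
                  s ^ (q + 1) + \<gamma> * t ^ (q + 1)) | s t. (s, t) \<noteq> (0, 0)}"

end

theory Submission
  imports Defs
begin

text \<open>
  Write \<open>n = q + 1 = 2 m\<close>. In the affine coordinate \<open>u = s/t\<close> the curve is the image of
  \<open>u \<mapsto> (A : B : C)\<close> with \<open>A = u\<^sup>m\<close>, \<open>B = (u + 1)\<^sup>n\<close> and \<open>C = u\<^sup>n + \<gamma>\<close>. This map is birational:
  the conjugates of \<open>u\<close> over \<open>k(C/A)\<close> are \<open>z u\<close> with \<open>z\<^sup>m = 1\<close> and \<open>z/u\<close> with \<open>z\<^sup>m = \<gamma>\<close>, and only \<open>u\<close>
  itself is also a root of the corresponding equation for \<open>B/A\<close> (\<open>birational_criterion\<close>). Hence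
  \<open>k(C)\<close> is the rational function field \<open>k(u)\<close>, and the projection from a point \<open>P\<close> outside the
  curve corresponds to the subfield \<open>k(f/g)\<close>, where \<open>f\<close> and \<open>g\<close> span the pencil of those linear
  combinations of \<open>A\<close>, \<open>B\<close>, \<open>C\<close> that vanish at \<open>P\<close>; it has index \<open>n\<close>.

  The two given points are Galois points by Artin's theorem (\<open>galois_by_group_action\<close>). For
  \<open>(0 : 1 : 0)\<close> the quotient \<open>C/A = u\<^sup>m + \<gamma> u\<^sup>-\<^sup>m\<close> is invariant under \<open>u \<mapsto> z u\<close> with \<open>z\<^sup>m = 1\<close> and
  \<open>u \<mapsto> c/u\<close> with \<open>c\<^sup>m = \<gamma>\<close>, which generate a dihedral group of order \<open>n\<close>. For \<open>(1 : 0 : 0)\<close> the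
  relation \<open>\<gamma>\<^sup>q = \<gamma>\<close> is decisive: it shows that \<open>D = (1 + \<gamma>) C - \<gamma> B\<close> is the \<open>n\<close>-th power of \<open>u - \<gamma>\<close>, so that
  \<open>D/B\<close> is the \<open>n\<close>-th power of \<open>(u - \<gamma>)/(u + 1)\<close> and the extension is a Kummer extension.

  Conversely, let \<open>P\<close> be an outer Galois point with pencil spanned by \<open>f\<close> and \<open>g\<close>. Then all \<open>n\<close>
  conjugates of \<open>u\<close> over \<open>k(f/g)\<close> lie in \<open>k(u)\<close>, and they are Moebius transformations that permute
  the points of each fibre of \<open>f/g\<close> transitively. If \<open>P\<close> lies on the line \<open>X = 0\<close>, then the pencil contains \<open>u\<^sup>m\<close>, so
  that these transformations preserve the set of \<open>0\<close> and \<open>\<infinity>\<close>. Unless \<open>P = (0 : 1 : 0)\<close>,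
  comparing coefficients leaves at most \<open>2 (m - 1) < n\<close> of them (\<open>split_pencil_with_A\<close>). Otherwise
  the pencil is spanned by \<open>f = B - b A\<close> and \<open>g = D - d A\<close>. By transitivity the ramification index
  is constant on each fibre. The zeros of the Wronskian \<open>J = f g' - g f'\<close> other than \<open>-1\<close> and \<open>\<gamma>\<close> have
  ramification index exactly \<open>2\<close>, so they form complete fibres of \<open>n/2\<close> points each; but for \<open>P \<noteq> (1 : 0 : 0)\<close> there are
  \<open>q\<close> or \<open>2 q\<close> of them, and \<open>q + 1\<close> divides neither \<open>2 q\<close> nor \<open>4 q\<close> (\<open>split_pencil_without_A\<close>).

  An equation of the curve is the norm \<open>\<Prod>\<^sub>i (X - H(v, \<zeta>\<^sup>i w))\<close> with \<open>v = s + t\<close>, \<open>w = s - \<gamma> t\<close> and a primitive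
  \<open>n\<close>-th root of unity \<open>\<zeta>\<close>, where \<open>X = H(v, w)\<close> on the curve. It is a polynomial in
  \<open>X\<close>, \<open>v\<^sup>n = Y\<close> and \<open>w\<^sup>n = (1 + \<gamma>) Z - \<gamma> Y\<close>, and it is irreducible because a factor that vanishes on
  the curve has \<open>n\<close> different zeros on a general line through \<open>(1 : 0 : 0)\<close>.
\<close>

section \<open>Minimal polynomials with simple roots\<close>

lemma (in domain) polynomial_zero_imp_algebraic:
  assumes K: "subfield K R" and p: "p \<in> carrier (K[X])" "p \<noteq> []" "eval p x = \<zero>"
  shows "algebraic K x"
  using algebraicI[OF p] unfolding over_def by simp

text \<open>
  Up to a constant factor, \<open>p\<close> is the product of the \<open>X - r\<close> over \<open>S\<close>. The minimal polynomial
  of \<open>x\<close> divides \<open>p\<close>, so it is the product of some of these factors.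
\<close>

lemma (in field) Irr_of_polynomial_with_distinct_roots:
  assumes K: "subfield K R" and p: "p \<in> carrier (K[X])" "p \<noteq> []"
    and S: "S \<subseteq> carrier R" "finite S" "card S = length p - 1" "\<And>r. r \<in> S \<Longrightarrow> eval p r = \<zero>"
    and x: "x \<in> S"
  shows "algebraic K x" "splitted (Irr K x)"
    "\<And>y. alg_mult (Irr K x) y \<le> 1" "\<And>y. is_root (Irr K x) y \<Longrightarrow> y \<in> S"
proof -
  have xR: "x \<in> carrier R" using S x by blast
  show alg: "algebraic K x"
    using polynomial_zero_imp_algebraic[OF K p] S(4)[OF x] by blast
  then have alg': "(algebraic over K) x" unfolding over_def .
  have pR: "p \<in> carrier (poly_ring R)"
    using carrier_polynomial_shell[OF subfieldE(1)[OF K] p(1)] .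
  have "mset_set S \<subseteq># roots p"
  proof (rule mset_subset_eqI)
    fix a
    show "count (mset_set S) a \<le> count (roots p) a"
      using S p roots_mem_iff_is_root[OF pR, of a] unfolding is_root_def
      by (cases "a \<in> S") (auto simp: Suc_le_eq)
  qed
  moreover have "size (roots p) \<le> size (mset_set S)"
    using size_roots_le_degree[OF pR] S by simp
  ultimately have rp: "roots p = mset_set S"
    by (metis mset_subset_size subset_mset.le_imp_less_or_eq not_le)
  have sp: "splitted p"
    unfolding splitted_def rp using S by simp
  note I = IrrE[OF K xR alg']
  have IR: "Irr K x \<in> carrier (poly_ring R)"
    using carrier_polynomial_shell[OF subfieldE(1)[OF K] I(1)] .
  have dv: "Irr K x pdivides p"
    using Irr_minimal[OF K xR alg' p(1)] S(4)[OF x] by blast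
  show "splitted (Irr K x)"
    by (rule pdivides_imp_splitted[OF IR pR p(2) sp dv])
  have sub: "roots (Irr K x) \<subseteq># mset_set S"
    using pdivides_imp_roots_incl[OF IR pR p(2) dv] rp by simp
  show "alg_mult (Irr K x) y \<le> 1" for y
    unfolding alg_mult_eq_count_roots[OF IR]
    using mset_subset_eq_count[OF sub, of y] by (cases "y \<in> S") (use S in auto)
  show "y \<in> S" if "is_root (Irr K x) y" for y
    using that roots_mem_iff_is_root[OF IR, of y] mset_subset_eqD[OF sub] S by auto
qed

text \<open>
  A polynomial of least length is a multiple of the minimal polynomial by a constant, and the
  latter has as many distinct roots as its degree.
\<close>

lemma (in field) galois_imp_distinct_roots:
  assumes K: "subfield K R" and x: "x \<in> carrier R" 
    and G: "splitted (Irr K x)" "\<And>y. y \<in> carrier R \<Longrightarrow> alg_mult (Irr K x) y \<le> 1"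
    and p: "p \<in> carrier (K[X])" "p \<noteq> []" "eval p x = \<zero>"
    and minimal: "\<And>q. q \<in> carrier (K[X]) \<Longrightarrow> q \<noteq> [] \<Longrightarrow> eval q x = \<zero> \<Longrightarrow> length p \<le> length q"
  shows "\<exists>S. S \<subseteq> carrier R \<and> card S = length p - 1 \<and> (\<forall>r\<in>S. eval p r = \<zero>)"
proof -
  have alg': "(algebraic over K) x"
    using algebraicI[OF p] .
  note I = IrrE[OF K x alg']
  have IR: "Irr K x \<in> carrier (poly_ring R)" and pR: "p \<in> carrier (poly_ring R)"
    using carrier_polynomial_shell[OF subfieldE(1)[OF K]] I(1) p(1) by auto
  have I0: "Irr K x \<noteq> []"
    using pirreducibleE(1)[OF subfieldE(1)[OF K] I(1) I(2)] .
  have dv: "Irr K x pdivides p"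
    using Irr_minimal[OF K x alg' p(1,3)] .
  have len: "length (Irr K x) = length p"
    using minimal[OF I(1) I0 I(4)] pdivides_imp_degree_le[OF subfieldE(1)[OF K] I(1) p(1,2) dv] 
      p(2) I0 by (cases "length p"; cases "length (Irr K x)") auto
  define S where "S = set_mset (roots (Irr K x))"
  have SR: "S \<subseteq> carrier R"
    using roots_mem_iff_is_root[OF IR] unfolding S_def is_root_def by auto
  have "count (roots (Irr K x)) y = (if y \<in> S then 1 else 0)" for y
  proof (cases "y \<in> S")
    case True
    then have "count (roots (Irr K x)) y \<le> 1"
      using G(2)[of y] SR unfolding alg_mult_eq_count_roots[OF IR] by blast
    then show ?thesis using True unfolding S_def
      by (metis One_nat_def Suc_leI count_greater_zero_iff le_antisym)
  qed (simp add: S_def not_in_iff)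
  then have "roots (Irr K x) = mset_set S"
    by (intro multiset_eqI) (simp add: S_def)
  then have "card S = length p - 1"
    using G(1) len unfolding splitted_def by simp
  moreover have "eval p r = \<zero>" if "r \<in> S" for r
  proof -
    have "is_root (Irr K x) r"
      using that roots_mem_iff_is_root[OF IR] unfolding S_def by simp
    then show ?thesis
      using pdivides_imp_root_sharing[OF IR dv, of r] unfolding is_root_def by auto
  qed
  ultimately show ?thesis using SR by blast
qed

section \<open>Finite groups acting on a field\<close>

text \<open>
  The counterpart of \<open>subfield\<close> for a field that is given by a type with class operations.
\<close>

definition subfield_of_type :: "'a::field set \<Rightarrow> bool" where
  "subfield_of_type K \<longleftrightarrow> 0 \<in> K \<and> 1 \<in> K \<and>
     (\<forall>x\<in>K. \<forall>y\<in>K. x + y \<in> K \<and> x * y \<in> K) \<and> (\<forall>x\<in>K. - x \<in> K \<and> inverse x \<in> K)"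

lemma subfield_of_typeD:
  assumes "subfield_of_type K"
  shows "0 \<in> K" "1 \<in> K" "x \<in> K \<Longrightarrow> y \<in> K \<Longrightarrow> x + y \<in> K" "x \<in> K \<Longrightarrow> y \<in> K \<Longrightarrow> x * y \<in> K"
    "x \<in> K \<Longrightarrow> - x \<in> K" "x \<in> K \<Longrightarrow> inverse x \<in> K"
    "x \<in> K \<Longrightarrow> y \<in> K \<Longrightarrow> x - y \<in> K" "x \<in> K \<Longrightarrow> y \<in> K \<Longrightarrow> x / y \<in> K"
proof -
  show *: "0 \<in> K" "1 \<in> K" "x \<in> K \<Longrightarrow> y \<in> K \<Longrightarrow> x + y \<in> K" "x \<in> K \<Longrightarrow> y \<in> K \<Longrightarrow> x * y \<in> K"
    "x \<in> K \<Longrightarrow> - x \<in> K" "x \<in> K \<Longrightarrow> inverse x \<in> K" for x y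
    using assms unfolding subfield_of_type_def by auto
  show "x \<in> K \<Longrightarrow> y \<in> K \<Longrightarrow> x - y \<in> K" using *(3)[of x "- y"] *(5) by simp
  show "x \<in> K \<Longrightarrow> y \<in> K \<Longrightarrow> x / y \<in> K" using *(4)[of x "inverse y"] *(6) by (simp add: field_simps)
qed

lemma subfield_of_type_power: "subfield_of_type K \<Longrightarrow> x \<in> K \<Longrightarrow> x ^ n \<in> K"
  by (induction n) (auto intro: subfield_of_typeD)

lemma subfield_of_type_sum:
  "subfield_of_type K \<Longrightarrow> (\<And>i. i \<in> I \<Longrightarrow> f i \<in> K) \<Longrightarrow> sum f I \<in> K"
  by (induction I rule: infinite_finite_induct) (auto intro: subfield_of_typeD)

definition poly_over :: "'a::field set \<Rightarrow> 'a poly \<Rightarrow> bool" where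
  "poly_over K P \<longleftrightarrow> (\<forall>i. Polynomial.coeff P i \<in> K)"

lemma poly_over_closed:
  assumes "subfield_of_type K"
  shows "poly_over K 0" "poly_over K P \<Longrightarrow> poly_over K Q \<Longrightarrow> poly_over K (P + Q)"
    "poly_over K P \<Longrightarrow> poly_over K Q \<Longrightarrow> poly_over K (P - Q)"
    "poly_over K P \<Longrightarrow> poly_over K Q \<Longrightarrow> poly_over K (P * Q)"
    "c \<in> K \<Longrightarrow> poly_over K (Polynomial.monom c n)"
    "c \<in> K \<Longrightarrow> poly_over K P \<Longrightarrow> poly_over K (pCons c P)"
  using assms subfield_of_typeD(1)[OF assms] unfolding poly_over_def coeff_mult
  by (auto intro!: subfield_of_typeD subfield_of_type_sum simp: coeff_pCons split: nat.split)

text \<open>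
  Long division stays over \<open>K\<close>, because the quotients of leading coefficients do.
\<close>

lemma poly_over_division:
  assumes K: "subfield_of_type K" and P: "poly_over K P" "P \<noteq> 0"
  shows "poly_over K Q \<Longrightarrow>
    \<exists>A B. poly_over K A \<and> poly_over K B \<and> Q = A * P + B \<and> (B = 0 \<or> Polynomial.degree B < Polynomial.degree P)"
proof (induction "Polynomial.degree Q" arbitrary: Q rule: less_induct)
  case less
  show ?case
  proof (cases "Q = 0 \<or> Polynomial.degree Q < Polynomial.degree P")
    case True
    then show ?thesis using less.prems poly_over_closed(1)[OF K]
      by (intro exI[of _ 0] exI[of _ Q]) auto
  next
    case False
    define c where "c = Polynomial.lead_coeff Q / Polynomial.lead_coeff P"
    define T where "T = Polynomial.monom c (Polynomial.degree Q - Polynomial.degree P)"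
    have cK: "c \<in> K"
      using less.prems P unfolding c_def poly_over_def by (intro subfield_of_typeD(8)[OF K]) auto
    have TK: "poly_over K T" unfolding T_def by (intro poly_over_closed(5)[OF K] cK)
    have c0: "c \<noteq> 0" using False P unfolding c_def by simp
    have dT: "Polynomial.degree (T * P) = Polynomial.degree Q"
    proof -
      have "T \<noteq> 0" "Polynomial.degree T = Polynomial.degree Q - Polynomial.degree P"
        using c0 unfolding T_def by (simp_all add: degree_monom_eq)
      then show ?thesis using False P(2) by (simp add: degree_mult_eq)
    qed
    have lT: "Polynomial.lead_coeff (T * P) = Polynomial.lead_coeff Q"
      using P c0 by (simp add: lead_coeff_mult T_def degree_monom_eq) (simp add: c_def)
    define Q' where "Q' = Q - T * P"
    have Q'K: "poly_over K Q'"
      unfolding Q'_def by (intro poly_over_closed[OF K] less.prems TK P)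
    have red: "Q' = 0 \<or> Polynomial.degree Q' < Polynomial.degree Q"
    proof (cases "Q' = 0")
      case False
      have "Polynomial.degree Q' \<le> Polynomial.degree Q"
        unfolding Q'_def using dT by (intro degree_diff_le) auto
      moreover have "Polynomial.coeff Q' (Polynomial.degree Q) = 0"
        using lT dT unfolding Q'_def by simp
      ultimately show ?thesis using False by (metis le_neq_implies_less leading_coeff_0_iff)
    qed simp
    have "\<exists>A B. poly_over K A \<and> poly_over K B \<and> Q' = A * P + B \<and>
        (B = 0 \<or> Polynomial.degree B < Polynomial.degree P)"
    proof (cases "Q' = 0")
      case True
      then show ?thesis using poly_over_closed(1)[OF K] by (intro exI[of _ 0]) auto
    next
      case False
      then show ?thesis using less.hyps[OF _ Q'K] red by blast
    qed
    then obtain A B where AB: "poly_over K A" "poly_over K B" "Q' = A * P + B"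
      "B = 0 \<or> Polynomial.degree B < Polynomial.degree P" by blast
    have "Q = (A + T) * P + B" using AB(3) unfolding Q'_def by (simp add: algebra_simps)
    then show ?thesis using AB TK poly_over_closed(2)[OF K AB(1) TK] by blast
  qed
qed

text \<open>
  The situation of Artin's theorem, stated so that it can be checked on a generator: \<open>x0\<close>
  generates the field over \<open>K\<close>, and the composition law and the faithfulness of the action are
  required at \<open>x0\<close> only. The polynomial \<open>P\<close> bounds the degree of \<open>x0\<close> over \<open>K\<close> by \<open>|H|\<close>.
\<close>

locale group_of_field_maps =
  fixes K :: "'a::field set" and H :: "('h, 'm) monoid_scheme" and act :: "'h \<Rightarrow> 'a \<Rightarrow> 'a"
    and x0 :: 'a and P :: "'a poly"
  assumes K: "subfield_of_type K"
    and H: "group H" "finite (carrier H)"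
    and act_add: "h \<in> carrier H \<Longrightarrow> act h (x + y) = act h x + act h y"
    and act_mult: "h \<in> carrier H \<Longrightarrow> act h (x * y) = act h x * act h y"
    and act_fix: "h \<in> carrier H \<Longrightarrow> x \<in> K \<Longrightarrow> act h x = x"
    and act_comp0: "g \<in> carrier H \<Longrightarrow> h \<in> carrier H \<Longrightarrow> act (g \<otimes>\<^bsub>H\<^esub> h) x0 = act g (act h x0)"
    and act_inj: "inj_on (\<lambda>h. act h x0) (carrier H)"
    and P: "poly_over K P" "P \<noteq> 0" "Polynomial.degree P \<le> card (carrier H)" "poly P x0 = 0"
    and simple: "\<exists>Q. poly_over K Q \<and> y = poly Q x0"
begin

lemma map_poly_over:
  assumes f: "\<And>x y. f (x + y) = f x + f y" "\<And>x y. f (x * y) = f x * f y" "\<And>x. x \<in> K \<Longrightarrow> f x = (x::'a)"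
    and Q: "poly_over K Q"
  shows "f (poly Q x) = poly Q (f x)"
  using Q
proof (induction Q)
  case 0
  then show ?case using f(3)[of 0] subfield_of_typeD(1)[OF K] by simp
next
  case (pCons a Q)
  have "a \<in> K" using pCons.prems unfolding poly_over_def by (metis coeff_pCons_0)
  moreover have "poly_over K Q" using pCons.prems unfolding poly_over_def by (metis coeff_pCons_Suc)
  ultimately show ?case using pCons.IH f by simp
qed

lemma act_poly: "h \<in> carrier H \<Longrightarrow> poly_over K Q \<Longrightarrow> act h (poly Q x) = poly Q (act h x)"
  by (rule map_poly_over) (auto simp: act_add act_mult act_fix)

lemma card_orbit_generator: "card ((\<lambda>h. act h x0) ` carrier H) = card (carrier H)"
  by (rule card_image[OF act_inj])

lemma root_generator: "h \<in> carrier H \<Longrightarrow> poly P (act h x0) = 0"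
  using act_poly[OF _ P(1), of h x0] P(4) act_fix subfield_of_typeD(1)[OF K] by simp

text \<open>
  The orbit of \<open>x0\<close> consists of \<open>|H|\<close> roots, which the degree of \<open>P\<close> does not let it exceed.
\<close>

lemma roots_P: "{x. poly P x = 0} = (\<lambda>h. act h x0) ` carrier H"
proof (rule card_seteq[symmetric])
  show "finite {x. poly P x = 0}" by (rule poly_roots_finite[OF P(2)])
  show "(\<lambda>h. act h x0) ` carrier H \<subseteq> {x. poly P x = 0}" using root_generator by auto
  show "card {x. poly P x = 0} \<le> card ((\<lambda>h. act h x0) ` carrier H)"
    unfolding card_orbit_generator using card_poly_roots_bound[OF P(2)] P(3) by linarith
qed

lemma degree_P: "Polynomial.degree P = card (carrier H)"
  using card_poly_roots_bound[OF P(2)] P(3) unfolding roots_P card_orbit_generator by linarith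

lemma card_H_pos: "card (carrier H) > 0"
  using H group.is_monoid monoid.one_closed by (metis card_gt_0_iff empty_iff)

text \<open>
  Both sides are field maps over \<open>K\<close>, so that they agree everywhere if they agree at \<open>x0\<close>.
\<close>

lemma act_comp: 
  assumes "g \<in> carrier H" "h \<in> carrier H"
  shows "act (g \<otimes>\<^bsub>H\<^esub> h) y = act g (act h y)"
proof -
  interpret H: group H by (rule H)
  obtain Q where Q: "poly_over K Q" "y = poly Q x0" using simple by blast
  show ?thesis using assms by (simp add: Q act_poly act_comp0)
qed

text \<open>
  Every element is a polynomial of degree less than \<open>|H|\<close> in \<open>x0\<close>. If it is fixed by \<open>H\<close>, that
  polynomial takes the same value at the \<open>|H|\<close> conjugates of \<open>x0\<close>, so it is constant.
\<close>

lemma fixed_imp_base: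
  assumes fixed: "\<And>h. h \<in> carrier H \<Longrightarrow> act h y = y"
  shows "y \<in> K"
proof -
  obtain Q where Q: "poly_over K Q" "y = poly Q x0" using simple by blast
  obtain A B where AB: "poly_over K A" "poly_over K B" "Q = A * P + B"
      "B = 0 \<or> Polynomial.degree B < Polynomial.degree P" using poly_over_division[OF K P(1,2) Q(1)] by blast
  have y: "y = poly B x0" using Q(2) AB(3) P(4) by simp
  define D where "D = B - [:y:]"
  have "D = 0"
  proof (rule ccontr)
    assume D: "D \<noteq> 0"
    have "(\<lambda>h. act h x0) ` carrier H \<subseteq> {x. poly D x = 0}"
      using fixed act_poly[OF _ AB(2), of _ x0] y unfolding D_def by auto
    then have "card (carrier H) \<le> card {x. poly D x = 0}"
      using card_mono[OF poly_roots_finite[OF D]] card_orbit_generator by metis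
    moreover have "Polynomial.degree D < card (carrier H)"
    proof -
      have "Polynomial.degree B < card (carrier H)"
        using AB(4) degree_P card_H_pos by auto
      then show ?thesis
        unfolding D_def using card_H_pos by (intro degree_diff_less) auto
    qed
    ultimately show False using card_poly_roots_bound[OF D] by linarith
  qed
  then have "B = [:y:]" unfolding D_def by simp
  then show ?thesis using AB(2) unfolding poly_over_def by (metis coeff_pCons_0)
qed

lemma act_zero: "h \<in> carrier H \<Longrightarrow> act h 0 = 0"
  using act_fix subfield_of_typeD(1)[OF K] by blast

lemma map_poly_act_mult:
  assumes "h \<in> carrier H"
  shows "map_poly (act h) (A * B) = map_poly (act h) A * map_poly (act h) B"
proof -
  have s: "act h (sum f I) = (\<Sum>i\<in>I. act h (f i))" for f and I :: "nat set"
    by (induction I rule: infinite_finite_induct) (auto simp: act_zero act_add assms)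
  show ?thesis
    by (rule poly_eqI) (simp add: coeff_map_poly act_zero assms coeff_mult s act_mult)
qed

lemma act_inverse:
  assumes "h \<in> carrier H"
  shows "act (inv\<^bsub>H\<^esub> h) (act h y) = y" "act h (act (inv\<^bsub>H\<^esub> h) y) = y"
proof -
  interpret H: group H by (rule H)
  have "act \<one>\<^bsub>H\<^esub> (act \<one>\<^bsub>H\<^esub> z) = act \<one>\<^bsub>H\<^esub> z" for z
    using act_comp[of "\<one>\<^bsub>H\<^esub>" "\<one>\<^bsub>H\<^esub>" z] by simp
  moreover have "act \<one>\<^bsub>H\<^esub> a = act \<one>\<^bsub>H\<^esub> b \<Longrightarrow> a = b" for a b
  proof (rule ccontr)
    assume eq: "act \<one>\<^bsub>H\<^esub> a = act \<one>\<^bsub>H\<^esub> b" and "a \<noteq> b"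
    define c where "c = a - b"
    have c: "c \<noteq> 0" "a = b + c" using \<open>a \<noteq> b\<close> unfolding c_def by auto
    have "act \<one>\<^bsub>H\<^esub> c = 0" using eq c(2) act_add[OF H.one_closed] by simp
    then have "act \<one>\<^bsub>H\<^esub> (c * inverse c) = 0" using act_mult[OF H.one_closed] by simp
    moreover have "act \<one>\<^bsub>H\<^esub> 1 = 1" using act_fix subfield_of_typeD(2)[OF K] by blast
    ultimately show False using c(1) by simp
  qed
  ultimately have one: "act \<one>\<^bsub>H\<^esub> z = z" for z by blast
  show "act (inv\<^bsub>H\<^esub> h) (act h y) = y" "act h (act (inv\<^bsub>H\<^esub> h) y) = y"
    using act_comp[of "inv\<^bsub>H\<^esub> h" h y] act_comp[of h "inv\<^bsub>H\<^esub> h" y] assms one by simp_all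
qed

text \<open>The product of the \<open>X - o\<close> over the orbit of \<open>z\<close> has coefficients that are fixed by \<open>H\<close>,
  so they lie in \<open>K\<close> by \<open>fixed_imp_base\<close>.\<close>

lemma orbit_polynomial:
  obtains Q where "poly_over K Q" "Q \<noteq> 0" "poly Q z = 0" 
    "card {x. poly Q x = 0} = Polynomial.degree Q"
proof -
  interpret H: group H by (rule H)
  define O' where "O' = (\<lambda>h. act h z) ` carrier H"
  define Q where "Q = (\<Prod>o'\<in>O'. [:- o', 1:])"
  have finO: "finite O'" unfolding O'_def using H by simp
  have perm: "bij_betw (act g) O' O'" if g: "g \<in> carrier H" for g
  proof (rule bij_betwI[where g = "act (inv\<^bsub>H\<^esub> g)"])
    show "act g \<in> O' \<rightarrow> O'"
      unfolding O'_def using act_comp[OF g, of _ z, symmetric] g by auto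
    show "act (inv\<^bsub>H\<^esub> g) \<in> O' \<rightarrow> O'"
      unfolding O'_def using act_comp[of "inv\<^bsub>H\<^esub> g" _ z, symmetric] g by auto
  qed (auto simp: act_inverse g)
  have "map_poly (act g) Q = Q" if g: "g \<in> carrier H" for g
  proof -
    have lin: "map_poly (act g) [:- a, 1:] = [:- act g a, 1:]" for a
    proof -
      have "act g (- a) + act g a = 0" using act_add[OF g, of "- a" a] act_zero[OF g] by simp
      then have "act g (- a) = - act g a" by (simp add: eq_neg_iff_add_eq_0)
      moreover have "act g 1 = 1" using act_fix[OF g] subfield_of_typeD(2)[OF K] by blast
      ultimately show ?thesis by (intro poly_eqI) (simp add: coeff_map_poly act_zero g coeff_pCons split: nat.split)
    qed
    have one: "map_poly (act g) 1 = 1"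
      using act_fix[OF g] subfield_of_typeD(2)[OF K] act_zero[OF g]
      by (intro poly_eqI) (simp add: coeff_map_poly coeff_1)
    have "map_poly (act g) (\<Prod>o'\<in>A. [:- o', 1:]) = (\<Prod>o'\<in>A. [:- act g o', 1:])" for A
      by (induction A rule: infinite_finite_induct) (simp_all add: map_poly_act_mult g lin one del: mult_pCons_left)
    then have "map_poly (act g) Q = (\<Prod>o'\<in>O'. [:- act g o', 1:])" unfolding Q_def .
    also have "\<dots> = Q"
      unfolding Q_def using prod.reindex_bij_betw[OF perm[OF g], of "\<lambda>o'. [:- o', 1:]"] by simp
    finally show ?thesis .
  qed
  then have QK: "poly_over K Q"
    unfolding poly_over_def by (metis fixed_imp_base coeff_map_poly act_zero)
  have Q0: "Q \<noteq> 0" unfolding Q_def using finO by simp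
  have deg: "Polynomial.degree Q = card O'"
    unfolding Q_def by (subst degree_prod_eq_sum_degree) auto
  have rt: "{x. poly Q x = 0} = O'"
    using finO unfolding Q_def by (auto simp: poly_prod)
  have "act \<one>\<^bsub>H\<^esub> z = z" using act_inverse(1)[of "\<one>\<^bsub>H\<^esub>" z] act_comp[of "\<one>\<^bsub>H\<^esub>" "\<one>\<^bsub>H\<^esub>" z] by simp
  then have "z \<in> O'" unfolding O'_def by (metis H.one_closed imageI)
  then show ?thesis using that[of Q] QK Q0 deg rt by auto
qed

text \<open>
  A field map over \<open>K\<close> sends \<open>x0\<close> to a root of \<open>P\<close>, that is, to a conjugate \<open>act h x0\<close>; and it is
  determined by its value at \<open>x0\<close>.
\<close>

lemma field_map_in_group:
  assumes f: "\<And>x y. f (x + y) = f x + f y" "\<And>x y. f (x * y) = f x * f y" "\<And>x. x \<in> K \<Longrightarrow> f x = x"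
  shows "\<exists>h\<in>carrier H. f = act h"
proof -
  have "poly P (f x0) = 0"
    using map_poly_over[OF f P(1), of x0] P(4) f(3)[of 0] subfield_of_typeD(1)[OF K] by simp
  then obtain h where h: "h \<in> carrier H" "f x0 = act h x0" using roots_P by auto
  have "f y = act h y" for y
  proof -
    obtain Q where Q: "poly_over K Q" "y = poly Q x0" using simple by blast
    show ?thesis using map_poly_over[OF f Q(1), of x0] act_poly[OF h(1) Q(1), of x0] Q(2) h(2) by simp
  qed
  then show ?thesis using h(1) by blast
qed

end

section \<open>Transfer along an isomorphism\<close>

text \<open>
  A function field is a record whose elements are classes of fractions. An isomorphism \<open>\<psi>\<close> onto a
  field type makes it possible to compute there and to carry the result back.
\<close>

locale field_copy =
  fixes R :: "('b, 'm) ring_scheme" (structure) and \<psi> :: "'b \<Rightarrow> 'a::field"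
  assumes bij: "bij_betw \<psi> (carrier R) UNIV"
    and mult_in: "x \<in> carrier R \<Longrightarrow> y \<in> carrier R \<Longrightarrow> x \<otimes> y \<in> carrier R"
    and add_in: "x \<in> carrier R \<Longrightarrow> y \<in> carrier R \<Longrightarrow> x \<oplus> y \<in> carrier R"
    and one_in: "\<one> \<in> carrier R" and zero_in: "\<zero> \<in> carrier R"
    and \<psi>_mult: "x \<in> carrier R \<Longrightarrow> y \<in> carrier R \<Longrightarrow> \<psi> (x \<otimes> y) = \<psi> x * \<psi> y"
    and \<psi>_add: "x \<in> carrier R \<Longrightarrow> y \<in> carrier R \<Longrightarrow> \<psi> (x \<oplus> y) = \<psi> x + \<psi> y"
    and \<psi>_one: "\<psi> \<one> = 1" and \<psi>_zero: "\<psi> \<zero> = 0"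
begin

definition \<iota> :: "'a \<Rightarrow> 'b" where "\<iota> = inv_into (carrier R) \<psi>"

lemma \<iota>_in [simp]: "\<iota> a \<in> carrier R"
  unfolding \<iota>_def using bij by (metis UNIV_I bij_betw_def inv_into_into)

lemma \<psi>_\<iota> [simp]: "\<psi> (\<iota> a) = a"
  unfolding \<iota>_def using bij by (metis UNIV_I bij_betw_def f_inv_into_f)

lemma \<iota>_\<psi> [simp]: "x \<in> carrier R \<Longrightarrow> \<iota> (\<psi> x) = x"
  unfolding \<iota>_def using bij by (simp add: bij_betw_def)

lemma \<psi>_inj: "x \<in> carrier R \<Longrightarrow> y \<in> carrier R \<Longrightarrow> \<psi> x = \<psi> y \<Longrightarrow> x = y"
  by (metis \<iota>_\<psi>)

lemma field_R: "field R"
proof -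
  let ?U = "ring_of_type_algebra :: 'a ring"
  have "\<iota> \<in> ring_hom ?U R"
    by (rule ring_hom_memI)
       (auto simp: ring_of_type_algebra_def mult_in add_in one_in \<psi>_mult \<psi>_add \<psi>_one intro: \<psi>_inj)
  moreover have "bij_betw \<iota> (carrier ?U) (carrier R)"
    unfolding \<iota>_def using bij_betw_inv_into[OF bij] by (simp add: ring_of_type_algebra_def)
  ultimately have "\<iota> \<in> ring_iso ?U R" unfolding ring_iso_def by simp
  note field.ring_iso_imp_img_field[OF field_from_type_algebra this]
  moreover have "\<iota> \<one>\<^bsub>?U\<^esub> = \<one>" "\<iota> \<zero>\<^bsub>?U\<^esub> = \<zero>"
    using \<iota>_\<psi>[OF one_in] \<iota>_\<psi>[OF zero_in] by (simp_all add: ring_of_type_algebra_def \<psi>_one \<psi>_zero)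
  ultimately show ?thesis by simp
qed

end

sublocale field_copy \<subseteq> field R by (rule field_R)

context field_copy
begin

lemma \<psi>_minus: "x \<in> carrier R \<Longrightarrow> \<psi> (\<ominus> x) = - \<psi> x"
  using \<psi>_add[of "\<ominus> x" x] by (simp add: l_neg \<psi>_zero eq_neg_iff_add_eq_0)

lemma \<psi>_inv: 
  assumes "x \<in> carrier R" "x \<noteq> \<zero>"
  shows "\<psi> (inv x) = inverse (\<psi> x)"
proof -
  have "x \<in> Units R" using assms field_Units by blast
  then have "\<psi> (inv x) * \<psi> x = 1" using \<psi>_mult[of "inv x" x] by (simp add: \<psi>_one Units_closed)
  then show ?thesis by (metis inverse_unique mult.commute)
qed

lemma \<psi>_pow: "x \<in> carrier R \<Longrightarrow> \<psi> (x [^] (n::nat)) = \<psi> x ^ n"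
  by (induction n) (simp_all add: \<psi>_one \<psi>_mult mult.commute)

lemma \<psi>_eval:
  assumes "set p \<subseteq> carrier R" "x \<in> carrier R"
  shows "\<psi> (eval p x) = poly (Poly (rev (map \<psi> p))) (\<psi> x)"
  using assms
proof (induction p)
  case (Cons a p)
  then show ?case
    by (simp add: Poly_snoc \<psi>_add \<psi>_mult \<psi>_pow eval_in_carrier poly_monom add.commute)
qed (simp add: \<psi>_zero)

text \<open>
  In the polynomial ring over a record, a polynomial is the list of its coefficients, with the
  leading one first.
\<close>

definition list_poly :: "'a poly \<Rightarrow> 'b list" where "list_poly P = map \<iota> (rev (coeffs P))"

lemma list_poly:
  assumes K: "K \<subseteq> carrier R" and P: "poly_over (\<psi> ` K) P" "P \<noteq> 0"
  shows "list_poly P \<in> carrier (K[X])" "list_poly P \<noteq> []" 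
    "length (list_poly P) = Suc (Polynomial.degree P)"
    "x \<in> carrier R \<Longrightarrow> \<psi> (eval (list_poly P) x) = poly P (\<psi> x)"
proof -
  have "\<iota> c \<in> K" if "c \<in> set (coeffs P)" for c
  proof -
    have "c \<in> \<psi> ` K" using that P(1) unfolding poly_over_def
      by (auto simp: coeffs_def split: if_splits)
    then show ?thesis using K by auto
  qed
  then have sub: "set (list_poly P) \<subseteq> K" unfolding list_poly_def by auto
  have "hd (list_poly P) = \<iota> (Polynomial.lead_coeff P)"
    using P(2) unfolding list_poly_def
    by (simp add: hd_map hd_rev last_coeffs_eq_coeff_degree)
  moreover have "\<iota> (Polynomial.lead_coeff P) \<noteq> \<zero>"
    using P(2) \<psi>_zero by (metis \<psi>_\<iota> leading_coeff_0_iff)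
  ultimately show "list_poly P \<in> carrier (K[X])"
    using sub unfolding univ_poly_carrier[symmetric] polynomial_def by simp
  show "list_poly P \<noteq> []" using P(2) unfolding list_poly_def by simp
  show "length (list_poly P) = Suc (Polynomial.degree P)"
    using P(2) unfolding list_poly_def by (simp add: length_coeffs)
  show "\<psi> (eval (list_poly P) x) = poly P (\<psi> x)" if "x \<in> carrier R"
  proof -
    have "set (list_poly P) \<subseteq> carrier R" using sub K by blast
    moreover have "map \<psi> (list_poly P) = rev (coeffs P)"
      unfolding list_poly_def by (simp add: map_idI)
    ultimately show ?thesis using \<psi>_eval[OF _ that, of "list_poly P"] by simp
  qed
qed

lemma poly_of_list:
  assumes K: "subfield K R" and p: "p \<in> carrier (K[X])"
  shows "poly_over (\<psi> ` K) (Poly (rev (map \<psi> p)))"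
    "x \<in> carrier R \<Longrightarrow> poly (Poly (rev (map \<psi> p))) (\<psi> x) = \<psi> (eval p x)"
    "p \<noteq> [] \<Longrightarrow> Poly (rev (map \<psi> p)) \<noteq> 0"
    "Polynomial.degree (Poly (rev (map \<psi> p))) \<le> length p - 1"
proof -
  have sK: "set p \<subseteq> K" 
    using p unfolding univ_poly_carrier[symmetric] polynomial_def by auto
  have KR: "K \<subseteq> carrier R" by (rule subfieldE(3)[OF K])
  have "\<zero> \<in> K" using subringE(2)[OF subfieldE(1)[OF K]] .
  then have "0 \<in> \<psi> ` K" using \<psi>_zero by (metis imageI)
  then show "poly_over (\<psi> ` K) (Poly (rev (map \<psi> p)))"
    using sK unfolding poly_over_def coeff_Poly_eq nth_default_def
    by (auto simp: rev_map rev_nth intro!: imageI subsetD[OF sK])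
  show "x \<in> carrier R \<Longrightarrow> poly (Poly (rev (map \<psi> p))) (\<psi> x) = \<psi> (eval p x)"
    using \<psi>_eval sK KR by auto
  show "Poly (rev (map \<psi> p)) \<noteq> 0" if "p \<noteq> []"
  proof -
    have "hd p \<noteq> \<zero>"
      using p that unfolding univ_poly_carrier[symmetric] polynomial_def by auto
    moreover have "hd p \<in> carrier R" using hd_in_set[OF that] sK KR by (meson subsetD)
    ultimately have "\<psi> (hd p) \<noteq> 0" using \<psi>_inj[of "hd p" \<zero>] \<psi>_zero by auto
    then have "Polynomial.coeff (Poly (rev (map \<psi> p))) (length p - 1) \<noteq> 0"
      using that unfolding coeff_Poly_eq nth_default_def
      by (simp add: rev_map rev_nth hd_conv_nth)
    then show ?thesis by (metis coeff_0)
  qed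
  show "Polynomial.degree (Poly (rev (map \<psi> p))) \<le> length p - 1"
    by (rule degree_le) (auto simp: coeff_Poly_eq nth_default_def)
qed

lemma subfield_iff:
  assumes "K \<subseteq> carrier R"
  shows "subfield K R \<longleftrightarrow> subfield_of_type (\<psi> ` K)"
proof
  assume K: "subfield K R"
  note S = subringE[OF subfieldE(1)[OF K]]
  have "inverse (\<psi> x) \<in> \<psi> ` K" if "x \<in> K" for x
  proof (cases "x = \<zero>")
    case False
    then show ?thesis
      using subfield_m_inv(1)[OF K, of x] that \<psi>_inv[of x] assms by (metis Diff_iff imageI singletonD subsetD)
  qed (use S(2) \<psi>_zero in force)
  moreover have "0 \<in> \<psi> ` K" "1 \<in> \<psi> ` K"
    using S(2,3) \<psi>_zero \<psi>_one by (metis imageI)+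
  moreover have "\<psi> x + \<psi> y \<in> \<psi> ` K" "\<psi> x * \<psi> y \<in> \<psi> ` K" "- \<psi> x \<in> \<psi> ` K"
    if "x \<in> K" "y \<in> K" for x y
    using S(5-7) that assms \<psi>_add[of x y] \<psi>_mult[of x y] \<psi>_minus[of x] by (metis imageI subsetD)+
  ultimately show "subfield_of_type (\<psi> ` K)"
    unfolding subfield_of_type_def by blast
next
  assume K: "subfield_of_type (\<psi> ` K)"
  have mem: "x \<in> K" if "x \<in> carrier R" "\<psi> x \<in> \<psi> ` K" for x
    using that assms \<psi>_inj by blast
  show "subfield K R"
  proof (rule subfieldI'[OF subringI])
    fix x assume "x \<in> K - {\<zero>}"
    then have x: "x \<in> carrier R" "x \<noteq> \<zero>" "x \<in> K" using assms by auto
    then have "x \<in> Units R" using field_Units by blast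
    then show "inv x \<in> K" using x \<psi>_inv[of x] subfield_of_typeD(6)[OF K, of "\<psi> x"]
      by (intro mem) auto
  next
    show "\<one> \<in> K" by (rule mem) (simp_all add: \<psi>_one subfield_of_typeD[OF K])
    show "\<ominus> h \<in> K" if "h \<in> K" for h
      using that assms subfield_of_typeD(5)[OF K, of "\<psi> h"] by (intro mem) (auto simp: \<psi>_minus subsetD)
    show "g \<otimes> h \<in> K" "g \<oplus> h \<in> K" if "g \<in> K" "h \<in> K" for g h
      using that assms by (auto simp: \<psi>_mult \<psi>_add subsetD intro!: mem subfield_of_typeD(3,4)[OF K])
  qed (rule assms)
qed

text \<open>
  The polynomials in an algebraic element form a field, so those in \<open>x0\<close> are all.
\<close>

lemma simple_extension_all:
  assumes K: "subfield K R" and P: "poly_over (\<psi> ` K) P" "P \<noteq> 0" "poly P x0 = 0"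
    and gen: "\<And>S. subfield_of_type S \<Longrightarrow> \<psi> ` K \<subseteq> S \<Longrightarrow> x0 \<in> S \<Longrightarrow> S = UNIV"
  shows "\<exists>Q. poly_over (\<psi> ` K) Q \<and> y = poly Q x0"
proof -
  have KR: "K \<subseteq> carrier R" by (rule subfieldE(3)[OF K])
  note L = list_poly[OF KR P(1,2)]
  have "\<psi> (eval (list_poly P) (\<iota> x0)) = \<psi> \<zero>"
    using L(4)[of "\<iota> x0"] P(3) by (simp add: \<psi>_zero)
  moreover have "eval (list_poly P) (\<iota> x0) \<in> carrier R"
    using carrier_polynomial_shell[OF subfieldE(1)[OF K] L(1)]
    by (intro eval_in_carrier) (auto simp: polynomial_incl univ_poly_carrier)
  ultimately have "eval (list_poly P) (\<iota> x0) = \<zero>" using \<psi>_inj zero_in by blast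
  then have alg: "(algebraic over K) (\<iota> x0)"
    using algebraicI[OF L(1,2)] by blast
  define S where "S = simple_extension K (\<iota> x0)"
  have S: "subfield S R"
    unfolding S_def using simple_extension_is_subfield[OF K] alg by simp
  have SR: "S \<subseteq> carrier R" by (rule subfieldE(3)[OF S])
  have "\<psi> ` S = UNIV"
  proof (rule gen)
    show "subfield_of_type (\<psi> ` S)" using S subfield_iff[OF SR] by simp
    show "\<psi> ` K \<subseteq> \<psi> ` S" unfolding S_def by (intro image_mono simple_extension_incl[OF KR \<iota>_in])
    have "\<iota> x0 \<in> S" unfolding S_def using simple_extension_mem[OF subfieldE(1)[OF K]] by simp
    then show "x0 \<in> \<psi> ` S" by (metis \<psi>_\<iota> imageI)
  qed
  then obtain z where z: "z \<in> S" "y = \<psi> z" by (metis UNIV_I imageE)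
  obtain q where q: "q \<in> carrier (K[X])" "z = eval q (\<iota> x0)"
    using z(1) unfolding S_def simple_extension_as_eval_img[OF KR \<iota>_in] by blast
  show ?thesis
    using poly_of_list(1,2)[OF K q(1)] q(2) z(2) by (metis \<iota>_in \<psi>_\<iota>)
qed

lemma galois_extensionI:
  assumes K: "subfield K R"
    and ex: "\<And>z. \<exists>Q. poly_over (\<psi> ` K) Q \<and> Q \<noteq> 0 \<and> poly Q z = 0 \<and>
      card {x. poly Q x = 0} = Polynomial.degree Q"
  shows "galois_extension R K"
proof -
  have "algebraic K x \<and> splitted (Irr K x) \<and> (\<forall>y\<in>carrier R. alg_mult (Irr K x) y \<le> 1)"
    if x: "x \<in> carrier R" for x
  proof -
    obtain Q where Q: "poly_over (\<psi> ` K) Q" "Q \<noteq> 0" "poly Q (\<psi> x) = 0"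
      "card {x. poly Q x = 0} = Polynomial.degree Q" using ex by blast
    note L = list_poly[OF subfieldE(3)[OF K] Q(1,2)]
    define S where "S = \<iota> ` {x. poly Q x = 0}"
    have "inj \<iota>" by (metis \<psi>_\<iota> injI)
    then have cS: "card S = length (list_poly Q) - 1"
      unfolding S_def L(3) by (simp add: card_image inj_on_def Q(4))
    have fS: "finite S" unfolding S_def using poly_roots_finite[OF Q(2)] by simp
    have SR: "S \<subseteq> carrier R" unfolding S_def by auto
    have ev: "eval (list_poly Q) r = \<zero>" if "r \<in> S" for r
    proof (rule \<psi>_inj)
      show "eval (list_poly Q) r \<in> carrier R"
        using carrier_polynomial_shell[OF subfieldE(1)[OF K] L(1)] SR that
        by (intro eval_in_carrier) (auto simp: polynomial_incl univ_poly_carrier)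
      show "\<psi> (eval (list_poly Q) r) = \<psi> \<zero>"
        using L(4)[of r] SR that unfolding S_def by (auto simp: \<psi>_zero)
    qed simp
    have "x \<in> S" unfolding S_def using Q(3) x by (metis (mono_tags) \<iota>_\<psi> image_eqI mem_Collect_eq)
    from Irr_of_polynomial_with_distinct_roots[OF K L(1,2) SR fS cS ev this]
    show ?thesis by blast
  qed
  then show ?thesis unfolding galois_extension_def using K field_R by blast
qed

text \<open>
  Every automorphism over \<open>K\<close> is the action of some \<open>h\<close> by \<open>field_map_in_group\<close>, and \<open>h\<close> can be
  recovered from the image of \<open>x0\<close>.
\<close>

lemma galois_group_iso:
  assumes KC: "K \<subseteq> carrier R" and act: "group_of_field_maps (\<psi> ` K) H act x0 P"
  shows "galois_group R K \<cong> H"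
proof -
  interpret group_of_field_maps "\<psi> ` K" H act x0 P by (rule act)
  interpret H: group H by (rule H(1))
  define F where "F h = (\<lambda>x\<in>carrier R. \<iota> (act h (\<psi> x)))" for h
  have F_app: "F h x = \<iota> (act h (\<psi> x))" if "x \<in> carrier R" for h x
    using that unfolding F_def by simp
  have bijF: "F h \<in> Bij (carrier R)" if h: "h \<in> carrier H" for h
  proof -
    have "bij_betw (\<lambda>x. \<iota> (act h (\<psi> x))) (carrier R) (carrier R)"
      by (rule bij_betwI[where g = "\<lambda>x. \<iota> (act (inv\<^bsub>H\<^esub> h) (\<psi> x))"])
         (auto simp: act_inverse h)
    then show ?thesis unfolding Bij_def F_def by simp
  qed
  have homF: "F h \<in> ring_hom R R" if h: "h \<in> carrier H" for h
  proof (rule ring_hom_memI)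
    have "act h 1 = 1" using act_fix[OF h] subfield_of_typeD(2)[OF K] by blast
    then show "F h \<one> = \<one>" by (simp add: F_app \<psi>_one) (metis \<iota>_\<psi> \<psi>_one one_in)
  qed (auto simp: F_app mult_in add_in \<psi>_mult \<psi>_add act_mult act_add h intro!: \<psi>_inj)
  have fixF: "F h x = x" if "h \<in> carrier H" "x \<in> K" for h x
    using that KC act_fix[of h "\<psi> x"] by (simp add: F_app subsetD)
  define A where "A = {\<sigma> \<in> Bij (carrier R). \<sigma> \<in> ring_hom R R \<and> (\<forall>x \<in> K. \<sigma> x = x)}"
  have carrierG: "carrier (galois_group R K) = A" unfolding galois_group_def A_def by simp
  have "F \<in> hom H (galois_group R K)"
  proof (rule homI)
    show "F h \<in> carrier (galois_group R K)" if "h \<in> carrier H" for h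
      unfolding carrierG A_def using that bijF homF fixF by simp
    show "F (g \<otimes>\<^bsub>H\<^esub> h) = F g \<otimes>\<^bsub>galois_group R K\<^esub> F h" if "g \<in> carrier H" "h \<in> carrier H" for g h
      using that bijF unfolding galois_group_def BijGroup_def
      by (auto simp: F_def compose_def act_comp intro!: restrict_ext)
  qed
  moreover have "inj_on F (carrier H)"
  proof (rule inj_onI)
    fix g h assume gh: "g \<in> carrier H" "h \<in> carrier H" "F g = F h"
    then have "\<iota> (act g x0) = \<iota> (act h x0)" using F_app[of "\<iota> x0" g] F_app[of "\<iota> x0" h] by simp
    then have "act g x0 = act h x0" by (metis \<psi>_\<iota>)
    then show "g = h" using act_inj gh by (simp add: inj_on_def)
  qed
  moreover have "F ` carrier H = A"
  proof
    show "F ` carrier H \<subseteq> A" unfolding A_def using bijF homF fixF by auto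
    show "A \<subseteq> F ` carrier H"
    proof
      fix \<sigma> assume \<sigma>: "\<sigma> \<in> A"
      then have \<sigma>B: "\<sigma> \<in> Bij (carrier R)" and \<sigma>h: "\<sigma> \<in> ring_hom R R" and \<sigma>K: "\<And>x. x \<in> K \<Longrightarrow> \<sigma> x = x"
        unfolding A_def by auto
      have \<sigma>c: "\<sigma> x \<in> carrier R" if "x \<in> carrier R" for x
        using ring_hom_closed[OF \<sigma>h that] .
      define f where "f a = \<psi> (\<sigma> (\<iota> a))" for a
      have i: "\<iota> (a + b) = \<iota> a \<oplus> \<iota> b" "\<iota> (a * b) = \<iota> a \<otimes> \<iota> b" for a b
        by (auto intro!: \<psi>_inj simp: \<psi>_add \<psi>_mult)
      have "f (a + b) = f a + f b" "f (a * b) = f a * f b" for a b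
        unfolding f_def i by (simp_all add: ring_hom_add[OF \<sigma>h] ring_hom_mult[OF \<sigma>h] \<psi>_add \<psi>_mult \<sigma>c)
      moreover have "f a = a" if "a \<in> \<psi> ` K" for a
        using that \<sigma>K KC unfolding f_def by auto
      ultimately obtain h where h: "h \<in> carrier H" "f = act h"
        using field_map_in_group[of f] by blast
      have "\<sigma> = F h"
      proof (rule extensionalityI[where A = "carrier R"])
        show "\<sigma> \<in> extensional (carrier R)" using \<sigma>B unfolding Bij_def by simp
        show "F h \<in> extensional (carrier R)" unfolding F_def by simp
        show "\<sigma> x = F h x" if "x \<in> carrier R" for x
        proof -
          have "F h x = \<iota> (f (\<psi> x))" using F_app[OF that] h(2) by simp
          then show ?thesis unfolding f_def using that \<sigma>c by simp
        qed
      qed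
      then show "\<sigma> \<in> F ` carrier H" using h(1) by blast
    qed
  qed
  ultimately have "F \<in> Group.iso H (galois_group R K)"
    unfolding Group.iso_def bij_betw_def carrierG by simp
  then show ?thesis using H.iso_sym unfolding is_iso_def by blast
qed

text \<open>
  Artin's theorem: every \<open>z\<close> is a root of its orbit polynomial, which has coefficients in \<open>K\<close> and
  distinct roots, so the extension is Galois; and \<open>H\<close> exhausts the automorphisms over \<open>K\<close>.
\<close>

theorem galois_by_group_action:
  assumes KC: "K \<subseteq> carrier R" and KS: "subfield_of_type (\<psi> ` K)" 
    and H: "group H" "finite (carrier H)"
    and act: "\<And>h x y. h \<in> carrier H \<Longrightarrow> act h (x + y) = act h x + act h y"
      "\<And>h x y. h \<in> carrier H \<Longrightarrow> act h (x * y) = act h x * act h y"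
      "\<And>h x. h \<in> carrier H \<Longrightarrow> x \<in> \<psi> ` K \<Longrightarrow> act h x = x"
      "\<And>g h. g \<in> carrier H \<Longrightarrow> h \<in> carrier H \<Longrightarrow> act (g \<otimes>\<^bsub>H\<^esub> h) x0 = act g (act h x0)"
    and inj: "inj_on (\<lambda>h. act h x0) (carrier H)"
    and P: "poly_over (\<psi> ` K) P" "P \<noteq> 0" "Polynomial.degree P \<le> card (carrier H)" "poly P x0 = 0"
    and gen: "\<And>S. subfield_of_type S \<Longrightarrow> \<psi> ` K \<subseteq> S \<Longrightarrow> x0 \<in> S \<Longrightarrow> S = UNIV"
  shows "galois_extension R K" "galois_group R K \<cong> H"
proof -
  have KR: "subfield K R" using KS subfield_iff[OF KC] by simp
  have G: "group_of_field_maps (\<psi> ` K) H act x0 P"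
    using simple_extension_all[OF KR P(1,2,4) gen] KS H act inj P
    by (intro group_of_field_maps.intro) blast+
  then interpret group_of_field_maps "\<psi> ` K" H act x0 P .
  show "galois_extension R K"
    using orbit_polynomial by (intro galois_extensionI[OF KR]) metis
  show "galois_group R K \<cong> H" by (rule galois_group_iso[OF KC G])
qed

text \<open>
  A polynomial of least degree is the minimal polynomial up to a factor, and the latter splits into
  distinct factors. This consequence of being Galois is what excludes all but two centres.
\<close>

lemma galois_extension_roots:
  assumes K: "K \<subseteq> carrier R" and G: "galois_extension R K"
    and P: "poly_over (\<psi> ` K) P" "P \<noteq> 0" "poly P x0 = 0"
    and minimal: "\<And>Q. poly_over (\<psi> ` K) Q \<Longrightarrow> poly Q x0 = 0 \<Longrightarrow> 
      Polynomial.degree Q < Polynomial.degree P \<Longrightarrow> Q = 0"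
  shows "card {x. poly P x = 0} = Polynomial.degree P"
proof -
  have KR: "subfield K R" using G unfolding galois_extension_def by blast
  note L = list_poly[OF K P(1,2)]
  have evc: "eval (list_poly P) r \<in> carrier R" if "r \<in> carrier R" for r
    using carrier_polynomial_shell[OF subfieldE(1)[OF KR] L(1)] that
    by (intro eval_in_carrier) (auto simp: polynomial_incl univ_poly_carrier)
  have ev0: "eval (list_poly P) (\<iota> x0) = \<zero>"
    using evc[of "\<iota> x0"] L(4)[of "\<iota> x0"] P(3) by (intro \<psi>_inj) (auto simp: \<psi>_zero)
  have "splitted (Irr K (\<iota> x0)) \<and> (\<forall>y\<in>carrier R. alg_mult (Irr K (\<iota> x0)) y \<le> 1)"
    using G unfolding galois_extension_def by (metis \<iota>_in)
  moreover have "length (list_poly P) \<le> length q"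
    if "q \<in> carrier (K[X])" "q \<noteq> []" "eval q (\<iota> x0) = \<zero>" for q
  proof (rule ccontr)
    assume "\<not> length (list_poly P) \<le> length q"
    then have "length q \<le> Polynomial.degree P" unfolding L(3) by simp
    then have "Polynomial.degree (Poly (rev (map \<psi> q))) < Polynomial.degree P"
      using poly_of_list(4)[OF KR that(1)] that(2) by (cases q) auto
    moreover have "poly (Poly (rev (map \<psi> q))) x0 = 0"
      using poly_of_list(2)[OF KR that(1), of "\<iota> x0"] that(3) by (simp add: \<psi>_zero)
    ultimately show False
      using minimal poly_of_list(1,3)[OF KR that(1)] that(2) by blast
  qed
  ultimately obtain S where S: "S \<subseteq> carrier R" "card S = length (list_poly P) - 1"
    "\<forall>r\<in>S. eval (list_poly P) r = \<zero>"
    using galois_imp_distinct_roots[OF KR \<iota>_in _ _ L(1,2) ev0] by blast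
  have "\<psi> ` S \<subseteq> {x. poly P x = 0}"
    using S(1,3) L(4) by (force simp: \<psi>_zero)
  moreover have "card (\<psi> ` S) = Polynomial.degree P"
    using S(1,2) L(3) \<psi>_inj by (subst card_image) (auto intro!: inj_onI)
  ultimately have "Polynomial.degree P \<le> card {x. poly P x = 0}"
    using card_mono[OF poly_roots_finite[OF P(2)]] by metis
  then show ?thesis using card_poly_roots_bound[OF P(2)] by simp
qed

end

section \<open>Homogeneous polynomials\<close>

lemma homogeneous_add: "homogeneous d F \<Longrightarrow> homogeneous d G \<Longrightarrow> homogeneous d (F + G)"
  unfolding homogeneous_def by (metis add_0 coeff_add)

lemma homogeneous_zero: "homogeneous d 0"
  unfolding homogeneous_def by simp

lemma homogeneous_sum: "(\<And>i. i \<in> I \<Longrightarrow> homogeneous d (f i)) \<Longrightarrow> homogeneous d (sum f I)"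
  by (induction I rule: infinite_finite_induct) (auto intro: homogeneous_add homogeneous_zero)

lemma homogeneous_mult:
  assumes "homogeneous d F" "homogeneous e G"
  shows "homogeneous (d + e) (F * G)"
  unfolding homogeneous_def
proof (intro allI impI)
  fix i j l assume "Polynomial.coeff (Polynomial.coeff (Polynomial.coeff (F * G) i) j) l \<noteq> 0"
  then have "(\<Sum>i'\<le>i. \<Sum>j'\<le>j. \<Sum>l'\<le>l.
     Polynomial.coeff (Polynomial.coeff (Polynomial.coeff F i') j') l' *
     Polynomial.coeff (Polynomial.coeff (Polynomial.coeff G (i - i')) (j - j')) (l - l')) \<noteq> 0"
    by (simp add: coeff_mult coeff_sum)
  then obtain i' j' l' where *: "i' \<le> i" "j' \<le> j" "l' \<le> l"
     "Polynomial.coeff (Polynomial.coeff (Polynomial.coeff F i') j') l' *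
     Polynomial.coeff (Polynomial.coeff (Polynomial.coeff G (i - i')) (j - j')) (l - l') \<noteq> 0"
    by (metis (no_types, lifting) atMost_iff sum.neutral)
  then have "i' + j' + l' = d" "(i - i') + (j - j') + (l - l') = e"
    using assms unfolding homogeneous_def by (metis mult_zero_left mult_zero_right)+
  then show "i + j + l = d + e" using *(1-3) by linarith
qed

lemma homogeneous_const: "homogeneous 0 (const3 c)"
  unfolding homogeneous_def const3_def by (auto simp: coeff_pCons split: nat.splits)

lemma homogeneous_one: "homogeneous 0 1"
  using homogeneous_const[of 1] by (simp add: const3_def one_pCons)

lemma homogeneous_power: "homogeneous d F \<Longrightarrow> homogeneous (d * i) (F ^ i)"
proof (induction i)
  case (Suc i)
  then show ?case using homogeneous_mult[of d F "d * i" "F ^ i"] by simp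
qed (simp add: homogeneous_one)

lemma homogeneous_scale: "homogeneous d F \<Longrightarrow> homogeneous d (const3 c * F)"
  using homogeneous_mult[OF homogeneous_const] by force

lemma homogeneous_diff:
  assumes "homogeneous d F" "homogeneous d G"
  shows "homogeneous d (F - G)"
  using assms unfolding homogeneous_def coeff_diff by (metis diff_self)

lemma homogeneous_variables:
  "homogeneous 1 [:0, 1:]" "homogeneous 1 [:[:0, 1:]:]" "homogeneous 1 [:[:[:0, 1:]:]:]"
  unfolding homogeneous_def by (auto simp: coeff_pCons split: nat.splits)

lemma eval3_sum: "eval3 (sum f I) v = (\<Sum>i\<in>I. eval3 (f i) v)"
  by (induction I rule: infinite_finite_induct) simp_all

lemma eval3_homogeneous:
  assumes "homogeneous d F"
  shows "eval3 F (c * x, c * y, c * z) = c ^ d * eval3 F (x, y, z)"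
proof -
  have p: "poly Q z = (\<Sum>l\<le>N. Polynomial.coeff Q l * z ^ l)" if "Polynomial.degree Q \<le> N" for Q :: "'b::comm_ring_1 poly" and z N
    unfolding poly_altdef using that
    by (intro sum.mono_neutral_left) (auto simp: coeff_eq_0)
  define N where "N = Polynomial.degree F"
  define M where "M = Max ((\<lambda>i. Polynomial.degree (Polynomial.coeff F i)) ` {..N})"
  define L where "L = Max ((\<lambda>(i, j). Polynomial.degree (Polynomial.coeff (Polynomial.coeff F i) j)) ` ({..N} \<times> {..M}))"
  have M: "Polynomial.degree (Polynomial.coeff F i) \<le> M" if "i \<le> N" for i
    unfolding M_def using that by (intro Max_ge) auto
  have L: "Polynomial.degree (Polynomial.coeff (Polynomial.coeff F i) j) \<le> L" if "i \<le> N" "j \<le> M" for i j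
    unfolding L_def using that by (intro Max_ge) (auto intro!: image_eqI[where x = "(i, j)"])
  have ev: "eval3 F (x, y, z) = (\<Sum>i\<le>N. \<Sum>j\<le>M. \<Sum>l\<le>L. 
      Polynomial.coeff (Polynomial.coeff (Polynomial.coeff F i) j) l * x ^ i * y ^ j * z ^ l)" for x y z
  proof -
    have cp: "[:[:x:]:] ^ i = [:[:x ^ i:]:]" "[:y:] ^ i = [:y ^ i:]" for x y :: 'a and i
      by (simp_all add: poly_const_pow)
    have "eval3 F (x, y, z) = (\<Sum>i\<le>N. poly (poly (Polynomial.coeff F i) [:y:]) z * x ^ i)"
      unfolding eval3_def by (simp add: poly_altdef[of F] N_def poly_sum cp mult.commute)
    also have "\<dots> = (\<Sum>i\<le>N. \<Sum>j\<le>M. poly (Polynomial.coeff (Polynomial.coeff F i) j) z * y ^ j * x ^ i)"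
      by (intro sum.cong) (simp_all add: p[OF M] poly_sum cp sum_distrib_left mult_ac)
    also have "\<dots> = (\<Sum>i\<le>N. \<Sum>j\<le>M. \<Sum>l\<le>L. 
      Polynomial.coeff (Polynomial.coeff (Polynomial.coeff F i) j) l * x ^ i * y ^ j * z ^ l)"
      by (intro sum.cong refl) (simp add: p[OF L] sum_distrib_right sum_distrib_left mult_ac)
    finally show ?thesis .
  qed
  show ?thesis
    unfolding ev sum_distrib_left
  proof (intro sum.cong refl)
    fix i j l
    let ?c = "Polynomial.coeff (Polynomial.coeff (Polynomial.coeff F i) j) l"
    show "?c * (c * x) ^ i * (c * y) ^ j * (c * z) ^ l = c ^ d * (?c * x ^ i * y ^ j * z ^ l)"
    proof (cases "?c = 0")
      case False
      then have "d = i + j + l" using assms unfolding homogeneous_def by blast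
      then show ?thesis by (simp add: power_add power_mult_distrib mult_ac)
    qed simp
  qed
qed

lemma linear_form:
  assumes "homogeneous 1 L"
  obtains l1 l2 l3 where "\<And>x y z. eval3 L (x, y, z) = l1 * x + l2 * y + l3 * z"
proof -
  have zero: "Polynomial.coeff (Polynomial.coeff (Polynomial.coeff L i) j) l = 0" if "i + j + l \<noteq> 1" for i j l
    using assms that unfolding homogeneous_def by blast
  define l1 where "l1 = Polynomial.coeff (Polynomial.coeff (Polynomial.coeff L 1) 0) 0"
  define l2 where "l2 = Polynomial.coeff (Polynomial.coeff (Polynomial.coeff L 0) 1) 0"
  define l3 where "l3 = Polynomial.coeff (Polynomial.coeff (Polynomial.coeff L 0) 0) 1"
  have "L = [:[:[:0, l3:], [:l2:]:], [:[:l1:]:]:]"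
    by (intro poly_eqI) (auto simp: coeff_pCons l1_def l2_def l3_def zero split: nat.splits)
  then have "eval3 L (x, y, z) = l1 * x + l2 * y + l3 * z" for x y z
    by (simp add: eval3_def algebra_simps)
  then show ?thesis using that by blast
qed

section \<open>Binary forms\<close>

text \<open>
  The value at \<open>(x, y)\<close> of the form of degree \<open>n\<close> obtained by homogenizing \<open>f\<close>.
\<close>

definition form_value :: "nat \<Rightarrow> 'a::comm_ring_1 poly \<Rightarrow> 'a \<Rightarrow> 'a \<Rightarrow> 'a" where
  "form_value n f x y = (\<Sum>i\<le>n. Polynomial.coeff f i * x ^ i * y ^ (n - i))"

lemma form_value_affine:
  assumes "Polynomial.degree f \<le> n"
  shows "form_value n f (y * x) y = y ^ n * poly f x"
proof -
  have "poly f x = (\<Sum>i\<le>n. Polynomial.coeff f i * x ^ i)"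
    unfolding poly_altdef using assms
    by (intro sum.mono_neutral_left) (auto simp: coeff_eq_0)
  moreover have "Polynomial.coeff f i * (y * x) ^ i * y ^ (n - i) = y ^ n * (Polynomial.coeff f i * x ^ i)"
    if "i \<in> {..n}" for i
  proof -
    have "y ^ n = y ^ i * y ^ (n - i)" using that by (simp add: power_add[symmetric])
    then show ?thesis by (simp add: power_mult_distrib mult_ac)
  qed
  ultimately show ?thesis unfolding form_value_def by (simp add: sum_distrib_left)
qed

lemma form_value_infinity: "form_value n f x 0 = Polynomial.coeff f n * x ^ n"
proof -
  have "form_value n f x 0 = (\<Sum>i\<in>{n}. Polynomial.coeff f i * x ^ i * 0 ^ (n - i))"
    unfolding form_value_def by (intro sum.mono_neutral_right) (auto simp: power_0_left split: if_splits)
  then show ?thesis by simp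
qed

lemma form_value_add: "form_value n (f + g) x y = form_value n f x y + form_value n g x y"
  by (simp add: form_value_def sum.distrib algebra_simps)

lemma form_value_diff: "form_value n (f - g) x y = form_value n f x y - form_value n g x y"
  by (simp add: form_value_def sum_subtractf algebra_simps)

lemma form_value_smult: "form_value n (Polynomial.smult c f) x y = c * form_value n f x y"
  by (simp add: form_value_def sum_distrib_left mult_ac)

lemma form_value_monom: "m \<le> n \<Longrightarrow> form_value n (Polynomial.monom c m) x y = c * x ^ m * y ^ (n - m)"
  unfolding form_value_def by (simp add: if_distrib[of "\<lambda>c. c * _ * _"] sum.delta cong: if_cong)

lemma coeff_mult_bounded_degree:
  fixes f g :: "'a::comm_semiring_1 poly"
  assumes "Polynomial.degree f \<le> a" "Polynomial.degree g \<le> b"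
  shows "Polynomial.coeff (f * g) (a + b) = Polynomial.coeff f a * Polynomial.coeff g b"
proof -
  have "Polynomial.coeff f i * Polynomial.coeff g (a + b - i) = 0" if "i \<noteq> a" for i
    using assms that by (cases "i < a") (auto simp: coeff_eq_0)
  then have "Polynomial.coeff (f * g) (a + b) = (\<Sum>i\<in>{a}. Polynomial.coeff f i * Polynomial.coeff g (a + b - i))"
    unfolding coeff_mult by (intro sum.mono_neutral_right) auto
  then show ?thesis by simp
qed

lemma coeff_power_bounded_degree:
  fixes f :: "'a::comm_semiring_1 poly"
  assumes "Polynomial.degree f \<le> a"
  shows "Polynomial.coeff (f ^ i) (i * a) = Polynomial.coeff f a ^ i" "Polynomial.degree (f ^ i) \<le> i * a"
proof -
  show *: "Polynomial.degree (f ^ i) \<le> i * a" for i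
    using degree_power_le[of f i] assms by (metis le_trans mult.commute mult_le_mono1)
  show "Polynomial.coeff (f ^ i) (i * a) = Polynomial.coeff f a ^ i"
    by (induction i) (simp_all add: coeff_mult_bounded_degree[OF assms *])
qed

lemma form_value_mult:
  fixes f g :: "'a::field poly"
  assumes "Polynomial.degree f \<le> n" "Polynomial.degree g \<le> m"
  shows "form_value (n + m) (f * g) x y = form_value n f x y * form_value m g x y"
proof (cases "y = 0")
  case True
  then show ?thesis
    using coeff_mult_bounded_degree[OF assms] by (simp add: form_value_infinity power_add)
next
  case False
  have d: "Polynomial.degree (f * g) \<le> n + m" using degree_mult_le[of f g] assms by linarith
  show ?thesis
    using form_value_affine[OF d, of y "x / y"] form_value_affine[OF assms(1), of y "x / y"]
      form_value_affine[OF assms(2), of y "x / y"] False by (simp add: power_add)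
qed

text \<open>
  For linear forms the degree of the power is its exponent, whence the same \<open>n\<close> twice.
\<close>

lemma form_value_power:
  fixes f :: "'a::field poly"
  assumes "Polynomial.degree f \<le> 1"
  shows "form_value n (f ^ n) x y = form_value 1 f x y ^ n"
proof (induction n)
  case (Suc n)
  have "Polynomial.degree (f ^ n) \<le> n" using coeff_power_bounded_degree(2)[OF assms, of n] by simp
  then show ?case using form_value_mult[OF assms, of "f ^ n" n] Suc by simp
qed (simp add: form_value_def)

lemma form_value_linear: "form_value 1 [:b, a:] x y = a * x + b * y"
  by (simp add: form_value_def)

lemma degree_diff_eq_left:
  fixes p q :: "'a::ab_group_add poly"
  shows "Polynomial.degree q < Polynomial.degree p \<Longrightarrow> Polynomial.degree (p - q) = Polynomial.degree p"
  using degree_add_eq_left[of "- q" p] by simp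

lemma infinite_poly_eqI:
  fixes f g :: "'a::field poly"
  assumes "infinite (UNIV :: 'a set)" "finite A" "\<And>x. x \<notin> A \<Longrightarrow> poly f x = poly g x"
  shows "f = g"
proof (rule ccontr)
  assume "f \<noteq> g"
  then have "finite {x. poly (f - g) x = 0}" by (intro poly_roots_finite) simp
  moreover have "- A \<subseteq> {x. poly (f - g) x = 0}" using assms(3) by auto
  ultimately have "finite (- A)" by (metis finite_subset)
  then show False using assms(1,2) by (metis finite_compl)
qed

section \<open>Rational functions in one variable\<close>

lemma infinite_alg_closed: "infinite (UNIV :: 'k::alg_closed_field set)"
proof
  assume fin: "finite (UNIV :: 'k set)"
  define P where "P = (\<Prod>a\<in>(UNIV::'k set). [:- a, 1:]) + 1"
  have "Polynomial.degree (\<Prod>a\<in>(UNIV::'k set). [:- a, 1:]) = card (UNIV :: 'k set)"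
    by (subst degree_prod_eq_sum_degree) auto
  moreover have "card (UNIV :: 'k set) > 0" using fin by (simp add: card_gt_0_iff)
  ultimately have "Polynomial.degree P > 0"
    unfolding P_def by (subst degree_add_eq_left) auto
  then obtain x where "poly P x = 0" using alg_closed_imp_poly_has_root by blast
  moreover have "poly P x = 1" unfolding P_def using fin by (simp add: poly_prod prod_zero_iff)
  ultimately show False by simp
qed

definition const_fract :: "'k::field \<Rightarrow> 'k poly fract" where
  "const_fract c = Fract [:c:] 1"

lemma const_fract_hom:
  "const_fract 0 = 0" "const_fract 1 = 1" "const_fract (a + b) = const_fract a + const_fract b"
  "const_fract (a * b) = const_fract a * const_fract b" "const_fract (- a) = - const_fract a"
  "const_fract (a - b) = const_fract a - const_fract b"
  by (simp_all add: const_fract_def Zero_fract_def One_fract_def one_pCons mult.commute)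

lemma const_fract_power: "const_fract (a ^ n) = const_fract a ^ n"
  by (induction n) (simp_all add: const_fract_hom)

lemma const_fract_eq_0: "const_fract c = 0 \<longleftrightarrow> c = 0"
  by (simp add: const_fract_def Zero_fract_def eq_fract)

lemma const_fract_divide: "const_fract (a / b) = const_fract a / const_fract b"
proof (cases "b = 0")
  case False
  then have "const_fract (a / b) * const_fract b = const_fract a" by (simp flip: const_fract_hom)
  moreover have "const_fract b \<noteq> 0" using False by (simp add: const_fract_eq_0)
  ultimately show ?thesis by (simp add: field_simps)
qed (simp add: const_fract_hom)

definition eval_fract :: "'k::field poly \<Rightarrow> 'k poly fract \<Rightarrow> 'k poly fract" where
  "eval_fract P r = poly (map_poly const_fract P) r"

lemma eval_fract_simps [simp]:
  "eval_fract 0 r = 0" "eval_fract 1 r = 1" "eval_fract [:c:] r = const_fract c"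
  "eval_fract (pCons c P) r = const_fract c + r * eval_fract P r"
  "eval_fract (P + Q) r = eval_fract P r + eval_fract Q r"
  "eval_fract (P - Q) r = eval_fract P r - eval_fract Q r"
  "eval_fract (P * Q) r = eval_fract P r * eval_fract Q r"
  "eval_fract (Polynomial.smult c P) r = const_fract c * eval_fract P r"
  "eval_fract (P ^ n) r = eval_fract P r ^ n" "eval_fract (- P) r = - eval_fract P r"
proof -
  have cz: "const_fract (sum f I) = (\<Sum>i\<in>I. const_fract (f i))" for f :: "nat \<Rightarrow> 'a" and I
    by (induction I rule: infinite_finite_induct) (simp_all add: const_fract_hom)
  show z: "eval_fract 0 r = 0" for r :: "'a poly fract" by (simp add: eval_fract_def)
  show c: "eval_fract (pCons c P) r = const_fract c + r * eval_fract P r" for c P and r :: "'a poly fract"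
    by (simp add: eval_fract_def map_poly_pCons const_fract_hom)
  show "eval_fract [:c:] r = const_fract c" by (simp add: c z)
  show o: "eval_fract 1 r = 1" using c[of 1 0 r] z by (simp add: one_pCons const_fract_hom)
  show "eval_fract (P + Q) r = eval_fract P r + eval_fract Q r"
    unfolding eval_fract_def by (subst poly_add[symmetric], rule arg_cong[where f = "\<lambda>p. poly p r"])
      (rule poly_eqI, simp add: coeff_map_poly const_fract_hom)
  show "eval_fract (P - Q) r = eval_fract P r - eval_fract Q r"
    unfolding eval_fract_def by (subst poly_diff[symmetric], rule arg_cong[where f = "\<lambda>p. poly p r"])
      (rule poly_eqI, simp add: coeff_map_poly const_fract_hom)
  show m: "eval_fract (P * Q) r = eval_fract P r * eval_fract Q r" for P Q
    unfolding eval_fract_def by (subst poly_mult[symmetric], rule arg_cong[where f = "\<lambda>p. poly p r"])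
      (rule poly_eqI, simp add: coeff_map_poly const_fract_hom coeff_mult cz)
  show "eval_fract (Polynomial.smult c P) r = const_fract c * eval_fract P r"
    using m[of "[:c:]" P] by (simp add: c z)
  show "eval_fract (P ^ n) r = eval_fract P r ^ n"
    by (induction n) (simp_all add: o m)
  show "eval_fract (- P) r = - eval_fract P r"
    using m[of "[:-1:]" P] by (simp add: c z const_fract_hom)
qed

lemma eval_fract_sum: "eval_fract (sum f I) r = (\<Sum>i\<in>I. eval_fract (f i) r)"
  by (induction I rule: infinite_finite_induct) simp_all

lemma eval_fract_monom: "eval_fract (Polynomial.monom c n) r = const_fract c * r ^ n"
  by (simp add: eval_fract_def map_poly_monom const_fract_hom poly_monom)

lemma eval_fract_altdef:
  assumes "Polynomial.degree P \<le> n"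
  shows "eval_fract P r = (\<Sum>i\<le>n. const_fract (Polynomial.coeff P i) * r ^ i)"
proof -
  have "P = (\<Sum>i\<le>n. Polynomial.monom (Polynomial.coeff P i) i)"
    using assms by (intro poly_eqI) (auto simp: coeff_sum coeff_eq_0 if_distrib sum.delta cong: if_cong)
  then have "eval_fract P r = eval_fract (\<Sum>i\<le>n. Polynomial.monom (Polynomial.coeff P i) i) r" by simp
  then show ?thesis by (simp add: eval_fract_sum eval_fract_monom)
qed

definition X_fract :: "'k::field poly fract" where "X_fract = Fract [:0, 1:] 1"

lemma Fract_eq_divide: "q \<noteq> 0 \<Longrightarrow> Fract p q = Fract p 1 / Fract q 1"
  by simp

lemma eval_fract_X: "eval_fract P X_fract = Fract P 1"
proof (induction P)
  case (pCons a P)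
  then show ?case by (simp add: X_fract_def const_fract_def)
qed (simp add: Zero_fract_def)

lemma Fract_eq_0_iff: "Fract p 1 = 0 \<longleftrightarrow> p = (0 :: 'a::idom)"
  by (simp add: Zero_fract_def eq_fract)

text \<open>The field generated by \<open>\<theta>\<close> over the constants.\<close>

definition simple_field :: "'k::field poly fract \<Rightarrow> 'k poly fract set" where
  "simple_field \<theta> = {eval_fract A \<theta> / eval_fract B \<theta> | A B. eval_fract B \<theta> \<noteq> 0}"

lemma simple_fieldI: "x = eval_fract A \<theta> / eval_fract B \<theta> \<Longrightarrow> eval_fract B \<theta> \<noteq> 0 \<Longrightarrow> x \<in> simple_field \<theta>"
  unfolding simple_field_def by blast

lemma simple_field:
  shows "subfield_of_type (simple_field \<theta>)" "const_fract c \<in> simple_field \<theta>" "\<theta> \<in> simple_field \<theta>"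
    "subfield_of_type S \<Longrightarrow> (\<And>c. const_fract c \<in> S) \<Longrightarrow> \<theta> \<in> S \<Longrightarrow> simple_field \<theta> \<subseteq> S"
proof -
  show c: "const_fract c \<in> simple_field \<theta>" for c
    by (rule simple_fieldI[of _ "[:c:]" _ 1]) simp_all
  show "\<theta> \<in> simple_field \<theta>"
    by (rule simple_fieldI[of _ "[:0,1:]" _ 1]) (simp_all add: const_fract_hom)
  show "subfield_of_type (simple_field \<theta>)"
    unfolding subfield_of_type_def
  proof (intro conjI ballI)
    show "0 \<in> simple_field \<theta>" "1 \<in> simple_field \<theta>"
      using c[of 0] c[of 1] by (simp_all add: const_fract_hom)
    fix x assume "x \<in> simple_field \<theta>"
    then obtain A B where x: "x = eval_fract A \<theta> / eval_fract B \<theta>" "eval_fract B \<theta> \<noteq> 0"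
      unfolding simple_field_def by blast
    show "- x \<in> simple_field \<theta>"
      by (rule simple_fieldI[of _ "Polynomial.smult (-1) A" _ B]) (use x in \<open>simp_all add: const_fract_hom\<close>)
    show "inverse x \<in> simple_field \<theta>"
    proof (cases "eval_fract A \<theta> = 0")
      case True
      then show ?thesis using x c[of 0] by (simp add: const_fract_hom)
    next
      case False
      then show ?thesis using x by (intro simple_fieldI[of _ B _ A]) simp_all
    qed
    fix y assume "y \<in> simple_field \<theta>"
    then obtain A' B' where y: "y = eval_fract A' \<theta> / eval_fract B' \<theta>" "eval_fract B' \<theta> \<noteq> 0"
      unfolding simple_field_def by blast
    show "x + y \<in> simple_field \<theta>"
      by (rule simple_fieldI[of _ "A * B' + A' * B" _ "B * B'"]) (use x y in \<open>simp_all add: add_frac_eq\<close>)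
    show "x * y \<in> simple_field \<theta>"
      by (rule simple_fieldI[of _ "A * A'" _ "B * B'"]) (use x y in simp_all)
  qed
  show "simple_field \<theta> \<subseteq> S" if S: "subfield_of_type S" "\<And>c. const_fract c \<in> S" "\<theta> \<in> S"
  proof -
    have "eval_fract A \<theta> \<in> S" for A
      unfolding eval_fract_altdef[OF order_refl]
      by (intro subfield_of_type_sum subfield_of_typeD(4) subfield_of_type_power S)
    then show ?thesis unfolding simple_field_def using subfield_of_typeD(8)[OF S(1)] by auto
  qed
qed

lemma simple_field_minus: "simple_field (- \<theta>) = simple_field \<theta>"
proof
  have sub: "simple_field (- \<theta>) \<subseteq> simple_field \<theta>" for \<theta> :: "'a poly fract"
    using subfield_of_typeD(5)[OF simple_field(1) simple_field(3)]
    by (intro simple_field(4)[OF simple_field(1)] simple_field(2))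
  show "simple_field (- \<theta>) \<subseteq> simple_field \<theta>" by (rule sub)
  show "simple_field \<theta> \<subseteq> simple_field (- \<theta>)" using sub[of "- \<theta>"] by simp
qed

lemma subfield_with_X:
  assumes "subfield_of_type S" "\<And>c. const_fract c \<in> S" "X_fract \<in> S"
  shows "S = UNIV"
proof -
  have "z \<in> simple_field X_fract" for z :: "'a poly fract"
  proof (cases z rule: Fract_cases)
    case (Fract a b)
    then show ?thesis
      by (intro simple_fieldI[of _ a _ b]) (simp_all add: eval_fract_X Fract_eq_0_iff)
  qed
  then show ?thesis using simple_field(4)[OF assms] by blast
qed

section \<open>The function field of a rational curve\<close>

text \<open>
  A plane curve that is the image of the projective line under forms of degree \<open>n\<close>, which are given
  by the polynomials \<open>a\<close>, \<open>b\<close>, \<open>c\<close> in the affine coordinate \<open>u = s/t\<close>. The last assumption says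
  that the parametrization is birational: the quotients of \<open>a\<close>, \<open>b\<close>, \<open>c\<close> generate \<open>k(u)\<close>.
\<close>

locale rational_curve =
  fixes n :: nat and a b c :: "'k::alg_closed_field poly" and C :: "('k \<times> 'k \<times> 'k) set set"
  assumes degrees: "Polynomial.degree a \<le> n" "Polynomial.degree b \<le> n" "Polynomial.degree c \<le> n"
    and no_base_point: "(s, t) \<noteq> (0, 0) \<Longrightarrow> (form_value n a s t, form_value n b s t, form_value n c s t) \<noteq> (0, 0, 0)"
    and C_def: "C = {proj_point (form_value n a s t, form_value n b s t, form_value n c s t) | s t. (s, t) \<noteq> (0, 0)}"
    and birational: "subfield_of_type S \<Longrightarrow> (\<And>k. const_fract k \<in> S) \<Longrightarrow>
      (\<And>f g. f \<in> {a, b, c} \<Longrightarrow> g \<in> {a, b, c} \<Longrightarrow> g \<noteq> 0 \<Longrightarrow> Fract f g \<in> S) \<Longrightarrow> X_fract \<in> S"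

lemma poly_along_map_exists:
  fixes G :: "'k::field poly3"
  shows "\<exists>g. \<forall>u. poly g u = eval3 G (poly a u, poly b u, poly c u)"
proof -
  have 1: "\<exists>g. \<forall>u. poly g u = poly H (poly c u)" for H
    by (intro exI[of _ "pcompose H c"]) (simp add: poly_pcompose)
  have 2: "\<exists>g. \<forall>u. poly g u = poly (poly H [:poly b u:]) (poly c u)" for H :: "'k poly poly"
  proof (induction H)
    case (pCons h H)
    obtain g g' where "\<forall>u. poly g u = poly (poly H [:poly b u:]) (poly c u)" "\<forall>u. poly g' u = poly h (poly c u)"
      using pCons.IH 1 by blast
    then show ?case by (intro exI[of _ "g' + b * g"]) simp
  qed (auto intro: exI[of _ 0])
  show ?thesis
  proof (induction G)
    case (pCons h H)
    obtain g g' where "\<forall>u. poly g u = eval3 H (poly a u, poly b u, poly c u)" 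
      "\<forall>u. poly g' u = poly (poly h [:poly b u:]) (poly c u)"
      using pCons.IH 2 by blast
    then show ?case by (intro exI[of _ "g' + a * g"]) (simp add: eval3_def)
  qed (auto intro: exI[of _ 0])
qed

lemma poly_eq_iff_infinite: "(\<forall>u. poly f u = poly g u) \<longleftrightarrow> f = (g :: 'k::alg_closed_field poly)"
  using infinite_poly_eqI[OF infinite_alg_closed, of "{}" f g] by auto

text \<open>
  The composition of a polynomial in three variables with a parametrization. Over an infinite field
  it is characterized by its values, which avoids iterated composition of univariate polynomials.
\<close>

definition pull :: "'k::alg_closed_field poly \<Rightarrow> 'k poly \<Rightarrow> 'k poly \<Rightarrow> 'k poly3 \<Rightarrow> 'k poly" where
  "pull a b c G = (THE g. \<forall>u. poly g u = eval3 G (poly a u, poly b u, poly c u))"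

lemma poly_pull: "poly (pull a b c G) u = eval3 G (poly a u, poly b u, poly c u)"
proof -
  obtain g where g: "\<forall>u. poly g u = eval3 G (poly a u, poly b u, poly c u)"
    using poly_along_map_exists by blast
  have "\<forall>u. poly (pull a b c G) u = eval3 G (poly a u, poly b u, poly c u)"
    unfolding pull_def
    by (rule theI[of _ g]) (use g poly_eq_iff_infinite in metis)+
  then show ?thesis by blast
qed

lemma pull_eqI: "(\<And>u. eval3 G (poly a u, poly b u, poly c u) = poly g u) \<Longrightarrow> pull a b c G = g"
  using poly_eq_iff_infinite by (metis poly_pull)

lemma pull_simps [simp]:
  "pull a b c (F + G) = pull a b c F + pull a b c G" "pull a b c (F - G) = pull a b c F - pull a b c G"
  "pull a b c (F * G) = pull a b c F * pull a b c G" "pull a b c (F ^ n) = pull a b c F ^ n"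
  "pull a b c (const3 k) = [:k:]" "pull a b c 0 = 0" "pull a b c 1 = 1"
  "pull a b c [:0, 1:] = a" "pull a b c [:[:0, 1:]:] = b" "pull a b c [:[:[:0, 1:]:]:] = c"
  by (auto intro!: pull_eqI simp: poly_pull eval3_variables)

lemma pull_sum: "pull a b c (sum f I) = (\<Sum>i\<in>I. pull a b c (f i))"
  by (induction I rule: infinite_finite_induct) simp_all

lemma homogeneous_subst_binary_form:
  assumes "homogeneous 1 L" "homogeneous 1 M"
  shows "homogeneous d (subst_binary_form d k L M)"
  unfolding subst_binary_form_def
proof (rule homogeneous_sum)
  fix i assume "i \<in> {..d}"
  then have d: "1 * i + 1 * (d - i) = d" by simp
  have "homogeneous d (L ^ i * M ^ (d - i))"
    using homogeneous_mult[OF homogeneous_power[OF assms(1), of i] homogeneous_power[OF assms(2), of "d - i"]]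
    unfolding d .
  then show "homogeneous d (const3 (k i) * L ^ i * M ^ (d - i))"
    unfolding mult.assoc by (rule homogeneous_scale)
qed

text \<open>
  The operations of the function field are unions over all pairs of representatives, which
  give the same result.
\<close>

lemma UN_pairs_const:
  assumes "(a, b) \<in> A" "(a', b') \<in> B" "\<And>x y x' y'. (x, y) \<in> A \<Longrightarrow> (x', y') \<in> B \<Longrightarrow> f x x' y y' = c"
  shows "(\<Union>(x, y) \<in> A. \<Union>(x', y') \<in> B. f x x' y y') = c"
proof -
  have "(\<Union>(x', y') \<in> B. f x x' y y') = c" if "(x, y) \<in> A" for x y
  proof -
    have "(\<Union>(x', y') \<in> B. f x x' y y') = (\<Union>_ \<in> B. c)"
      using assms(3)[OF that] by (intro SUP_cong refl) (simp add: case_prod_beta)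
    then show ?thesis using assms(2) by auto
  qed
  then have "(\<Union>(x, y) \<in> A. \<Union>(x', y') \<in> B. f x x' y y') = (\<Union>_ \<in> A. c)"
    by (intro SUP_cong refl) (simp add: case_prod_beta)
  then show ?thesis using assms(1) by auto
qed

context rational_curve
begin

abbreviation "\<phi> \<equiv> pull a b c"

lemma eval3_point:
  assumes "t \<noteq> 0" "homogeneous d G"
  shows "eval3 G (form_value n a s t, form_value n b s t, form_value n c s t) =
    t ^ (n * d) * poly (\<phi> G) (s / t)"
proof -
  have "form_value n f s t = t ^ n * poly f (s / t)" if "Polynomial.degree f \<le> n" for f
    using form_value_affine[OF that, of t "s / t"] assms(1) by simp
  then have "eval3 G (form_value n a s t, form_value n b s t, form_value n c s t) =
      eval3 G (t ^ n * poly a (s / t), t ^ n * poly b (s / t), t ^ n * poly c (s / t))"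
    using degrees by simp
  then show ?thesis using eval3_homogeneous[OF assms(2)] by (simp add: poly_pull power_mult)
qed

text \<open>
  A form that vanishes at the points with \<open>t \<noteq> 0\<close> also vanishes at those with \<open>t = 0\<close>: for fixed
  \<open>s\<close>, its value is a polynomial in \<open>t\<close> with infinitely many zeros.
\<close>

lemma vanishes_on_iff:
  assumes G: "homogeneous d G"
  shows "vanishes_on C G \<longleftrightarrow> \<phi> G = 0"
proof
  assume v: "vanishes_on C G"
  have "poly (\<phi> G) u = 0" for u
  proof -
    let ?v = "(form_value n a u 1, form_value n b u 1, form_value n c u 1)"
    have "?v \<in> proj_point ?v" unfolding proj_point_def by (auto intro: exI[of _ 1])
    moreover have "proj_point ?v \<in> C" unfolding C_def by (intro CollectI exI[of _ u] exI[of _ 1]) simp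
    ultimately have "eval3 G ?v = 0" using v unfolding vanishes_on_def by blast
    then show ?thesis using eval3_point[OF _ G, of 1 u] by simp
  qed
  then show "\<phi> G = 0" using poly_eq_iff_infinite[of "\<phi> G" 0] by simp
next
  assume z: "\<phi> G = 0"
  have aff: "eval3 G (form_value n a s t, form_value n b s t, form_value n c s t) = 0" if "t \<noteq> 0" for s t
    using eval3_point[OF that G] z by simp
  have "eval3 G (form_value n a s t, form_value n b s t, form_value n c s t) = 0" for s t
  proof (cases "t = 0")
    case True
    define h where "h f = (\<Sum>i\<le>n. Polynomial.smult (Polynomial.coeff f i * s ^ i) ([:0, 1:] ^ (n - i)))" for f
    have h: "poly (h f) x = form_value n f s x" for f x
      unfolding h_def form_value_def by (simp add: poly_sum)
    have "pull (h a) (h b) (h c) G = 0"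
      by (rule infinite_poly_eqI[OF infinite_alg_closed, of "{0}"]) (auto simp: poly_pull h aff)
    then have "poly (pull (h a) (h b) (h c) G) t = 0" by simp
    then show ?thesis by (simp add: poly_pull h)
  qed (rule aff)
  then show "vanishes_on C G"
    unfolding vanishes_on_def C_def proj_point_def using eval3_homogeneous[OF G] by auto
qed

definition frac :: "'k poly3 \<times> 'k poly3 \<Rightarrow> 'k poly fract" where
  "frac p = Fract (\<phi> (fst p)) (\<phi> (snd p))"

lemma fractions_iff:
  "(G, H) \<in> fractions C \<longleftrightarrow> (\<exists>d. homogeneous d G \<and> homogeneous d H) \<and> \<phi> H \<noteq> 0"
  unfolding fractions_def using vanishes_on_iff by blast

lemma fraction_rel_iff:
  "(p, p') \<in> fraction_rel C \<longleftrightarrow> p \<in> fractions C \<and> p' \<in> fractions C \<and> frac p = frac p'"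
proof (cases p; cases p')
  fix G H G' H' assume p: "p = (G, H)" "p' = (G', H')"
  have "vanishes_on C (G * H' - G' * H) \<longleftrightarrow> frac p = frac p'" 
    if f: "(G, H) \<in> fractions C" "(G', H') \<in> fractions C"
  proof -
    obtain d d' where d: "homogeneous d G" "homogeneous d H" "\<phi> H \<noteq> 0" 
      "homogeneous d' G'" "homogeneous d' H'" "\<phi> H' \<noteq> 0"
      using f unfolding fractions_iff by blast
    have "homogeneous (d + d') (G * H' + const3 (-1) * (G' * H))"
      using homogeneous_mult[OF d(1,5)] homogeneous_mult[OF d(4,2)]
      by (intro homogeneous_add homogeneous_scale) (simp_all add: add.commute)
    moreover have "const3 (-1) * F = - F" for F :: "'k poly3"
    proof -
      have "[:[:- 1:]:] = (- 1 :: 'k poly poly)" by (simp add: one_pCons)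
      then show ?thesis by (simp add: const3_def)
    qed
    ultimately have "homogeneous (d + d') (G * H' - G' * H)" by simp
    from vanishes_on_iff[OF this] show ?thesis
      using d by (simp add: p frac_def eq_fract)
  qed
  then show ?thesis unfolding fraction_rel_def p by auto
qed

lemma mem_fraction: "p \<in> fraction C G H \<longleftrightarrow> p \<in> fractions C \<and> (G, H) \<in> fractions C \<and> frac p = frac (G, H)"
  unfolding fraction_def by (auto simp: fraction_rel_iff)

lemma fraction_eq: "p \<in> fractions C \<Longrightarrow> (G, H) \<in> fractions C \<Longrightarrow> frac p = frac (G, H) \<Longrightarrow> fraction C (fst p) (snd p) = fraction C G H"
  by (auto simp: mem_fraction)

lemma carrier_cases:
  assumes "A \<in> carrier (function_field C)"
  obtains G H where "(G, H) \<in> fractions C" "A = fraction C G H"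
  using assms unfolding function_field_def fraction_def by (auto elim!: quotientE)

lemma fraction_in_carrier: "(G, H) \<in> fractions C \<Longrightarrow> fraction C G H \<in> carrier (function_field C)"
  unfolding function_field_def fraction_def by (auto intro: quotientI)

text \<open>
  The isomorphism of \<open>k(C)\<close> with \<open>k(u)\<close> that restricts \<open>G/H\<close> to the parametrized curve. All
  representatives of a class have the same restriction by \<open>fraction_rel_iff\<close>.
\<close>

definition \<psi> :: "('k poly3 \<times> 'k poly3) set \<Rightarrow> 'k poly fract" where
  "\<psi> A = frac (SOME p. p \<in> A)"

lemma \<psi>_fraction: 
  assumes "(G, H) \<in> fractions C"
  shows "\<psi> (fraction C G H) = Fract (\<phi> G) (\<phi> H)"
proof -
  have "(G, H) \<in> fraction C G H" using assms by (simp add: mem_fraction)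
  then have "(SOME p. p \<in> fraction C G H) \<in> fraction C G H" by (rule someI)
  then show ?thesis unfolding \<psi>_def by (auto simp: mem_fraction frac_def)
qed

lemma fractions_op:
  assumes "(G, H) \<in> fractions C" "(G', H') \<in> fractions C"
  shows "(G * G', H * H') \<in> fractions C" "(G * H' + G' * H, H * H') \<in> fractions C"
    "frac (G * G', H * H') = frac (G, H) * frac (G', H')"
    "frac (G * H' + G' * H, H * H') = frac (G, H) + frac (G', H')"
proof -
  obtain d d' where d: "homogeneous d G" "homogeneous d H" "\<phi> H \<noteq> 0" 
    "homogeneous d' G'" "homogeneous d' H'" "\<phi> H' \<noteq> 0"
    using assms unfolding fractions_iff by blast
  show "(G * G', H * H') \<in> fractions C" "(G * H' + G' * H, H * H') \<in> fractions C"
    using d homogeneous_mult[of d G d' G'] homogeneous_mult[of d H d' H'] 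
      homogeneous_mult[of d G d' H'] homogeneous_mult[of d' G' d H]
    unfolding fractions_iff by (auto intro!: exI[of _ "d + d'"] homogeneous_add simp: add.commute)
  show "frac (G * G', H * H') = frac (G, H) * frac (G', H')"
    "frac (G * H' + G' * H, H * H') = frac (G, H) + frac (G', H')"
    using d by (simp_all add: frac_def)
qed

lemma function_field_ops:
  assumes "(G, H) \<in> fractions C" "(G', H') \<in> fractions C"
  shows "fraction C G H \<otimes>\<^bsub>function_field C\<^esub> fraction C G' H' = fraction C (G * G') (H * H')"
    "fraction C G H \<oplus>\<^bsub>function_field C\<^esub> fraction C G' H' = fraction C (G * H' + G' * H) (H * H')"
proof -
  have ne: "(G, H) \<in> fraction C G H" "(G', H') \<in> fraction C G' H'"
    using assms by (simp_all add: mem_fraction)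
  have m: "fraction C (G1 * G2) (H1 * H2) = fraction C (G * G') (H * H')"
    "fraction C (G1 * H2 + G2 * H1) (H1 * H2) = fraction C (G * H' + G' * H) (H * H')"
    if "(G1, H1) \<in> fraction C G H" "(G2, H2) \<in> fraction C G' H'" for G1 H1 G2 H2
  proof -
    have "(G1, H1) \<in> fractions C" "(G2, H2) \<in> fractions C" "frac (G1, H1) = frac (G, H)" "frac (G2, H2) = frac (G', H')"
      using that by (simp_all add: mem_fraction)
    then show "fraction C (G1 * G2) (H1 * H2) = fraction C (G * G') (H * H')"
    "fraction C (G1 * H2 + G2 * H1) (H1 * H2) = fraction C (G * H' + G' * H) (H * H')"
      using fraction_eq[of "(G1 * G2, H1 * H2)" "G * G'" "H * H'"]
        fraction_eq[of "(G1 * H2 + G2 * H1, H1 * H2)" "G * H' + G' * H" "H * H'"]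
        fractions_op[of G1 H1 G2 H2] fractions_op[OF assms] by simp_all
  qed
  show "fraction C G H \<otimes>\<^bsub>function_field C\<^esub> fraction C G' H' = fraction C (G * G') (H * H')"
    unfolding function_field_def monoid.select_convs by (rule UN_pairs_const[OF ne m(1)])
  show "fraction C G H \<oplus>\<^bsub>function_field C\<^esub> fraction C G' H' = fraction C (G * H' + G' * H) (H * H')"
    unfolding function_field_def ring.select_convs by (rule UN_pairs_const[OF ne m(2)])
qed

lemma one_fractions: "(1, 1) \<in> fractions C" "(0, 1) \<in> fractions C" "(const3 k, 1) \<in> fractions C"
  unfolding fractions_iff using homogeneous_one homogeneous_zero homogeneous_const by auto

lemma range_subfield: "subfield_of_type (\<psi> ` carrier (function_field C))"
proof -
  have mem: "frac p \<in> \<psi> ` carrier (function_field C)" if "p \<in> fractions C" for p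
    using that fraction_in_carrier \<psi>_fraction[of "fst p" "snd p"] unfolding frac_def
    by (metis imageI prod.collapse)
  show ?thesis
    unfolding subfield_of_type_def
  proof (intro conjI ballI)
    show "0 \<in> \<psi> ` carrier (function_field C)" "1 \<in> \<psi> ` carrier (function_field C)"
      using mem[OF one_fractions(1)] mem[OF one_fractions(2)]
      by (simp_all add: frac_def Zero_fract_def One_fract_def)
    fix x assume "x \<in> \<psi> ` carrier (function_field C)"
    then obtain G H where GH: "(G, H) \<in> fractions C" "x = frac (G, H)"
      using \<psi>_fraction unfolding frac_def by (auto elim!: carrier_cases)
    show "- x \<in> \<psi> ` carrier (function_field C)"
    proof -
      have "frac (const3 (-1), 1) = - 1"
      proof -
        have "const_fract (- 1 :: 'k) = - 1" by (simp only: const_fract_hom)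
        then show ?thesis by (simp add: frac_def const_fract_def)
      qed
      then show ?thesis
        using mem[OF fractions_op(1)[OF one_fractions(3)[of "-1"] GH(1)]] GH(2)
          fractions_op(3)[OF one_fractions(3)[of "-1"] GH(1)] by simp
    qed
    show "inverse x \<in> \<psi> ` carrier (function_field C)"
    proof (cases "\<phi> G = 0")
      case True
      then show ?thesis using GH(2) mem[OF one_fractions(2)] 
        by (simp add: frac_def fract_collapse)
    next
      case False
      then have "(H, G) \<in> fractions C" using GH(1) unfolding fractions_iff by blast
      from mem[OF this] show ?thesis using GH(2) by (simp add: frac_def)
    qed
    fix y assume "y \<in> \<psi> ` carrier (function_field C)"
    then obtain G' H' where GH': "(G', H') \<in> fractions C" "y = frac (G', H')"
      using \<psi>_fraction unfolding frac_def by (auto elim!: carrier_cases)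
    show "x + y \<in> \<psi> ` carrier (function_field C)" "x * y \<in> \<psi> ` carrier (function_field C)"
      using mem[OF fractions_op(1)[OF GH(1) GH'(1)]] mem[OF fractions_op(2)[OF GH(1) GH'(1)]]
        fractions_op(3,4)[OF GH(1) GH'(1)] GH(2) GH'(2) by simp_all
  qed
qed

text \<open>Birationality is what makes \<open>\<psi>\<close> surjective.\<close>

lemma range_\<psi>: "\<psi> ` carrier (function_field C) = UNIV"
proof (rule subfield_with_X)
  have mem: "frac p \<in> \<psi> ` carrier (function_field C)" if "p \<in> fractions C" for p
    using that fraction_in_carrier \<psi>_fraction[of "fst p" "snd p"] unfolding frac_def
    by (metis imageI prod.collapse)
  show c: "const_fract k \<in> \<psi> ` carrier (function_field C)" for k
    using mem[OF one_fractions(3)] by (simp add: frac_def const_fract_def)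
  show "X_fract \<in> \<psi> ` carrier (function_field C)"
  proof (rule birational[OF range_subfield c])
    fix f g assume "f \<in> {a, b, c}" "g \<in> {a, b, c}" "g \<noteq> 0"
    then obtain F G where "homogeneous 1 F" "homogeneous 1 G" "\<phi> F = f" "\<phi> G = g"
      using homogeneous_variables pull_simps(8-10)[of a b c] by (metis insertE singletonD)
    then show "Fract f g \<in> \<psi> ` carrier (function_field C)"
      using mem[of "(F, G)"] \<open>g \<noteq> 0\<close> unfolding frac_def fractions_iff by auto
  qed
qed (rule range_subfield)

sublocale function_field: field_copy "function_field C" \<psi>
proof
  have "inj_on \<psi> (carrier (function_field C))"
  proof (rule inj_onI)
    fix A B assume AB: "A \<in> carrier (function_field C)" "B \<in> carrier (function_field C)" "\<psi> A = \<psi> B"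
    then obtain G H G' H' where *: "(G, H) \<in> fractions C" "A = fraction C G H"
      "(G', H') \<in> fractions C" "B = fraction C G' H'" by (metis carrier_cases)
    then have "frac (G, H) = frac (G', H')" using AB(3) by (simp add: \<psi>_fraction frac_def)
    then show "A = B" using fraction_eq[OF *(1,3)] * by simp
  qed
  then show "bij_betw \<psi> (carrier (function_field C)) UNIV"
    using range_\<psi> by (simp add: bij_betw_def)
  show "\<one>\<^bsub>function_field C\<^esub> \<in> carrier (function_field C)" "\<zero>\<^bsub>function_field C\<^esub> \<in> carrier (function_field C)"
    using fraction_in_carrier[OF one_fractions(1)] fraction_in_carrier[OF one_fractions(2)]
    by (simp_all add: function_field_def)
  show "\<psi> \<one>\<^bsub>function_field C\<^esub> = 1" "\<psi> \<zero>\<^bsub>function_field C\<^esub> = 0"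
    using \<psi>_fraction[OF one_fractions(1)] \<psi>_fraction[OF one_fractions(2)]
    by (simp_all add: function_field_def One_fract_def Zero_fract_def)
next
  fix A B assume "A \<in> carrier (function_field C)" "B \<in> carrier (function_field C)"
  then obtain G H G' H' where *: "(G, H) \<in> fractions C" "A = fraction C G H"
    "(G', H') \<in> fractions C" "B = fraction C G' H'" by (metis carrier_cases)
  show "A \<otimes>\<^bsub>function_field C\<^esub> B \<in> carrier (function_field C)" "A \<oplus>\<^bsub>function_field C\<^esub> B \<in> carrier (function_field C)"
    "\<psi> (A \<otimes>\<^bsub>function_field C\<^esub> B) = \<psi> A * \<psi> B" "\<psi> (A \<oplus>\<^bsub>function_field C\<^esub> B) = \<psi> A + \<psi> B"
    using fractions_op[OF *(1,3)] unfolding *(2,4) function_field_ops[OF *(1,3)]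
    by (simp_all add: fraction_in_carrier \<psi>_fraction *(1,3) frac_def)
qed

section \<open>The field of a projection\<close>

lemma pull_subst_binary_form:
  "\<phi> (subst_binary_form d k L M) = (\<Sum>i\<le>d. Polynomial.smult (k i) (\<phi> L ^ i * \<phi> M ^ (d - i)))"
  unfolding subst_binary_form_def by (simp add: pull_sum mult.assoc)

lemma subst_binary_form_fractions:
  assumes "linear_projection P L M" "\<not> vanishes_on C (subst_binary_form d b' L M)"
  shows "(subst_binary_form d a' L M, subst_binary_form d b' L M) \<in> fractions C"
  using homogeneous_subst_binary_form assms unfolding fractions_def linear_projection_def by blast

lemma projection_subfield_carrier: "projection_subfield C P \<subseteq> carrier (function_field C)"
  unfolding projection_subfield_def
  using fraction_in_carrier subst_binary_form_fractions by auto

text \<open>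
  If two linear forms have \<open>P\<close> as their only common zero, their restrictions to the curve are
  combinations of \<open>f\<close> and \<open>g\<close>. Hence quotients of binary forms of the same degree in them are
  rational functions of \<open>f/g\<close>; conversely, \<open>L0\<close> and \<open>M0\<close> themselves yield all of these.
\<close>

lemma projection_subfield:
  assumes P: "linear_projection P L0 M0" and fg: "f = \<phi> L0" "g = \<phi> M0" and M0: "g \<noteq> 0"
    and span: "\<And>L. homogeneous 1 L \<Longrightarrow> (\<And>v. v \<in> P \<Longrightarrow> eval3 L v = 0) \<Longrightarrow>
      \<exists>\<alpha> \<beta>. \<phi> L = Polynomial.smult \<alpha> f + Polynomial.smult \<beta> g"
  shows "\<psi> ` projection_subfield C P = simple_field (Fract f g)"
proof
  define \<theta> where "\<theta> = Fract f g"
  note S = simple_field[where \<theta> = \<theta>]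
  have f: "Fract f 1 = \<theta> * Fract g 1"
    using M0 unfolding \<theta>_def by (simp add: eq_fract)
  have g1: "Fract g 1 \<noteq> 0" using M0 by (simp add: Fract_eq_0_iff)
  have Fs: "Fract (sum h I) 1 = (\<Sum>i\<in>I. Fract (h i) 1)" for h :: "nat \<Rightarrow> 'k poly" and I
    unfolding eval_fract_X[symmetric] by (rule eval_fract_sum)
  have Fm: "Fract (x * y) 1 = Fract x 1 * Fract y 1" for x y :: "'k poly"
    unfolding eval_fract_X[symmetric] by simp
  have Fp: "Fract (x ^ i) 1 = Fract x 1 ^ i" for x :: "'k poly" and i
    unfolding eval_fract_X[symmetric] by simp
  have Fc: "Fract (Polynomial.smult k x) 1 = const_fract k * Fract x 1" for k and x :: "'k poly"
    unfolding eval_fract_X[symmetric] by simp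
  show "\<psi> ` projection_subfield C P \<subseteq> simple_field (Fract f g)"
  proof
    fix z assume "z \<in> \<psi> ` projection_subfield C P"
    then obtain d a' b' L M where z: "linear_projection P L M" "\<not> vanishes_on C (subst_binary_form d b' L M)"
      "z = \<psi> (fraction C (subst_binary_form d a' L M) (subst_binary_form d b' L M))"
      unfolding projection_subfield_def by blast
    have lin: "homogeneous 1 L" "homogeneous 1 M"
      "\<And>v. v \<in> P \<Longrightarrow> eval3 L v = 0" "\<And>v. v \<in> P \<Longrightarrow> eval3 M v = 0"
      using z(1) unfolding linear_projection_def by auto
    have lin_ex: "\<exists>x\<in>simple_field \<theta>. Fract (\<phi> L') 1 = x * Fract g 1" 
      if L': "homogeneous 1 L'" "\<And>v. v \<in> P \<Longrightarrow> eval3 L' v = 0" for L'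
    proof -
      obtain \<alpha> \<beta> where "\<phi> L' = Polynomial.smult \<alpha> f + Polynomial.smult \<beta> g"
        using span[OF L'] by blast
      then have "Fract (\<phi> L') 1 = Fract (Polynomial.smult \<alpha> f) 1 + Fract (Polynomial.smult \<beta> g) 1" by simp
      also have "\<dots> = const_fract \<alpha> * (\<theta> * Fract g 1) + const_fract \<beta> * Fract g 1" by (simp only: Fc f)
      also have "\<dots> = (const_fract \<alpha> * \<theta> + const_fract \<beta>) * Fract g 1"
        by (simp only: algebra_simps)
      finally show ?thesis
        using subfield_of_typeD(3,4)[OF S(1)] S(2,3) by blast
    qed
    obtain x y where xy: "x \<in> simple_field \<theta>" "y \<in> simple_field \<theta>" 
      "Fract (\<phi> L) 1 = x * Fract g 1" "Fract (\<phi> M) 1 = y * Fract g 1"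
      using lin_ex[OF lin(1,3)] lin_ex[OF lin(2,4)] by blast
    have form: "\<exists>w\<in>simple_field \<theta>. Fract (\<phi> (subst_binary_form d k L M)) 1 = w * Fract g 1 ^ d" for k
    proof (intro bexI)
      have "Fract (\<phi> (subst_binary_form d k L M)) 1 = 
          (\<Sum>i\<le>d. const_fract (k i) * ((x * Fract g 1) ^ i * (y * Fract g 1) ^ (d - i)))"
        unfolding pull_subst_binary_form Fs Fc Fm Fp xy(3,4) ..
      also have "\<dots> = (\<Sum>i\<le>d. const_fract (k i) * x ^ i * y ^ (d - i) * Fract g 1 ^ d)"
      proof (intro sum.cong refl)
        fix i assume "i \<in> {..d}"
        then have "Fract g 1 ^ d = Fract g 1 ^ i * Fract g 1 ^ (d - i)"
          by (metis atMost_iff le_add_diff_inverse power_add)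
        then show "const_fract (k i) * ((x * Fract g 1) ^ i * (y * Fract g 1) ^ (d - i)) =
          const_fract (k i) * x ^ i * y ^ (d - i) * Fract g 1 ^ d"
          by (simp only: power_mult_distrib mult_ac)
      qed
      finally show "Fract (\<phi> (subst_binary_form d k L M)) 1 =
          (\<Sum>i\<le>d. const_fract (k i) * x ^ i * y ^ (d - i)) * Fract g 1 ^ d"
        by (simp only: sum_distrib_right)
      show "(\<Sum>i\<le>d. const_fract (k i) * x ^ i * y ^ (d - i)) \<in> simple_field \<theta>"
        by (intro subfield_of_type_sum[OF S(1)] subfield_of_typeD(4)[OF S(1)] 
            subfield_of_type_power[OF S(1)] S(2) xy)
    qed
    have den: "\<phi> (subst_binary_form d b' L M) \<noteq> 0"
      using z(2) vanishes_on_iff[OF homogeneous_subst_binary_form[OF lin(1,2)]] by blast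
    obtain w w' where w: "w \<in> simple_field \<theta>" "w' \<in> simple_field \<theta>"
      "Fract (\<phi> (subst_binary_form d a' L M)) 1 = w * Fract g 1 ^ d" 
      "Fract (\<phi> (subst_binary_form d b' L M)) 1 = w' * Fract g 1 ^ d" using form by metis
    have "z = Fract (\<phi> (subst_binary_form d a' L M)) 1 / Fract (\<phi> (subst_binary_form d b' L M)) 1"
      unfolding z(3) \<psi>_fraction[OF subst_binary_form_fractions[OF z(1,2)]]
      by (rule Fract_eq_divide[OF den])
    also have "\<dots> = w / w'" using g1 unfolding w(3,4) by simp
    finally show "z \<in> simple_field (Fract f g)"
      using subfield_of_typeD(8)[OF S(1) w(1,2)] unfolding \<theta>_def by simp
  qed
  show "simple_field (Fract f g) \<subseteq> \<psi> ` projection_subfield C P"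
  proof
    fix z assume "z \<in> simple_field (Fract f g)"
    then obtain A B where z: "z = eval_fract A \<theta> / eval_fract B \<theta>" "eval_fract B \<theta> \<noteq> 0"
      unfolding simple_field_def \<theta>_def by blast
    define d where "d = max (Polynomial.degree A) (Polynomial.degree B)"
    have form: "Fract (\<phi> (subst_binary_form d (Polynomial.coeff Q) L0 M0)) 1 = eval_fract Q \<theta> * Fract g 1 ^ d"
      if "Polynomial.degree Q \<le> d" for Q
    proof -
      have "Fract (\<phi> (subst_binary_form d (Polynomial.coeff Q) L0 M0)) 1 =
        (\<Sum>i\<le>d. const_fract (Polynomial.coeff Q i) * ((\<theta> * Fract g 1) ^ i * Fract g 1 ^ (d - i)))"
        unfolding pull_subst_binary_form Fs Fc Fm Fp fg(1,2)[symmetric] f ..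
      also have "\<dots> = (\<Sum>i\<le>d. const_fract (Polynomial.coeff Q i) * \<theta> ^ i * Fract g 1 ^ d)"
      proof (intro sum.cong refl)
        fix i assume "i \<in> {..d}"
        then have "Fract g 1 ^ d = Fract g 1 ^ i * Fract g 1 ^ (d - i)"
          by (metis atMost_iff le_add_diff_inverse power_add)
        then show "const_fract (Polynomial.coeff Q i) * ((\<theta> * Fract g 1) ^ i * Fract g 1 ^ (d - i)) =
          const_fract (Polynomial.coeff Q i) * \<theta> ^ i * Fract g 1 ^ d"
          by (simp only: power_mult_distrib mult_ac)
      qed
      also have "\<dots> = eval_fract Q \<theta> * Fract g 1 ^ d"
        unfolding eval_fract_altdef[OF that] by (simp only: sum_distrib_right)
      finally show ?thesis .
    qed
    let ?A = "subst_binary_form d (Polynomial.coeff A) L0 M0" and ?B = "subst_binary_form d (Polynomial.coeff B) L0 M0"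
    have A: "Fract (\<phi> ?A) 1 = eval_fract A \<theta> * Fract g 1 ^ d" and B: "Fract (\<phi> ?B) 1 = eval_fract B \<theta> * Fract g 1 ^ d"
      using form[of A] form[of B] unfolding d_def by simp_all
    have "Fract (\<phi> ?B) 1 \<noteq> 0" unfolding B using z(2) g1 by simp
    then have den: "\<phi> ?B \<noteq> 0" by (simp add: Fract_eq_0_iff)
    then have nv: "\<not> vanishes_on C ?B"
      using vanishes_on_iff[OF homogeneous_subst_binary_form] P unfolding linear_projection_def by blast
    have "\<psi> (fraction C ?A ?B) = Fract (\<phi> ?A) 1 / Fract (\<phi> ?B) 1"
      unfolding \<psi>_fraction[OF subst_binary_form_fractions[OF P nv]] by (rule Fract_eq_divide[OF den])
    also have "\<dots> = z" unfolding A B z(1) using g1 by simp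
    finally have "z = \<psi> (fraction C ?A ?B)" by simp
    moreover have "fraction C ?A ?B \<in> projection_subfield C P"
      unfolding projection_subfield_def using P nv by blast
    ultimately show "z \<in> \<psi> ` projection_subfield C P" by blast
  qed
qed

end

section \<open>Substitutions in the rational function field\<close>

text \<open>
  A polynomial over \<open>k\<close> splits into linear factors, none of which vanishes at a nonconstant \<open>r\<close>.
\<close>

lemma eval_fract_eq_0:
  fixes Q :: "'k::alg_closed_field poly"
  assumes "r \<notin> range const_fract" "eval_fract Q r = 0"
  shows "Q = 0"
  using assms(2)
proof (induction "Polynomial.degree Q" arbitrary: Q)
  case 0
  then obtain c where "Q = [:c:]" by (metis degree_eq_zeroE)
  then show ?case using 0 by (simp add: const_fract_eq_0)
next
  case (Suc d)
  then obtain \<rho> where "poly Q \<rho> = 0" using alg_closed_imp_poly_has_root[of Q] by auto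
  then obtain Q' where Q': "Q = [:- \<rho>, 1:] * Q'" unfolding poly_eq_0_iff_dvd by (elim dvdE)
  have "Q \<noteq> 0" using Suc(2) by auto
  then have "Q' \<noteq> 0" using Q' by auto
  then have "Polynomial.degree Q' = d" using Suc(2) unfolding Q' by (subst (asm) degree_mult_eq) auto
  moreover have "eval_fract Q r = (r - const_fract \<rho>) * eval_fract Q' r"
    unfolding Q' eval_fract_simps(7) by (simp add: const_fract_hom)
  moreover have "r - const_fract \<rho> \<noteq> 0" using assms(1) by auto
  ultimately show ?case using Suc(1)[of Q'] Suc(3) Q' by simp
qed

text \<open>
  The endomorphism of \<open>k(u)\<close> that maps \<open>u\<close> to \<open>r\<close>. For nonconstant \<open>r\<close> the denominator does not
  vanish at \<open>r\<close>, and the value is the same for all representations \<open>P/Q\<close> of \<open>z\<close>.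
\<close>

definition subst_fract :: "'k::alg_closed_field poly fract \<Rightarrow> 'k poly fract \<Rightarrow> 'k poly fract" where
  "subst_fract r z = (SOME w. \<exists>P Q. Q \<noteq> 0 \<and> z = Fract P Q \<and> w = eval_fract P r / eval_fract Q r)"

lemma subst_Fract:
  assumes r: "r \<notin> range const_fract" and "Q \<noteq> 0"
  shows "subst_fract r (Fract P Q) = eval_fract P r / eval_fract Q r"
  unfolding subst_fract_def
proof (rule some_equality)
  show "\<exists>P' Q'. Q' \<noteq> 0 \<and> Fract P Q = Fract P' Q' \<and> eval_fract P r / eval_fract Q r = eval_fract P' r / eval_fract Q' r"
    using assms(2) by blast
next
  fix w assume "\<exists>P' Q'. Q' \<noteq> 0 \<and> Fract P Q = Fract P' Q' \<and> w = eval_fract P' r / eval_fract Q' r"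
  then obtain P' Q' where *: "Q' \<noteq> 0" "Fract P Q = Fract P' Q'" "w = eval_fract P' r / eval_fract Q' r" by blast
  have "P * Q' = P' * Q" using *(1,2) assms(2) by (simp add: eq_fract)
  then have "eval_fract P r * eval_fract Q' r = eval_fract P' r * eval_fract Q r"
    by (metis eval_fract_simps(7))
  then show "w = eval_fract P r / eval_fract Q r"
    using eval_fract_eq_0[OF r] *(1,3) assms(2) by (metis frac_eq_eq)
qed

context
  fixes r :: "'k::alg_closed_field poly fract"
  assumes r: "r \<notin> range const_fract"
begin

lemma subst_fract_add: "subst_fract r (x + y) = subst_fract r x + subst_fract r y"
proof (cases x rule: Fract_cases, cases y rule: Fract_cases)
  fix a b a' b' assume *: "x = Fract a b" "b \<noteq> 0" "y = Fract a' b'" "b' \<noteq> 0"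
  then have "eval_fract b r \<noteq> 0" "eval_fract b' r \<noteq> 0" using eval_fract_eq_0[OF r] by auto
  then show ?thesis using * by (simp add: subst_Fract[OF r] add_frac_eq)
qed

lemma subst_fract_mult: "subst_fract r (x * y) = subst_fract r x * subst_fract r y"
proof (cases x rule: Fract_cases, cases y rule: Fract_cases)
  fix a b a' b' assume *: "x = Fract a b" "b \<noteq> 0" "y = Fract a' b'" "b' \<noteq> 0"
  then show ?thesis by (simp add: subst_Fract[OF r])
qed

lemma subst_fract_const: "subst_fract r (const_fract c) = const_fract c"
proof -
  have "subst_fract r (Fract [:c:] 1) = const_fract c" by (subst subst_Fract[OF r]) simp_all
  then show ?thesis by (simp add: const_fract_def)
qed

lemma subst_fract_X: "subst_fract r X_fract = r"
  unfolding X_fract_def by (subst subst_Fract[OF r]) (simp_all add: const_fract_hom)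

lemma subst_fract_numerals: "subst_fract r 0 = 0" "subst_fract r 1 = 1"
  using subst_fract_const[of 0] subst_fract_const[of 1] by (simp_all add: const_fract_hom)

lemma subst_fract_inverse: "subst_fract r (inverse x) = inverse (subst_fract r x)"
proof (cases "x = 0")
  case False
  then have "subst_fract r (inverse x) * subst_fract r x = 1"
    using subst_fract_mult[of "inverse x" x] by (simp add: subst_fract_numerals)
  then show ?thesis by (metis inverse_unique mult.commute)
qed (simp add: subst_fract_numerals)

lemma subst_fract_divide: "subst_fract r (x / y) = subst_fract r x / subst_fract r y"
  by (simp add: field_class.field_divide_inverse subst_fract_mult subst_fract_inverse)

lemma subst_fract_diff: "subst_fract r (x - y) = subst_fract r x - subst_fract r y"
  using subst_fract_add[of "x - y" y] by simp

lemma subst_fract_power: "subst_fract r (x ^ i) = subst_fract r x ^ i"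
  by (induction i) (simp_all add: subst_fract_numerals subst_fract_mult)

lemma subst_eval_fract: "subst_fract r (eval_fract P z) = eval_fract P (subst_fract r z)"
  by (induction P) (simp_all add: subst_fract_add subst_fract_mult subst_fract_const subst_fract_numerals)

lemma subst_fract_fixes: 
  assumes "subst_fract r \<theta> = \<theta>" "z \<in> simple_field \<theta>"
  shows "subst_fract r z = z"
  using assms unfolding simple_field_def by (auto simp: subst_fract_divide subst_eval_fract)

end

section \<open>The fibres of a rational function\<close>

text \<open>
  The polynomial \<open>f(T) - \<theta> g(T)\<close> for \<open>\<theta> = f/g\<close>. It is an equation of \<open>u\<close> over \<open>k(\<theta>)\<close>, and its roots are
  the conjugates of \<open>u\<close>.
\<close>

definition fibre_poly :: "'k::field poly \<Rightarrow> 'k poly \<Rightarrow> 'k poly fract poly" where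
  "fibre_poly f g = map_poly const_fract f - Polynomial.smult (Fract f g) (map_poly const_fract g)"

lemma poly_fibre_poly: "poly (fibre_poly f g) r = eval_fract f r - Fract f g * eval_fract g r"
  by (simp add: fibre_poly_def eval_fract_def)

lemma fibre_poly_roots:
  assumes "g \<noteq> 0"
  shows "poly (fibre_poly f g) r = 0 \<longleftrightarrow> eval_fract f r * Fract g 1 = eval_fract g r * Fract f 1"
proof -
  have *: "x - a / b * y = 0 \<longleftrightarrow> x * b = y * a" if "b \<noteq> 0" for x y a b :: "'a poly fract"
    using that by (simp add: field_simps)
  have "Fract g 1 \<noteq> 0" using assms by (simp add: Fract_eq_0_iff)
  then show ?thesis unfolding poly_fibre_poly Fract_eq_divide[OF assms, of f] by (rule *)
qed

lemma fibre_poly_over: "poly_over (simple_field (Fract f g)) (fibre_poly f g)"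
  unfolding poly_over_def fibre_poly_def
  by (auto simp: coeff_map_poly const_fract_hom intro!: subfield_of_typeD[OF simple_field(1)] simple_field(2,3))

lemma fibre_poly_X: "g \<noteq> 0 \<Longrightarrow> poly (fibre_poly f g) X_fract = 0"
  by (simp add: fibre_poly_roots eval_fract_X mult.commute)

lemma degree_fibre_poly:
  assumes "Polynomial.degree f \<le> n" "Polynomial.degree g \<le> n"
  shows "Polynomial.degree (fibre_poly f g) \<le> n"
  unfolding fibre_poly_def using assms
  by (intro degree_diff_le) (auto intro: order_trans[OF map_poly_degree_leq] order_trans[OF degree_smult_le])

text \<open>
  A coefficient \<open>a - \<theta> b\<close> with constants \<open>a\<close> and \<open>b\<close>, not both zero, vanishes only if \<open>\<theta>\<close> is constant.
\<close>

lemma coeff_fibre_poly: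
  assumes g: "g \<noteq> 0" and f: "\<And>c. f \<noteq> Polynomial.smult c g"
    and i: "Polynomial.coeff f i \<noteq> 0 \<or> Polynomial.coeff g i \<noteq> 0"
  shows "Polynomial.coeff (fibre_poly f g) i \<noteq> 0"
proof
  assume "Polynomial.coeff (fibre_poly f g) i = 0"
  then have "Fract f g * const_fract (Polynomial.coeff g i) = const_fract (Polynomial.coeff f i)"
    by (simp add: fibre_poly_def coeff_map_poly const_fract_hom)
  then have "Polynomial.smult (Polynomial.coeff g i) f = Polynomial.smult (Polynomial.coeff f i) g"
    using g by (simp add: const_fract_def eq_fract mult.commute)
  moreover from this have "Polynomial.coeff g i \<noteq> 0" using i g by auto
  ultimately have "f = Polynomial.smult (Polynomial.coeff f i / Polynomial.coeff g i) g"
    by (metis nonzero_mult_div_cancel_left smult_eq_iff)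
  then show False using f by blast
qed

lemma dvd_mult_no_common_root:
  fixes f g h :: "'k::alg_closed_field poly"
  assumes "f dvd g * h" "f \<noteq> 0" "\<And>x. poly f x = 0 \<Longrightarrow> poly g x \<noteq> 0"
  shows "f dvd h"
  using assms
proof (induction "Polynomial.degree f" arbitrary: f h)
  case 0
  then show ?case by (metis is_unit_iff_degree unit_imp_dvd)
next
  case (Suc d)
  then obtain \<rho> where \<rho>: "poly f \<rho> = 0" using alg_closed_imp_poly_has_root[of f] by auto
  then obtain f' where f': "f = [:- \<rho>, 1:] * f'" unfolding poly_eq_0_iff_dvd by (elim dvdE)
  have f0: "f' \<noteq> 0" using Suc.prems(2) f' by auto
  have "Polynomial.degree f' = d" using Suc(2) f0 unfolding f' by (subst (asm) degree_mult_eq) auto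
  have "poly (g * h) \<rho> = 0" using Suc.prems(1) \<rho> by (metis dvdE mult_eq_0_iff poly_mult)
  then have "poly h \<rho> = 0" using Suc.prems(3)[OF \<rho>] by simp
  then obtain h' where h': "h = [:- \<rho>, 1:] * h'" unfolding poly_eq_0_iff_dvd by (elim dvdE)
  have "[:- \<rho>, 1:] * f' dvd [:- \<rho>, 1:] * (g * h')"
    using Suc.prems(1) unfolding f' h' by (simp only: mult_ac)
  then have "f' dvd g * h'" by (subst (asm) dvd_mult_cancel_left) auto
  then have "f' dvd h'"
    using Suc(1)[of f' h'] f0 \<open>Polynomial.degree f' = d\<close> Suc.prems(3) unfolding f' by simp
  then show ?case unfolding f' h' by (rule mult_dvd_mono[OF dvd_refl])
qed

text \<open>
  A relation of degree less than \<open>n\<close> in \<open>u\<close> whose coefficients are forms in \<open>f\<close> and \<open>g\<close> is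
  trivial: modulo \<open>f\<close> only the terms with \<open>j = 0\<close> survive, and they have degree less than \<open>n\<close>.
\<close>

lemma binary_form_relation_trivial:
  fixes f g :: "'k::alg_closed_field poly"
  assumes f: "Polynomial.degree f = n" "f \<noteq> 0" and cop: "\<And>x. poly f x = 0 \<Longrightarrow> poly g x \<noteq> 0"
    and rel: "(\<Sum>i<n. \<Sum>j\<le>e. Polynomial.monom (A i j) i * f ^ j * g ^ (e - j)) = 0"
  shows "\<forall>i<n. \<forall>j\<le>e. A i j = 0"
  using rel
proof (induction e arbitrary: A)
  case 0
  then have z: "(\<Sum>i<n. Polynomial.monom (A i 0) i) = 0" by simp
  have "A i 0 = 0" if "i < n" for i
  proof -
    have "Polynomial.coeff (\<Sum>i<n. Polynomial.monom (A i 0) i) i = A i 0"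
      using that by (simp add: coeff_sum)
    then show ?thesis unfolding z by simp
  qed
  then show ?case by simp
next
  case (Suc e)
  define R where "R = (\<Sum>i<n. \<Sum>j\<le>e. Polynomial.monom (A i (Suc j)) i * f ^ j * g ^ (e - j))"
  define S where "S = (\<Sum>i<n. Polynomial.monom (A i 0) i)"
  have split: "(\<Sum>i<n. \<Sum>j\<le>Suc e. Polynomial.monom (A i j) i * f ^ j * g ^ (Suc e - j)) = g ^ Suc e * S + f * R"
    unfolding R_def S_def
    by (simp add: sum.atMost_Suc_shift sum.distrib sum_distrib_left mult_ac del: sum.atMost_Suc)
  have "f dvd g ^ Suc e * S"
    using Suc.prems unfolding split by (metis add_eq_0_iff2 dvd_minus_iff dvd_triv_left)
  then have dv: "f dvd S"
    using dvd_mult_no_common_root[OF _ f(2), of "g ^ Suc e" S] cop by simp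
  have "S = 0"
  proof (rule ccontr)
    assume "S \<noteq> 0"
    then have "n \<le> Polynomial.degree S" using dvd_imp_degree_le[OF dv] f(1) by simp
    then have "Polynomial.coeff S (Polynomial.degree S) = 0"
      unfolding S_def by (simp add: coeff_sum)
    then show False using \<open>S \<noteq> 0\<close> by simp
  qed
  have A0: "A i 0 = 0" if "i < n" for i
  proof -
    have "Polynomial.coeff S i = A i 0"
      using that unfolding S_def by (simp add: coeff_sum)
    then show ?thesis unfolding \<open>S = 0\<close> by simp
  qed
  have "R = 0" using Suc.prems f(2) unfolding split \<open>S = 0\<close> by simp
  from Suc.IH[OF this[unfolded R_def]] A0 show ?case
    by (metis Suc_le_mono not0_implies_Suc)
qed

text \<open>
  The degree of \<open>u\<close> over \<open>k(f/g)\<close> is at least \<open>n\<close>: multiplying an equation of smaller degree by a common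
  denominator and by a power of \<open>g\<close> gives a relation as in \<open>binary_form_relation_trivial\<close>.
\<close>

lemma minimal_degree_over_simple_field:
  fixes f g :: "'k::alg_closed_field poly"
  assumes f: "Polynomial.degree f = n" "f \<noteq> 0" and g: "g \<noteq> 0" and cop: "\<And>x. poly f x = 0 \<Longrightarrow> poly g x \<noteq> 0"
    and Q: "poly_over (simple_field (Fract f g)) Q" "poly Q X_fract = 0" "Polynomial.degree Q < n"
  shows "Q = 0"
proof -
  define \<theta> where "\<theta> = Fract f g"
  have "\<forall>i. \<exists>A B. Polynomial.coeff Q i = eval_fract A \<theta> / eval_fract B \<theta> \<and> eval_fract B \<theta> \<noteq> 0"
    using Q(1) unfolding poly_over_def simple_field_def \<theta>_def by auto
  then obtain A B where AB: "\<And>i. Polynomial.coeff Q i = eval_fract (A i) \<theta> / eval_fract (B i) \<theta>"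
    "\<And>i. eval_fract (B i) \<theta> \<noteq> 0" by metis
  define D where "D = (\<Prod>j<n. B j)"
  have ep: "eval_fract (prod h I) \<theta> = (\<Prod>i\<in>I. eval_fract (h i) \<theta>)" for h :: "nat \<Rightarrow> 'k poly" and I
    by (induction I rule: infinite_finite_induct) simp_all
  have D0: "eval_fract D \<theta> \<noteq> 0" unfolding D_def ep using AB(2) by simp
  define A' where "A' i = A i * (\<Prod>j\<in>{..<n} - {i}. B j)" for i
  have A': "eval_fract (A' i) \<theta> = Polynomial.coeff Q i * eval_fract D \<theta>" if "i < n" for i
  proof -
    have "D = B i * (\<Prod>j\<in>{..<n} - {i}. B j)"
      unfolding D_def using that by (intro prod.remove) auto
    then show ?thesis using AB unfolding A'_def by simp
  qed
  define e where "e = Max (insert 0 ((\<lambda>i. Polynomial.degree (A' i)) ` {..<n}))"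
  have e: "Polynomial.degree (A' i) \<le> e" if "i < n" for i
    unfolding e_def using that by (intro Max_ge) auto
  have g1: "Fract g 1 \<noteq> 0" using g by (simp add: Fract_eq_0_iff)
  have f1: "Fract f 1 = \<theta> * Fract g 1" using g unfolding \<theta>_def by (simp add: eq_fract)
  have "(\<Sum>i<n. Polynomial.coeff Q i * X_fract ^ i) = poly Q X_fract"
    unfolding poly_altdef using Q(3) by (intro sum.mono_neutral_right) (auto simp: coeff_eq_0)
  then have "eval_fract D \<theta> * (\<Sum>i<n. Polynomial.coeff Q i * X_fract ^ i) = 0" using Q(2) by simp
  then have "(\<Sum>i<n. (Polynomial.coeff Q i * eval_fract D \<theta>) * X_fract ^ i) = 0"
    by (simp only: sum_distrib_left mult_ac)
  then have "(\<Sum>i<n. eval_fract (A' i) \<theta> * X_fract ^ i) = 0" using A' by simp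
  then have "(\<Sum>i<n. eval_fract (A' i) \<theta> * X_fract ^ i * Fract g 1 ^ e) = 0"
    by (simp flip: sum_distrib_right)
  moreover have "eval_fract (A' i) \<theta> * X_fract ^ i * Fract g 1 ^ e =
      (\<Sum>j\<le>e. const_fract (Polynomial.coeff (A' i) j) * X_fract ^ i * Fract f 1 ^ j * Fract g 1 ^ (e - j))"
    if "i < n" for i
    unfolding eval_fract_altdef[OF e[OF that]] sum_distrib_right
  proof (intro sum.cong refl)
    fix j assume "j \<in> {..e}"
    then have "Fract g 1 ^ e = Fract g 1 ^ j * Fract g 1 ^ (e - j)"
      by (metis atMost_iff le_add_diff_inverse power_add)
    then show "const_fract (Polynomial.coeff (A' i) j) * \<theta> ^ j * X_fract ^ i * Fract g 1 ^ e =
      const_fract (Polynomial.coeff (A' i) j) * X_fract ^ i * Fract f 1 ^ j * Fract g 1 ^ (e - j)"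
      unfolding f1 by (simp only: power_mult_distrib mult_ac)
  qed
  ultimately have "(\<Sum>i<n. \<Sum>j\<le>e. const_fract (Polynomial.coeff (A' i) j) * X_fract ^ i * Fract f 1 ^ j * Fract g 1 ^ (e - j)) = 0"
    by simp
  then have "eval_fract (\<Sum>i<n. \<Sum>j\<le>e. Polynomial.monom (Polynomial.coeff (A' i) j) i * f ^ j * g ^ (e - j)) X_fract = 0"
    by (simp only: eval_fract_sum eval_fract_simps(7,9) eval_fract_monom) (simp only: eval_fract_X)
  then have "(\<Sum>i<n. \<Sum>j\<le>e. Polynomial.monom (Polynomial.coeff (A' i) j) i * f ^ j * g ^ (e - j)) = 0"
    by (simp add: eval_fract_X Fract_eq_0_iff)
  from binary_form_relation_trivial[OF f cop this]
  have "Polynomial.coeff (A' i) j = 0" if "i < n" "j \<le> e" for i j using that by blast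
  then have "A' i = 0" if "i < n" for i
    using that e[OF that] by (metis leading_coeff_0_iff)
  then have "Polynomial.coeff Q i = 0" if "i < n" for i
    using A'[OF that] that D0 by simp
  then show ?thesis using Q(3) by (metis leading_coeff_0_iff)
qed

text \<open>
  The fibre polynomial has the least possible degree \<open>n\<close>, so it is a minimal polynomial of \<open>u\<close> up to
  a factor and has \<open>n\<close> distinct roots in a Galois extension.
\<close>

lemma (in rational_curve) galois_imp_fibre_splits:
  assumes G: "galois_extension (function_field C) (projection_subfield C P)"
    and K: "\<psi> ` projection_subfield C P = simple_field (Fract f g)"
    and f: "Polynomial.degree f = n" "f \<noteq> 0" and g: "g \<noteq> 0" "Polynomial.degree g \<le> n"
    and cop: "\<And>x. poly f x = 0 \<Longrightarrow> poly g x \<noteq> 0" and n: "n > 0"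
  shows "card {r. eval_fract f r * Fract g 1 = eval_fract g r * Fract f 1} = n"
proof -
  have "f \<noteq> Polynomial.smult c g" for c
  proof
    assume eq: "f = Polynomial.smult c g"
    then have "c \<noteq> 0" using f by auto
    then have "Polynomial.degree g > 0" using f(1) n eq by simp
    then obtain x where "poly g x = 0" using alg_closed_imp_poly_has_root by blast
    then show False using cop[of x] eq by simp
  qed
  then have "Polynomial.coeff (fibre_poly f g) n \<noteq> 0"
    using f by (intro coeff_fibre_poly[OF g(1)]) auto
  then have deg: "Polynomial.degree (fibre_poly f g) = n" "fibre_poly f g \<noteq> 0"
    using degree_fibre_poly[of f n g] f(1) g(2) le_degree by (metis le_antisym order_refl, force)
  have "card {r. poly (fibre_poly f g) r = 0} = Polynomial.degree (fibre_poly f g)"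
  proof (rule function_field.galois_extension_roots[OF projection_subfield_carrier G])
    show "poly_over (\<psi> ` projection_subfield C P) (fibre_poly f g)"
      unfolding K by (rule fibre_poly_over)
    show "poly (fibre_poly f g) X_fract = 0" by (rule fibre_poly_X[OF g(1)])
    show "Q = 0" if "poly_over (\<psi> ` projection_subfield C P) Q" "poly Q X_fract = 0"
      "Polynomial.degree Q < Polynomial.degree (fibre_poly f g)" for Q
      using that minimal_degree_over_simple_field[OF f g(1) cop] unfolding K deg(1) by blast
  qed (rule deg(2))
  then show ?thesis unfolding fibre_poly_roots[OF g(1)] deg(1) .
qed

section \<open>Reduced fractions\<close>

text \<open>
  In a representation with a denominator of least degree no common root is left to cancel.
\<close>

lemma reduced_fract:
  fixes r :: "'k::alg_closed_field poly fract"
  obtains \<alpha> \<beta> where "r = Fract \<alpha> \<beta>" "\<beta> \<noteq> 0" "\<And>x. poly \<alpha> x \<noteq> 0 \<or> poly \<beta> x \<noteq> 0"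
proof -
  define S where "S = {d. \<exists>\<alpha> \<beta>. r = Fract \<alpha> \<beta> \<and> \<beta> \<noteq> 0 \<and> Polynomial.degree \<beta> = d}"
  obtain a b where "r = Fract a b" "b \<noteq> 0" by (cases r rule: Fract_cases)
  then have "Polynomial.degree b \<in> S" unfolding S_def by blast
  then have "(LEAST d. d \<in> S) \<in> S" by (rule LeastI)
  then obtain \<alpha> \<beta> where ab: "r = Fract \<alpha> \<beta>" "\<beta> \<noteq> 0" "Polynomial.degree \<beta> = (LEAST d. d \<in> S)"
    unfolding S_def by blast
  have "poly \<alpha> x \<noteq> 0 \<or> poly \<beta> x \<noteq> 0" for x
  proof (rule ccontr)
    assume "\<not> ?thesis"
    then obtain \<alpha>' \<beta>' where *: "\<alpha> = [:- x, 1:] * \<alpha>'" "\<beta> = [:- x, 1:] * \<beta>'"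
      unfolding poly_eq_0_iff_dvd by (metis dvdE)
    then have b0: "\<beta>' \<noteq> 0" using ab(2) by auto
    have "r = Fract \<alpha>' \<beta>'"
      unfolding ab(1) * using b0 by (subst eq_fract) (simp_all only: mult_ac mult_eq_0_iff pCons_eq_0_iff one_neq_zero simp_thms not_False_eq_True)
    then have "Polynomial.degree \<beta>' \<in> S" unfolding S_def using b0 by blast
    then have "Polynomial.degree \<beta> \<le> Polynomial.degree \<beta>'" unfolding ab(3) by (rule Least_le)
    moreover have "Polynomial.degree \<beta> = Suc (Polynomial.degree \<beta>')"
      unfolding *(2) using b0 by (subst degree_mult_eq) auto
    ultimately show False by simp
  qed
  then show ?thesis using that ab by blast
qed

section \<open>Counting roots with multiplicity\<close>

lemma size_proots_alg_closed:
  fixes p :: "'k::alg_closed_field poly"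
  assumes "p \<noteq> 0"
  shows "size (proots p) = Polynomial.degree p"
proof -
  obtain A where A: "size A = Polynomial.degree p" "p = Polynomial.smult (Polynomial.lead_coeff p) (\<Prod>x\<in>#A. [:-x, 1:])"
    using alg_closed_imp_factorization[OF assms] by blast
  have "proots (\<Prod>x\<in>#A. [:-x, 1:]) = A"
  proof (induction A)
    case (add x A)
    have "(\<Prod>x\<in>#A. [:-x, 1:]) \<noteq> 0" by (auto simp: prod_mset_zero_iff)
    then show ?case using add proots_mult[of "[:-x, 1:]" "\<Prod>x\<in>#A. [:-x, 1:]"]
      by (simp del: mult_pCons_left)
  qed simp
  then have "proots p = A"
    using assms by (subst A(2)) (simp add: proots_smult)
  then show ?thesis using A(1) by simp
qed

lemma card_roots_uniform_order:
  fixes p :: "'k::alg_closed_field poly"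
  assumes "p \<noteq> 0" "\<And>x. poly p x = 0 \<Longrightarrow> Polynomial.order x p = k"
  shows "k * card {x. poly p x = 0} = Polynomial.degree p"
proof -
  have "(\<Sum>x\<in>{x. poly p x = 0}. k) = size (proots p)"
    unfolding size_multiset_overloaded_eq using assms by (intro sum.cong) auto
  then show ?thesis using size_proots_alg_closed[OF assms(1)] by (simp add: mult.commute)
qed

lemma square_dvd_iff:
  fixes h :: "'k::field poly"
  shows "[:- Q, 1:] ^ 2 dvd h \<longleftrightarrow> poly h Q = 0 \<and> poly (pderiv h) Q = 0"
proof (cases "poly h Q = 0")
  case True
  then obtain l where l: "h = [:- Q, 1:] * l" unfolding poly_eq_0_iff_dvd by (elim dvdE)
  have "[:- Q, 1:] ^ 2 dvd h \<longleftrightarrow> [:- Q, 1:] dvd l"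
    unfolding l power2_eq_square by (subst dvd_mult_cancel_left) auto
  moreover have "poly (pderiv h) Q = poly l Q"
    unfolding l by (simp only: pderiv_mult) (simp add: pderiv_pCons)
  ultimately show ?thesis using True by (simp add: poly_eq_0_iff_dvd)
next
  case False
  then show ?thesis by (metis dvd_trans dvd_power poly_eq_0_iff_dvd zero_less_numeral)
qed

lemma order_eq_1:
  fixes h :: "'k::field poly"
  assumes "poly h Q = 0" "poly (pderiv h) Q \<noteq> 0"
  shows "Polynomial.order Q h = 1"
proof -
  have h: "h \<noteq> 0" using assms(2) by auto
  have "\<not> 2 \<le> Polynomial.order Q h"
    using square_dvd_iff[of Q h] assms(2) h unfolding order_divides by simp
  moreover have "Polynomial.order Q h > 0" using assms(1) h by (simp add: order_gt_0_iff)
  ultimately show ?thesis by linarith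
qed

lemma order_eq_2:
  fixes h :: "'k::field poly"
  assumes "poly h Q = 0" "poly (pderiv h) Q = 0" "poly (pderiv (pderiv h)) Q \<noteq> 0"
  shows "Polynomial.order Q h = 2"
proof -
  have h: "h \<noteq> 0" using assms(3) by auto
  have "\<not> 3 \<le> Polynomial.order Q h"
  proof
    assume "3 \<le> Polynomial.order Q h"
    then have "[:- Q, 1:] ^ 3 dvd h" by (simp add: order_divides)
    then obtain l where "h = [:- Q, 1:] ^ 3 * l" by (elim dvdE)
    then have "h = [:- Q, 1:] * ([:- Q, 1:] * ([:- Q, 1:] * l))"
      by (simp only: power3_eq_cube mult.assoc)
    then have "poly (pderiv (pderiv h)) Q = 0"
      by (simp only: pderiv_mult pderiv_add) simp
    then show False using assms(3) by simp
  qed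
  moreover have "2 \<le> Polynomial.order Q h"
    using square_dvd_iff[of Q h] assms(1,2) h unfolding order_divides by simp
  ultimately show ?thesis by linarith
qed

lemma poly_eq_prod_roots:
  fixes p :: "'a::field poly"
  assumes deg: "Polynomial.degree p \<le> n" and S: "finite S" "card S = n" "\<And>r. r \<in> S \<Longrightarrow> poly p r = 0" and n: "n > 0"
  shows "p = Polynomial.smult (Polynomial.coeff p n) (\<Prod>r\<in>S. [:- r, 1:])"
proof -
  define q where "q = (\<Prod>r\<in>S. [:- r, 1:])"
  have dq: "Polynomial.degree q = n"
    unfolding q_def using S(2) by (subst degree_prod_eq_sum_degree) auto
  have lq: "Polynomial.coeff q n = 1"
    using lead_coeff_prod[of "\<lambda>r. [:- r, 1:]" S] unfolding dq[symmetric] by (simp add: q_def)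
  define D where "D = p - Polynomial.smult (Polynomial.coeff p n) q"
  have "D = 0"
  proof (rule ccontr)
    assume D: "D \<noteq> 0"
    have "Polynomial.degree D \<le> n"
      unfolding D_def using deg dq by (intro degree_diff_le) (auto intro: order_trans[OF degree_smult_le])
    moreover have "Polynomial.coeff D n = 0" unfolding D_def using lq by simp
    ultimately have "Polynomial.degree D < n"
      using D by (metis le_neq_implies_less leading_coeff_0_iff)
    moreover have "S \<subseteq> {x. poly D x = 0}"
      using S(1,3) by (auto simp: D_def q_def poly_prod)
    then have "n \<le> card {x. poly D x = 0}"
      using card_mono[OF poly_roots_finite[OF D]] S(2) by metis
    ultimately show False using card_poly_roots_bound[OF D] by linarith
  qed
  then show ?thesis unfolding D_def q_def by simp
qed

section \<open>Pencils with a totally split generic fibre\<close>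

lemma eval_fract_const: "eval_fract P (const_fract c) = const_fract (poly P c)"
  by (induction P) (simp_all add: const_fract_hom)

lemma eval_fract_prod: "eval_fract (prod h I) r = (\<Prod>i\<in>I. eval_fract (h i) r)"
  by (induction I rule: infinite_finite_induct) simp_all

text \<open>
  The form of degree \<open>n\<close> obtained from \<open>f\<close>, evaluated at two polynomials. This is the numerator of
  \<open>f(\<alpha>/\<beta>)\<close> for the denominator \<open>\<beta>\<^sup>n\<close>.
\<close>

definition form_comp :: "nat \<Rightarrow> 'k::field poly \<Rightarrow> 'k poly \<Rightarrow> 'k poly \<Rightarrow> 'k poly" where
  "form_comp n f \<alpha> \<beta> = (\<Sum>i\<le>n. Polynomial.smult (Polynomial.coeff f i) (\<alpha> ^ i * \<beta> ^ (n - i)))"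

lemma poly_form_comp: "poly (form_comp n f \<alpha> \<beta>) u = form_value n f (poly \<alpha> u) (poly \<beta> u)"
  by (simp add: form_comp_def form_value_def poly_sum mult.assoc)

lemma form_comp_linear:
  fixes f g :: "'k::alg_closed_field poly"
  shows "form_comp n (Polynomial.smult a f + Polynomial.smult b g) \<alpha> \<beta> =
    Polynomial.smult a (form_comp n f \<alpha> \<beta>) + Polynomial.smult b (form_comp n g \<alpha> \<beta>)"
  by (intro iffD1[OF poly_eq_iff_infinite] allI)
    (simp add: poly_form_comp form_value_add form_value_smult)

lemma form_comp_mult:
  fixes f g :: "'k::alg_closed_field poly"
  assumes "Polynomial.degree f \<le> n" "Polynomial.degree g \<le> m"
  shows "form_comp (n + m) (f * g) \<alpha> \<beta> = form_comp n f \<alpha> \<beta> * form_comp m g \<alpha> \<beta>"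
  using form_value_mult[OF assms] poly_eq_iff_infinite
  by (metis poly_form_comp poly_mult)

lemma form_comp_eval:
  assumes "Polynomial.degree f \<le> n" "\<beta> \<noteq> 0"
  shows "Fract (form_comp n f \<alpha> \<beta>) 1 = eval_fract f (Fract \<alpha> \<beta>) * Fract \<beta> 1 ^ n"
proof -
  have b: "Fract \<beta> 1 \<noteq> 0" using assms(2) by (simp add: Fract_eq_0_iff)
  have a: "Fract \<alpha> 1 = Fract \<alpha> \<beta> * Fract \<beta> 1" using assms(2) by (simp add: eq_fract)
  have "Fract (form_comp n f \<alpha> \<beta>) 1 = eval_fract (form_comp n f \<alpha> \<beta>) X_fract" by (simp add: eval_fract_X)
  also have "\<dots> = (\<Sum>i\<le>n. const_fract (Polynomial.coeff f i) * (Fract \<alpha> 1 ^ i * Fract \<beta> 1 ^ (n - i)))"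
    unfolding form_comp_def by (simp only: eval_fract_sum eval_fract_simps(7,8,9)) (simp only: eval_fract_X)
  also have "\<dots> = (\<Sum>i\<le>n. const_fract (Polynomial.coeff f i) * Fract \<alpha> \<beta> ^ i * Fract \<beta> 1 ^ n)"
  proof (intro sum.cong refl)
    fix i assume "i \<in> {..n}"
    then have "Fract \<beta> 1 ^ n = Fract \<beta> 1 ^ i * Fract \<beta> 1 ^ (n - i)"
      by (metis atMost_iff le_add_diff_inverse power_add)
    then show "const_fract (Polynomial.coeff f i) * (Fract \<alpha> 1 ^ i * Fract \<beta> 1 ^ (n - i)) =
      const_fract (Polynomial.coeff f i) * Fract \<alpha> \<beta> ^ i * Fract \<beta> 1 ^ n"
      unfolding a by (simp only: power_mult_distrib mult_ac)
  qed
  also have "\<dots> = eval_fract f (Fract \<alpha> \<beta>) * Fract \<beta> 1 ^ n"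
    unfolding eval_fract_altdef[OF assms(1)] by (simp only: sum_distrib_right)
  finally show ?thesis .
qed

text \<open>
  The leading coefficients of \<open>\<alpha>\<close> and \<open>\<beta>\<close> are their values at infinity.
\<close>

lemma coeff_form_comp:
  assumes "Polynomial.degree \<alpha> \<le> N" "Polynomial.degree \<beta> \<le> N"
  shows "Polynomial.coeff (form_comp n f \<alpha> \<beta>) (n * N) = form_value n f (Polynomial.coeff \<alpha> N) (Polynomial.coeff \<beta> N)"
proof -
  have "Polynomial.coeff (\<alpha> ^ i * \<beta> ^ (n - i)) (n * N) = Polynomial.coeff \<alpha> N ^ i * Polynomial.coeff \<beta> N ^ (n - i)"
    if "i \<le> n" for i
  proof -
    have "n * N = i * N + (n - i) * N" using that by (simp flip: add_mult_distrib)
    then show ?thesis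
      using coeff_mult_bounded_degree[OF coeff_power_bounded_degree(2)[OF assms(1), of i]
          coeff_power_bounded_degree(2)[OF assms(2), of "n - i"]]
        coeff_power_bounded_degree(1)[OF assms(1)] coeff_power_bounded_degree(1)[OF assms(2)] by simp
  qed
  then show ?thesis by (simp add: form_comp_def form_value_def coeff_sum mult.assoc)
qed

text \<open>
  The polynomials \<open>f\<close> and \<open>g\<close> span a pencil of degree \<open>n\<close> without base points, and all \<open>n\<close> conjugates
  of \<open>u\<close> over \<open>k(f/g)\<close> lie in \<open>k(u)\<close>. The set \<open>S\<close> of these conjugates consists of the
  transformations \<open>r\<close> of the line with \<open>f(r)/g(r) = f/g\<close>, and it turns out to act transitively
  on the points of each fibre.
\<close>

locale split_pencil =
  fixes n :: nat and f g :: "'k::alg_closed_field poly"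
  assumes n: "n > 0" and f: "Polynomial.degree f = n" and g: "g \<noteq> 0" "Polynomial.degree g \<le> n"
    and cop: "\<And>x. poly f x = 0 \<Longrightarrow> poly g x \<noteq> 0"
    and split: "card {r. eval_fract f r * Fract g 1 = eval_fract g r * Fract f 1} = n"
begin

abbreviation "S \<equiv> {r. eval_fract f r * Fract g 1 = eval_fract g r * Fract f 1}"

lemma f0: "f \<noteq> 0" using f n by auto

lemma f_not_smult: "f \<noteq> Polynomial.smult c g"
proof
  assume eq: "f = Polynomial.smult c g"
  obtain x where "poly f x = 0" using alg_closed_imp_poly_has_root[of f] f n by auto
  moreover have "c \<noteq> 0" using eq f0 by auto
  ultimately show False using cop[of x] eq by simp
qed

lemma no_base_point: "(x, y) \<noteq> (0, 0) \<Longrightarrow> form_value n f x y \<noteq> 0 \<or> form_value n g x y \<noteq> 0"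
proof (cases "y = 0")
  case True
  assume "(x, y) \<noteq> (0, 0)"
  then have "form_value n f x y \<noteq> 0" using True f f0 by (auto simp: form_value_infinity)
  then show ?thesis by blast
next
  case False
  then show ?thesis
    using form_value_affine[of f n y "x / y"] form_value_affine[of g n y "x / y"] f g cop[of "x / y"] by auto
qed

text \<open>
  Since \<open>f(r)/g(r) = f/g\<close> and \<open>f\<close>, \<open>g\<close> are coprime, the homogenized \<open>f(\<alpha>, \<beta>)\<close> and \<open>g(\<alpha>, \<beta>)\<close> are the
  multiples of \<open>f\<close> and \<open>g\<close> by the same polynomial \<open>c\<close>. A zero of \<open>c\<close> would be mapped to a
  base point of the pencil, so \<open>c\<close> is constant.
\<close>

lemma form_comp_split:
  assumes r: "Fract \<alpha> \<beta> \<in> S" "\<beta> \<noteq> 0" "\<And>x. poly \<alpha> x \<noteq> 0 \<or> poly \<beta> x \<noteq> 0"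
  obtains c where "c \<noteq> 0" "form_comp n f \<alpha> \<beta> = Polynomial.smult c f" "form_comp n g \<alpha> \<beta> = Polynomial.smult c g"
proof -
  have "Fract (form_comp n f \<alpha> \<beta> * g) 1 = Fract (form_comp n f \<alpha> \<beta>) 1 * Fract g 1" by simp
  also have "\<dots> = (eval_fract f (Fract \<alpha> \<beta>) * Fract g 1) * Fract \<beta> 1 ^ n"
    using f by (subst form_comp_eval[OF _ r(2)]) (simp_all only: mult_ac order_refl)
  also have "\<dots> = (eval_fract g (Fract \<alpha> \<beta>) * Fract f 1) * Fract \<beta> 1 ^ n" using r(1) by simp
  also have "\<dots> = Fract (form_comp n g \<alpha> \<beta>) 1 * Fract f 1"
    using g by (subst form_comp_eval[OF _ r(2)]) (simp_all only: mult_ac)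
  also have "\<dots> = Fract (form_comp n g \<alpha> \<beta> * f) 1" by simp
  finally have rel: "form_comp n f \<alpha> \<beta> * g = form_comp n g \<alpha> \<beta> * f" by (simp add: eq_fract)
  then have "f dvd g * form_comp n f \<alpha> \<beta>" by (metis dvd_triv_right mult.commute)
  then have "f dvd form_comp n f \<alpha> \<beta>" by (rule dvd_mult_no_common_root[OF _ f0 cop])
  then obtain c where c: "form_comp n f \<alpha> \<beta> = f * c" by (elim dvdE)
  have "f * (c * g) = f * form_comp n g \<alpha> \<beta>" using rel unfolding c by (simp only: mult_ac)
  then have cg: "form_comp n g \<alpha> \<beta> = c * g" using f0 by simp
  have "poly c x \<noteq> 0" for x
  proof
    assume "poly c x = 0"
    then have "poly (form_comp n f \<alpha> \<beta>) x = 0" "poly (form_comp n g \<alpha> \<beta>) x = 0" unfolding c cg by simp_all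
    then show False using no_base_point[of "poly \<alpha> x" "poly \<beta> x"] r(3)[of x] unfolding poly_form_comp by auto
  qed
  then have "Polynomial.degree c = 0" using alg_closed_imp_poly_has_root[of c] by blast
  then obtain k where "c = [:k:]" by (metis degree_eq_zeroE)
  moreover have "k \<noteq> 0" using \<open>\<And>x. poly c x \<noteq> 0\<close>[of 0] calculation by simp
  ultimately show ?thesis using that c cg by simp
qed

text \<open>
  So \<open>r\<close> is a Moebius transformation: otherwise \<open>f(\<alpha>, \<beta>)\<close> would have larger degree than \<open>f\<close>, or
  infinity would be mapped to a base point.
\<close>

lemma degree_split:
  assumes r: "Fract \<alpha> \<beta> \<in> S" "\<beta> \<noteq> 0" "\<And>x. poly \<alpha> x \<noteq> 0 \<or> poly \<beta> x \<noteq> 0"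
  shows "Polynomial.degree \<alpha> \<le> 1" "Polynomial.degree \<beta> \<le> 1"
proof -
  define N where "N = max (Polynomial.degree \<alpha>) (Polynomial.degree \<beta>)"
  obtain c where c: "c \<noteq> 0" "form_comp n f \<alpha> \<beta> = Polynomial.smult c f" "form_comp n g \<alpha> \<beta> = Polynomial.smult c g"
    using form_comp_split[OF r] by blast
  have d: "Polynomial.degree \<alpha> \<le> N" "Polynomial.degree \<beta> \<le> N" unfolding N_def by simp_all
  have "\<not> N > 1"
  proof
    assume N: "N > 1"
    then have "n < n * N" using n by simp
    then have "Polynomial.coeff (form_comp n f \<alpha> \<beta>) (n * N) = 0" "Polynomial.coeff (form_comp n g \<alpha> \<beta>) (n * N) = 0"
      unfolding c using f coeff_eq_0[of f "n * N"] coeff_eq_0[of g "n * N"] le_less_trans[OF g(2)] by simp_all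
    then have "(Polynomial.coeff \<alpha> N, Polynomial.coeff \<beta> N) = (0, 0)"
      unfolding coeff_form_comp[OF d] using no_base_point by blast
    then show False using N r(2) unfolding N_def
      by (auto simp: max_def split: if_splits)
  qed
  then show "Polynomial.degree \<alpha> \<le> 1" "Polynomial.degree \<beta> \<le> 1" using d by simp_all
qed

text \<open>The member of the pencil that vanishes at \<open>Q\<close>, and the one that vanishes at infinity.\<close>

definition member :: "'k \<Rightarrow> 'k poly" where
  "member Q = Polynomial.smult (poly f Q) g - Polynomial.smult (poly g Q) f"

definition member_inf :: "'k poly" where
  "member_inf = Polynomial.smult (Polynomial.coeff f n) g - Polynomial.smult (Polynomial.coeff g n) f"

lemma member_sym: "poly (member Q) R = 0 \<longleftrightarrow> poly (member R) Q = 0"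
  by (auto simp: member_def algebra_simps)

lemma member_nonzero: "member Q \<noteq> 0"
proof
  assume m: "member Q = 0"
  have "poly g Q \<noteq> 0 \<or> poly f Q \<noteq> 0" using cop by blast
  then show False
  proof (cases "poly g Q = 0")
    case True
    then show ?thesis using m g(1) \<open>poly g Q \<noteq> 0 \<or> poly f Q \<noteq> 0\<close> by (auto simp: member_def)
  next
    case False
    have "Polynomial.smult (poly f Q) g = Polynomial.smult (poly g Q) f" using m by (simp add: member_def)
    then have "f = Polynomial.smult (poly f Q / poly g Q) g"
      using False by (metis nonzero_mult_div_cancel_left smult_eq_iff)
    then show False using f_not_smult by blast
  qed
qed

text \<open>
  The fibre polynomial is the product of the \<open>T - r\<close> over \<open>S\<close>, up to its leading coefficient. Inserting
  a constant \<open>R\<close> for \<open>T\<close> gives, up to a factor, the member of the pencil through \<open>R\<close>.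
\<close>

lemma fibre_identity:
  assumes "\<And>r. r \<in> S \<Longrightarrow> r = Fract (\<alpha> r) (\<beta> r) \<and> \<beta> r \<noteq> 0"
  shows "member R * (\<Prod>r\<in>S. \<beta> r) = member_inf * (\<Prod>r\<in>S. Polynomial.smult R (\<beta> r) - \<alpha> r)"
proof -
  have finS: "finite S" using split n by (metis card.infinite not_gr0)
  define p where "p = Polynomial.smult (Fract g 1) (map_poly const_fract f) - Polynomial.smult (Fract f 1) (map_poly const_fract g)"
  have pe: "poly p r = Fract g 1 * eval_fract f r - Fract f 1 * eval_fract g r" for r
    by (simp add: p_def eval_fract_def)
  have deg: "Polynomial.degree p \<le> n" unfolding p_def using f g
    by (intro degree_diff_le) (auto intro!: order_trans[OF degree_smult_le] order_trans[OF map_poly_degree_leq])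
  have "Fract member_inf 1 = const_fract (Polynomial.coeff f n) * Fract g 1 - const_fract (Polynomial.coeff g n) * Fract f 1"
    unfolding eval_fract_X[symmetric] member_inf_def by simp
  then have cp: "Polynomial.coeff p n = Fract member_inf 1"
    by (simp only: p_def coeff_diff coeff_smult coeff_map_poly const_fract_hom mult.commute)
  have "p = Polynomial.smult (Polynomial.coeff p n) (\<Prod>r\<in>S. [:- r, 1:])"
    using split n finS pe by (intro poly_eq_prod_roots[OF deg]) (auto simp: mult.commute)
  then have "poly p (const_fract R) = poly (Polynomial.smult (Polynomial.coeff p n) (\<Prod>r\<in>S. [:- r, 1:])) (const_fract R)"
    by simp
  also have "\<dots> = Fract member_inf 1 * (\<Prod>r\<in>S. const_fract R - r)"
    unfolding cp by (simp add: poly_prod)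
  finally have fib: "poly p (const_fract R) = Fract member_inf 1 * (\<Prod>r\<in>S. const_fract R - r)" .
  have "Fract (member R) 1 = const_fract (poly f R) * Fract g 1 - const_fract (poly g R) * Fract f 1"
    unfolding eval_fract_X[symmetric] member_def by simp
  then have "Fract (member R) 1 = Fract member_inf 1 * (\<Prod>r\<in>S. const_fract R - r)"
    unfolding fib[symmetric] pe eval_fract_const by (simp only: mult.commute)
  then have "Fract (member R) 1 * (\<Prod>r\<in>S. Fract (\<beta> r) 1) =
      Fract member_inf 1 * (\<Prod>r\<in>S. (const_fract R - r) * Fract (\<beta> r) 1)"
    by (simp add: prod.distrib mult.assoc)
  also have "(\<Prod>r\<in>S. (const_fract R - r) * Fract (\<beta> r) 1) = (\<Prod>r\<in>S. Fract (Polynomial.smult R (\<beta> r) - \<alpha> r) 1)"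
  proof (rule prod.cong[OF refl])
    fix r assume "r \<in> S"
    then have r: "r = Fract (\<alpha> r) (\<beta> r)" "\<beta> r \<noteq> 0" using assms by auto
    have "r * Fract (\<beta> r) 1 = Fract (\<alpha> r) 1"
      using r(2) by (subst r(1)) (simp add: eq_fract)
    then show "(const_fract R - r) * Fract (\<beta> r) 1 = Fract (Polynomial.smult R (\<beta> r) - \<alpha> r) 1"
      by (simp add: left_diff_distrib const_fract_def)
  qed
  finally have "eval_fract (member R * (\<Prod>r\<in>S. \<beta> r)) X_fract = 
      eval_fract (member_inf * (\<Prod>r\<in>S. Polynomial.smult R (\<beta> r) - \<alpha> r)) X_fract"
    unfolding eval_fract_simps(7) eval_fract_prod unfolding eval_fract_X .
  then show ?thesis unfolding eval_fract_X by (simp add: eq_fract)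
qed

lemma reduced_split:
  obtains \<alpha> \<beta> where "\<And>r. r \<in> S \<Longrightarrow> r = Fract (\<alpha> r) (\<beta> r) \<and> \<beta> r \<noteq> 0 \<and> (\<forall>x. poly (\<alpha> r) x \<noteq> 0 \<or> poly (\<beta> r) x \<noteq> 0)"
proof -
  have "\<forall>r::'k poly fract. \<exists>\<alpha> \<beta>. r = Fract \<alpha> \<beta> \<and> \<beta> \<noteq> 0 \<and> (\<forall>x. poly \<alpha> x \<noteq> 0 \<or> poly \<beta> x \<noteq> 0)"
    by (metis reduced_fract)
  then show ?thesis using that by metis
qed

lemma finite_S: "finite S"
  using split n by (metis card.infinite not_gr0)

text \<open>
  If \<open>Q\<close> and \<open>R\<close> lie in the same fibre, one of the factors in \<open>fibre_identity\<close> vanishes at \<open>Q\<close>, so that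
  \<open>r(Q) = R\<close> for some \<open>r\<close> in \<open>S\<close>.
\<close>

lemma split_connects:
  assumes "poly (member R) Q = 0" "poly member_inf Q \<noteq> 0"
  obtains \<alpha> \<beta> where "Fract \<alpha> \<beta> \<in> S" "\<beta> \<noteq> 0" "\<And>x. poly \<alpha> x \<noteq> 0 \<or> poly \<beta> x \<noteq> 0" "poly \<alpha> Q = R * poly \<beta> Q"
proof -
  obtain \<alpha> \<beta> where ab: "\<And>r. r \<in> S \<Longrightarrow> r = Fract (\<alpha> r) (\<beta> r) \<and> \<beta> r \<noteq> 0 \<and> (\<forall>x. poly (\<alpha> r) x \<noteq> 0 \<or> poly (\<beta> r) x \<noteq> 0)"
    using reduced_split by blast
  have "member R * (\<Prod>r\<in>S. \<beta> r) = member_inf * (\<Prod>r\<in>S. Polynomial.smult R (\<beta> r) - \<alpha> r)"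
    using ab by (intro fibre_identity) blast
  then have "poly (member R * (\<Prod>r\<in>S. \<beta> r)) Q = poly (member_inf * (\<Prod>r\<in>S. Polynomial.smult R (\<beta> r) - \<alpha> r)) Q"
    by simp
  then have "(\<Prod>r\<in>S. R * poly (\<beta> r) Q - poly (\<alpha> r) Q) = 0"
    using assms by (simp add: poly_prod)
  then obtain r where r: "r \<in> S" "R * poly (\<beta> r) Q - poly (\<alpha> r) Q = 0"
    using finite_S by (metis (no_types, lifting) prod_zero_iff)
  have "Fract (\<alpha> r) (\<beta> r) \<in> S" using ab[OF r(1)] r(1) by metis
  then show ?thesis using that[of "\<alpha> r" "\<beta> r"] ab[OF r(1)] r(2) by simp
qed

text \<open>
  Similarly, some \<open>r\<close> in \<open>S\<close> maps a given point of the fibre of infinity to infinity.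
\<close>

lemma split_connects_inf:
  assumes "poly member_inf Q = 0"
  obtains \<alpha> \<beta> where "Fract \<alpha> \<beta> \<in> S" "\<beta> \<noteq> 0" "\<And>x. poly \<alpha> x \<noteq> 0 \<or> poly \<beta> x \<noteq> 0" "poly \<beta> Q = 0"
proof -
  obtain \<alpha> \<beta> where ab: "\<And>r. r \<in> S \<Longrightarrow> r = Fract (\<alpha> r) (\<beta> r) \<and> \<beta> r \<noteq> 0 \<and> (\<forall>x. poly (\<alpha> r) x \<noteq> 0 \<or> poly (\<beta> r) x \<noteq> 0)"
    using reduced_split by blast
  obtain R where "poly (member Q) R \<noteq> 0"
    using member_nonzero[of Q] poly_eq_iff_infinite[of "member Q" 0] by auto
  then have R: "poly (member R) Q \<noteq> 0" using member_sym by blast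
  have "member R * (\<Prod>r\<in>S. \<beta> r) = member_inf * (\<Prod>r\<in>S. Polynomial.smult R (\<beta> r) - \<alpha> r)"
    using ab by (intro fibre_identity) blast
  then have "poly (member R * (\<Prod>r\<in>S. \<beta> r)) Q = poly (member_inf * (\<Prod>r\<in>S. Polynomial.smult R (\<beta> r) - \<alpha> r)) Q"
    by simp
  then have "(\<Prod>r\<in>S. poly (\<beta> r) Q) = 0"
    using assms R by (simp add: poly_prod)
  then obtain r where r: "r \<in> S" "poly (\<beta> r) Q = 0"
    using finite_S by (metis (no_types, lifting) prod_zero_iff)
  have "Fract (\<alpha> r) (\<beta> r) \<in> S" using ab[OF r(1)] r(1) by metis
  then show ?thesis using that[of "\<alpha> r" "\<beta> r"] ab[OF r(1)] r(2) by simp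
qed

text \<open>
  The substitution of \<open>r = \<alpha>/\<beta>\<close> multiplies every member of the pencil by a constant, and it turns the
  linear factor with root \<open>R\<close> into one that vanishes at \<open>Q\<close>.
\<close>

lemma square_dvd_pull_back:
  assumes r: "Fract \<alpha> \<beta> \<in> S" "\<beta> \<noteq> 0" "\<And>x. poly \<alpha> x \<noteq> 0 \<or> poly \<beta> x \<noteq> 0" and Q: "poly \<alpha> Q = R * poly \<beta> Q"
    and h: "h = Polynomial.smult a f + Polynomial.smult b g" "[:- R, 1:] ^ 2 dvd h"
  shows "[:- Q, 1:] ^ 2 dvd h"
proof (cases "h = 0")
  case False
  obtain c where c: "c \<noteq> 0" "form_comp n f \<alpha> \<beta> = Polynomial.smult c f" "form_comp n g \<alpha> \<beta> = Polynomial.smult c g"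
    using form_comp_split[OF r] by blast
  have fh: "form_comp n h \<alpha> \<beta> = Polynomial.smult c h"
    unfolding h(1) form_comp_linear c(2,3) by (simp add: smult_add_right mult.commute)
  obtain l where "h = [:- R, 1:] ^ 2 * l" using h(2) by (elim dvdE)
  then have l: "h = [:- R, 1:] * ([:- R, 1:] * l)" by (simp only: power2_eq_square mult.assoc)
  then have l0: "l \<noteq> 0" using False by auto
  have "Polynomial.degree h = 2 + Polynomial.degree l"
    unfolding l using l0 by (simp add: degree_mult_eq del: mult_pCons_left)
  moreover have "Polynomial.degree h \<le> n"
    unfolding h(1) using f g by (intro degree_add_le order_trans[OF degree_smult_le]) auto
  ultimately have dl: "Polynomial.degree l \<le> n - 2" "n = 1 + (1 + (n - 2))" by linarith+
  have d1: "Polynomial.degree ([:- R, 1:] * l) \<le> 1 + (n - 2)"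
    using degree_mult_le[of "[:- R, 1:]" l] dl(1) by simp
  have "form_comp n h \<alpha> \<beta> = form_comp 1 [:- R, 1:] \<alpha> \<beta> * (form_comp 1 [:- R, 1:] \<alpha> \<beta> * form_comp (n - 2) l \<alpha> \<beta>)"
    unfolding l using form_comp_mult[OF _ d1, of "[:- R, 1:]" 1 \<alpha> \<beta>] form_comp_mult[OF _ dl(1), of "[:- R, 1:]" 1 \<alpha> \<beta>] dl(2) by simp
  moreover have "[:- Q, 1:] dvd form_comp 1 [:- R, 1:] \<alpha> \<beta>"
    unfolding poly_eq_0_iff_dvd[symmetric] poly_form_comp form_value_linear Q by simp
  ultimately have "[:- Q, 1:] ^ 2 dvd Polynomial.smult c h"
    unfolding fh power2_eq_square by (metis dvd_mult2 mult.assoc mult_dvd_mono)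
  then show ?thesis using c(1) by (simp add: dvd_smult_iff)
qed simp

lemma member_comb: "member Q = Polynomial.smult (- poly g Q) f + Polynomial.smult (poly f Q) g"
  by (simp add: member_def)

lemma member_proportional:
  assumes "poly (member Q) R = 0"
  obtains c where "c \<noteq> 0" "member Q = Polynomial.smult c (member R)"
proof -
  have e: "poly f Q * poly g R = poly g Q * poly f R" using assms by (simp add: member_def)
  have "\<exists>c. c \<noteq> 0 \<and> poly f Q = c * poly f R \<and> poly g Q = c * poly g R"
  proof (cases "poly g R = 0")
    case True
    then have fR: "poly f R \<noteq> 0" using cop by blast
    then have gQ: "poly g Q = 0" using True e by simp
    then have "poly f Q \<noteq> 0" using cop by blast
    then show ?thesis using True fR gQ by (intro exI[of _ "poly f Q / poly f R"]) simp
  next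
    case False
    have "poly g Q \<noteq> 0"
    proof
      assume "poly g Q = 0"
      then have "poly f Q = 0" using e False by simp
      then show False using cop \<open>poly g Q = 0\<close> by blast
    qed
    then show ?thesis using False e by (intro exI[of _ "poly g Q / poly g R"]) (simp add: field_simps)
  qed
  then obtain c where c: "c \<noteq> 0" "poly f Q = c * poly f R" "poly g Q = c * poly g R" by blast
  then have "member Q = Polynomial.smult c (member R)" by (simp add: member_def smult_diff_right)
  then show ?thesis using that c(1) by blast
qed

definition ramified :: "'k \<Rightarrow> bool" where "ramified Q \<longleftrightarrow> [:- Q, 1:] ^ 2 dvd member Q"

lemma member_self: "poly (member Q) Q = 0"
  by (simp add: member_def)

lemma ramified_iff: "ramified Q \<longleftrightarrow> poly (pderiv (member Q)) Q = 0"
  unfolding ramified_def square_dvd_iff by (simp add: member_self)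

text \<open>
  Some \<open>r\<close> in \<open>S\<close> maps \<open>R\<close> to \<open>Q\<close>, and a double root at \<open>Q\<close> is pulled back to one at \<open>R\<close>.
\<close>

lemma ramified_fibre:
  assumes Q: "ramified Q" "poly member_inf Q \<noteq> 0" and R: "poly (member Q) R = 0"
  shows "ramified R"
proof -
  obtain c where c: "c \<noteq> 0" "member Q = Polynomial.smult c (member R)"
    using member_proportional[OF R] by blast
  have "poly member_inf R \<noteq> 0"
  proof
    have fn: "Polynomial.coeff f n \<noteq> 0" using f f0 by auto
    assume m: "poly member_inf R = 0"
    have "Polynomial.coeff (member R) n = - poly member_inf R" by (simp add: member_def member_inf_def mult.commute)
    moreover have "Polynomial.coeff (member Q) n = - poly member_inf Q" by (simp add: member_def member_inf_def mult.commute)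
    ultimately show False using Q(2) m c(2) by simp
  qed
  then obtain \<alpha> \<beta> where ab: "Fract \<alpha> \<beta> \<in> S" "\<beta> \<noteq> 0" "\<And>x. poly \<alpha> x \<noteq> 0 \<or> poly \<beta> x \<noteq> 0" "poly \<alpha> R = Q * poly \<beta> R"
    using split_connects[OF R] by blast
  have "[:- R, 1:] ^ 2 dvd member Q"
    using square_dvd_pull_back[OF ab member_comb] Q(1) unfolding ramified_def by blast
  then show ?thesis unfolding ramified_def c(2) using c(1) by (simp add: dvd_smult_iff)
qed

text \<open>
  The hypothesis on the coefficient says that infinity is a simple zero of the member through it, that
  is, unramified. A transformation in \<open>S\<close> that maps \<open>Q\<close> to infinity would turn this simple zero into
  a simple zero at \<open>Q\<close>.
\<close>

lemma ramified_not_in_fibre_inf: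
  assumes Q: "ramified Q" and inf: "Polynomial.coeff member_inf (n - 1) \<noteq> 0"
  shows "poly member_inf Q \<noteq> 0"
proof
  assume m: "poly member_inf Q = 0"
  have fn: "Polynomial.coeff f n \<noteq> 0" using f f0 by auto
  have e: "Polynomial.coeff f n * poly g Q = Polynomial.coeff g n * poly f Q"
    using m by (simp add: member_inf_def)
  have fQ: "poly f Q \<noteq> 0"
  proof
    assume "poly f Q = 0"
    then have "poly g Q = 0" using e fn by simp
    then show False using cop \<open>poly f Q = 0\<close> by blast
  qed
  have "member_inf = Polynomial.smult (Polynomial.coeff f n / poly f Q) (member Q)"
    using fQ e by (simp add: member_inf_def member_def smult_diff_right field_simps)
  then have sq: "[:- Q, 1:] ^ 2 dvd member_inf"
    using Q fn fQ unfolding ramified_def by (simp add: dvd_smult)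
  obtain \<alpha> \<beta> where ab: "Fract \<alpha> \<beta> \<in> S" "\<beta> \<noteq> 0" "\<And>x. poly \<alpha> x \<noteq> 0 \<or> poly \<beta> x \<noteq> 0" "poly \<beta> Q = 0"
    using split_connects_inf[OF m] by blast
  obtain c where c: "c \<noteq> 0" "form_comp n f \<alpha> \<beta> = Polynomial.smult c f" "form_comp n g \<alpha> \<beta> = Polynomial.smult c g"
    using form_comp_split[OF ab(1-3)] by blast
  have comb: "member_inf = Polynomial.smult (- Polynomial.coeff g n) f + Polynomial.smult (Polynomial.coeff f n) g"
    by (simp add: member_inf_def)
  have fh: "form_comp n member_inf \<alpha> \<beta> = Polynomial.smult c member_inf"
    unfolding comb form_comp_linear c(2,3) by (simp add: smult_diff_right mult.commute)
  have "Polynomial.degree member_inf \<le> n"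
    unfolding comb using f g by (intro degree_add_le order_trans[OF degree_smult_le]) auto
  moreover have "Polynomial.coeff member_inf n = 0" by (simp add: member_inf_def)
  ultimately have "Polynomial.degree member_inf < n"
    using n by (metis degree_0 le_neq_implies_less leading_coeff_0_iff)
  then have dm: "Polynomial.degree member_inf \<le> n - 1" by simp
  define F where "F = form_comp (n - 1) member_inf \<alpha> \<beta>"
  have "form_comp (n - 1 + 1) (member_inf * 1) \<alpha> \<beta> = F * form_comp 1 1 \<alpha> \<beta>"
    unfolding F_def by (rule form_comp_mult[OF dm]) simp
  moreover have "form_comp 1 1 \<alpha> \<beta> = \<beta>" by (simp add: form_comp_def)
  ultimately have "Polynomial.smult c member_inf = F * \<beta>" using fh n by simp
  moreover obtain b where b: "\<beta> = [:- Q, 1:] * b" using ab(4) unfolding poly_eq_0_iff_dvd by (elim dvdE)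
  ultimately have eq: "Polynomial.smult c member_inf = [:- Q, 1:] * (b * F)" by (simp only: mult_ac)
  have "b \<noteq> 0" using ab(2) b by auto
  then have "Polynomial.degree \<beta> = 1 + Polynomial.degree b" unfolding b by (subst degree_mult_eq) auto
  then have "Polynomial.degree b = 0" using degree_split(2)[OF ab(1-3)] by simp
  then obtain b0 where b0: "b = [:b0:]" "b0 \<noteq> 0" using \<open>b \<noteq> 0\<close> by (metis degree_eq_zeroE pCons_0_0)
  have "[:- Q, 1:] * [:- Q, 1:] dvd [:- Q, 1:] * (b * F)"
    using dvd_smult[OF sq, of c] unfolding eq power2_eq_square .
  then have "[:- Q, 1:] dvd b * F" by (subst (asm) dvd_mult_cancel_left) auto
  then have "poly F Q = 0" using b0 unfolding poly_eq_0_iff_dvd[symmetric] by simp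
  then have "Polynomial.coeff member_inf (n - 1) * poly \<alpha> Q ^ (n - 1) = 0"
    unfolding F_def poly_form_comp ab(4) form_value_infinity .
  then show False using inf ab(3)[of Q] ab(4) by simp
qed

text \<open>
  By transitivity a fibre that meets \<open>T\<close> is contained in \<open>T\<close>. It has degree \<open>n\<close> and consists of ordinary
  double points, so it has \<open>n/2\<close> points; and \<open>T\<close> is a disjoint union of such fibres.
\<close>

lemma card_ramified_set:
  assumes T: "finite T" "\<And>Q. Q \<in> T \<Longrightarrow> ramified Q" and inf: "Polynomial.coeff member_inf (n - 1) \<noteq> 0"
    and closed: "\<And>Q R. Q \<in> T \<Longrightarrow> poly (member Q) R = 0 \<Longrightarrow> ramified R \<Longrightarrow> R \<in> T"
    and double: "\<And>R. R \<in> T \<Longrightarrow> poly (pderiv (pderiv (member R))) R \<noteq> 0"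
  shows "n dvd 2 * card T"
proof -
  define F where "F Q = {R. poly (member Q) R = 0}" for Q
  have sub: "F Q \<subseteq> T" if Q: "Q \<in> T" for Q
    using closed[OF Q] ramified_fibre[OF T(2)[OF Q] ramified_not_in_fibre_inf[OF T(2)[OF Q] inf]]
    unfolding F_def by blast
  have card: "2 * card (F Q) = n" if Q: "Q \<in> T" for Q
  proof -
    have "Polynomial.order R (member Q) = 2" if R: "poly (member Q) R = 0" for R
    proof -
      have RT: "R \<in> T" using sub[OF Q] R unfolding F_def by blast
      obtain c where c: "c \<noteq> 0" "member Q = Polynomial.smult c (member R)"
        using member_proportional[OF R] by blast
      have "Polynomial.order R (member R) = 2"
        using T(2)[OF RT] double[OF RT] by (intro order_eq_2 member_self) (simp add: ramified_iff)
      then show ?thesis unfolding c(2) using c(1) by (simp add: order_smult)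
    qed
    then have "2 * card (F Q) = Polynomial.degree (member Q)"
      unfolding F_def using member_nonzero by (rule card_roots_uniform_order[rotated])
    moreover have "Polynomial.coeff (member Q) n \<noteq> 0"
      using ramified_not_in_fibre_inf[OF T(2)[OF Q] inf] by (simp add: member_def member_inf_def mult.commute)
    moreover have "Polynomial.degree (member Q) \<le> n"
      unfolding member_comb using f g by (intro degree_add_le order_trans[OF degree_smult_le]) auto
    ultimately show ?thesis by (metis le_antisym le_degree)
  qed
  have U: "\<Union> (F ` T) = T" using sub member_self unfolding F_def by fastforce
  have "n div 2 dvd card (\<Union> (F ` T))"
  proof (rule dvd_partition)
    show "finite (\<Union> (F ` T))" unfolding U by (rule T(1))
    show "\<forall>c\<in>F ` T. n div 2 dvd card c" using card by force
    have "F Q = F Q'" if "R \<in> F Q" "R \<in> F Q'" for Q Q' R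
    proof -
      have "poly (member Q) R = 0" "poly (member Q') R = 0" using that unfolding F_def by auto
      then obtain c c' where "c \<noteq> 0" "member Q = Polynomial.smult c (member R)" 
        "c' \<noteq> 0" "member Q' = Polynomial.smult c' (member R)" by (metis member_proportional)
      then show ?thesis unfolding F_def by simp
    qed
    then show "\<forall>c1\<in>F ` T. \<forall>c2\<in>F ` T. c1 \<noteq> c2 \<longrightarrow> c1 \<inter> c2 = {}" by blast
  qed
  then have "n div 2 dvd card T" unfolding U .
  moreover have "n = 2 * (n div 2)" if "T \<noteq> {}" using card that by fastforce
  ultimately show ?thesis by (metis card.empty dvd_0_right mult_0_right mult_dvd_mono dvd_refl)
qed

end

section \<open>The pencils of the curve\<close>

text \<open>
  The numerical data of the curve. All that is needed from the finite field is that the \<open>q\<close>-th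
  power map is additive and fixes \<open>\<gamma>\<close>.
\<close>

locale curve3 =
  fixes q m n :: nat and \<gamma> :: "'k::alg_closed_field"
  assumes m: "m \<ge> 3" and n_m: "n = 2 * m" and n_q: "n = Suc q"
    and char_q: "of_nat q = (0 :: 'k)"
    and frobenius: "\<And>x y :: 'k. (x + y) ^ q = x ^ q + y ^ q"
    and \<gamma>_q: "\<gamma> ^ q = \<gamma>" and \<gamma>: "\<gamma> \<noteq> 0" "\<gamma> \<noteq> 1" "\<gamma> \<noteq> -1"
begin

definition "A = Polynomial.monom (1 :: 'k) m"
definition "B = [:1, 1 :: 'k:] ^ n"
definition "C = Polynomial.monom 1 n + [:\<gamma>:]"
definition "D = [:- \<gamma>, 1:] ^ n"

lemma q_odd: "odd q"
  using n_m n_q by presburger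

lemma numbers: "n > 0" "m < q" "q < n" "q \<ge> 5" "n - 1 = q" "n - m = m"
  using m n_m n_q by linarith+

lemma power_n: "x ^ n = x * x ^ q" for x :: "'a::monoid_mult"
  by (simp add: n_q)

lemma of_nat_n: "of_nat n = (1 :: 'k)"
  using char_q by (simp add: n_q)

lemma of_nat_m: "2 * of_nat m = (1 :: 'k)"
  using of_nat_n by (simp add: n_m)

lemma of_nat_m_nonzero: "of_nat m \<noteq> (0 :: 'k)"
  using of_nat_m by auto

lemma one_plus_\<gamma>: "1 + \<gamma> \<noteq> 0"
  using \<gamma>(3) by (metis add_eq_0_iff minus_minus)

lemma one_minus_\<gamma>: "1 - \<gamma> \<noteq> 0" "\<gamma> - 1 \<noteq> 0"
  using \<gamma>(2) by auto

lemma frobenius_minus: "(- x) ^ q = - (x ^ q :: 'k)"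
  using q_odd by simp

lemma frobenius_diff: "(x - y) ^ q = x ^ q - (y ^ q :: 'k)"
  using frobenius[of x "- y"] by (simp add: frobenius_minus)

lemma poly_ABCD:
  "poly A u = u ^ m" "poly B u = (u + 1) ^ n" "poly C u = u ^ n + \<gamma>" "poly D u = (u - \<gamma>) ^ n"
  by (simp_all add: A_def B_def C_def D_def poly_monom add.commute)

lemma B_expand: "B = Polynomial.monom 1 n + Polynomial.monom 1 q + [:1, 1:]"
proof (intro iffD1[OF poly_eq_iff_infinite] allI)
  show "poly B u = poly (Polynomial.monom 1 n + Polynomial.monom 1 q + [:1, 1:]) u" for u
    by (simp add: poly_ABCD power_n frobenius poly_monom algebra_simps)
qed

text \<open>
  The pencil spanned by \<open>B\<close> and \<open>C\<close> contains a second power of a linear form, because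
  \<open>\<gamma>\<close> is fixed by the Frobenius map.
\<close>

lemma D_combination: "D = Polynomial.smult (1 + \<gamma>) C - Polynomial.smult \<gamma> B"
proof (intro iffD1[OF poly_eq_iff_infinite] allI)
  show "poly D u = poly (Polynomial.smult (1 + \<gamma>) C - Polynomial.smult \<gamma> B) u" for u
    by (simp add: poly_ABCD power_n frobenius frobenius_diff \<gamma>_q poly_monom algebra_simps)
qed

lemma degrees: "Polynomial.degree A = m" "Polynomial.degree B = n" "Polynomial.degree C = n" "Polynomial.degree D = n"
  using numbers by (simp_all add: A_def B_def C_def D_def degree_monom_eq degree_power_eq degree_add_eq_left)

lemma coeffs_ABC:
  "Polynomial.coeff A i = (if i = m then 1 else 0)"
  "Polynomial.coeff B n = 1" "Polynomial.coeff B q = 1" "Polynomial.coeff B 1 = 1" "Polynomial.coeff B 0 = 1"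
  "Polynomial.coeff C n = 1" "Polynomial.coeff C q = 0" "Polynomial.coeff C 1 = 0" "Polynomial.coeff C 0 = \<gamma>"
  using numbers by (auto simp: A_def B_expand C_def coeff_pCons split: nat.split)

lemma coeffs_D: "Polynomial.coeff D n = 1" "Polynomial.coeff D q = - \<gamma>"
  unfolding D_combination by (simp_all add: coeffs_ABC)

lemma pderivs:
  "pderiv A = Polynomial.monom (of_nat m) (m - 1)" "pderiv B = [:1, 1:] ^ q" "pderiv D = [:- \<gamma>, 1:] ^ q"
  "pderiv ([:1, 1 :: 'k:] ^ q) = 0" "pderiv ([:- \<gamma>, 1:] ^ q) = 0"
proof -
  show "pderiv A = Polynomial.monom (of_nat m) (m - 1)" by (simp add: A_def pderiv_monom)
  have pd: "pderiv ([:a, 1:] ^ Suc i) = Polynomial.smult (of_nat (Suc i)) ([:a, 1:] ^ i)" for a :: 'k and i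
    by (simp only: pderiv_power_Suc) (simp add: pderiv_pCons)
  show "pderiv B = [:1, 1:] ^ q" "pderiv D = [:- \<gamma>, 1:] ^ q"
    unfolding B_def D_def using pd[of _ q, folded n_q] unfolding of_nat_n smult_1_left by auto
  obtain r where r: "q = Suc r" using numbers(4) by (cases q) auto
  have "pderiv ([:a, 1:] ^ q) = 0" for a :: 'k
    using pd[of a r, folded r] unfolding char_q by simp
  then show "pderiv ([:1, 1 :: 'k:] ^ q) = 0" "pderiv ([:- \<gamma>, 1:] ^ q) = 0" by auto
qed

text \<open>
  The only possible zero of \<open>\<alpha>\<close> and \<open>\<beta>\<close> is \<open>0\<close>, and their degrees add up to \<open>1\<close>.
\<close>

lemma monom_factor:
  fixes \<alpha> \<beta> :: "'k poly"
  assumes "\<alpha> ^ m * \<beta> ^ m = Polynomial.monom c m" "c \<noteq> 0"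
  obtains a b where "a \<noteq> 0" "b \<noteq> 0" "\<alpha> = Polynomial.monom a 1 \<and> \<beta> = [:b:] \<or> \<alpha> = [:a:] \<and> \<beta> = Polynomial.monom b 1"
proof -
  have m0: "m > 0" using m by simp
  have nz: "\<alpha> \<noteq> 0" "\<beta> \<noteq> 0" using assms m0 by (auto simp: zero_power monom_eq_0_iff)
  have "m * (Polynomial.degree \<alpha> + Polynomial.degree \<beta>) = Polynomial.degree (\<alpha> ^ m * \<beta> ^ m)"
    using nz by (simp add: degree_mult_eq degree_power_eq algebra_simps)
  also have "\<dots> = m * 1" unfolding assms(1) using assms(2) by (simp add: degree_monom_eq)
  finally have deg: "Polynomial.degree \<alpha> + Polynomial.degree \<beta> = 1" using m0 by simp
  have root: "x = 0" if "poly \<alpha> x = 0 \<or> poly \<beta> x = 0" for x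
  proof -
    have "poly (\<alpha> ^ m * \<beta> ^ m) x = 0" using that m0 by auto
    then show ?thesis unfolding assms(1) using assms(2) m0 by (simp add: poly_monom)
  qed
  have lin: "\<exists>a. a \<noteq> 0 \<and> p = Polynomial.monom a 1" if p: "Polynomial.degree p = 1" "\<And>x. poly p x = 0 \<Longrightarrow> x = 0" for p :: "'k poly"
  proof -
    obtain x where "poly p x = 0" using alg_closed_imp_poly_has_root[of p] p(1) by auto
    then have "poly p 0 = 0" using p(2) by blast
    then have "Polynomial.coeff p 0 = 0" by (simp add: poly_0_coeff_0)
    then have "p = Polynomial.monom (Polynomial.coeff p 1) 1"
    proof (intro poly_eqI)
      fix i :: nat
      show "Polynomial.coeff p i = Polynomial.coeff (Polynomial.monom (Polynomial.coeff p 1) 1) i"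
        using \<open>Polynomial.coeff p 0 = 0\<close> coeff_eq_0[of p i] p(1) by (cases "i = 0"; cases "i = 1") auto
    qed
    moreover from this have "Polynomial.coeff p 1 \<noteq> 0" using p(1) by (metis degree_0 monom_0 monom_eq_0 zero_neq_one)
    ultimately show ?thesis by blast
  qed
  have const: "\<exists>a. a \<noteq> 0 \<and> p = [:a:]" if "Polynomial.degree p = 0" "p \<noteq> 0" for p :: "'k poly"
    using that by (metis degree_eq_zeroE pCons_0_0)
  consider "Polynomial.degree \<alpha> = 1" "Polynomial.degree \<beta> = 0" | "Polynomial.degree \<alpha> = 0" "Polynomial.degree \<beta> = 1"
    using deg by linarith
  then show ?thesis
  proof cases
    case 1
    then show ?thesis using lin[of \<alpha>] const[of \<beta>] nz root that by blast
  next
    case 2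
    then show ?thesis using lin[of \<beta>] const[of \<alpha>] nz root that by blast
  qed
qed

lemma form_comp_monom:
  "form_comp n f (Polynomial.monom a 1) [:b:] = (\<Sum>i\<le>n. Polynomial.monom (Polynomial.coeff f i * a ^ i * b ^ (n - i)) i)"
  "form_comp n f [:a:] (Polynomial.monom b 1) = (\<Sum>i\<le>n. Polynomial.monom (Polynomial.coeff f i * a ^ i * b ^ (n - i)) (n - i))"
  for a b :: 'k
  by (simp_all add: form_comp_def monom_power mult_monom smult_monom poly_const_pow mult.assoc
      flip: monom_0)

text \<open>
  For a centre on the line \<open>X = 0\<close> the pencil contains \<open>u\<^sup>m\<close>, so the conjugates of \<open>u\<close> are of the
  form \<open>z u\<close> and \<open>z/u\<close>. Such a substitution multiplies \<open>f\<close> and \<open>A\<close> by the same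
  constant. If \<open>y \<noteq> 0\<close>, then \<open>u\<close> and \<open>u\<^sup>q\<close> occur in \<open>f\<close>, and their coefficients and that of \<open>u\<^sup>m\<close> in \<open>A\<close> are
  multiplied by the same constant only if \<open>z\<^sup>m\<^sup>-\<^sup>1 = 1\<close>. This leaves at most \<open>2 (m - 1) < n\<close> conjugates.
\<close>

lemma split_pencil_with_A:
  assumes sp: "split_pencil n (Polynomial.smult y B - Polynomial.smult z C) A"
  shows "y = 0"
proof (rule ccontr)
  assume y: "y \<noteq> 0"
  define f where "f = Polynomial.smult y B - Polynomial.smult z C"
  interpret split_pencil n f A using sp unfolding f_def .
  have f1: "Polynomial.coeff f 1 = y" "Polynomial.coeff f q = y"
    unfolding f_def by (simp_all only: coeff_diff coeff_smult coeffs_ABC) simp_all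
  define Z where "Z = {z::'k. z ^ (m - 1) = 1}"
  have "S \<subseteq> (\<lambda>z. const_fract z * X_fract) ` Z \<union> (\<lambda>z. const_fract z / X_fract) ` Z"
  proof
    fix r assume r: "r \<in> S"
    obtain \<alpha> \<beta> where ab: "r = Fract \<alpha> \<beta>" "\<beta> \<noteq> 0" "\<And>x. poly \<alpha> x \<noteq> 0 \<or> poly \<beta> x \<noteq> 0"
      using reduced_fract by blast
    obtain c where c: "c \<noteq> 0" "form_comp n f \<alpha> \<beta> = Polynomial.smult c f" "form_comp n A \<alpha> \<beta> = Polynomial.smult c A"
      using form_comp_split[of \<alpha> \<beta>] r ab by blast
    have "form_comp n A \<alpha> \<beta> = \<alpha> ^ m * \<beta> ^ m"
    proof -
      have "form_comp n A \<alpha> \<beta> = (\<Sum>i\<in>{m}. Polynomial.smult (Polynomial.coeff A i) (\<alpha> ^ i * \<beta> ^ (n - i)))"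
        unfolding form_comp_def using n_m by (intro sum.mono_neutral_right) (auto simp: coeffs_ABC)
      then show ?thesis by (simp add: coeffs_ABC numbers)
    qed
    then have prod: "\<alpha> ^ m * \<beta> ^ m = Polynomial.monom c m"
      unfolding c(3) by (simp add: A_def smult_monom)
    obtain a b where nz: "a \<noteq> 0" "b \<noteq> 0" and
      cases: "\<alpha> = Polynomial.monom a 1 \<and> \<beta> = [:b:] \<or> \<alpha> = [:a:] \<and> \<beta> = Polynomial.monom b 1"
      using monom_factor[OF prod c(1)] by blast
    have "a ^ m * b ^ m = c"
    proof -
      have "poly (\<alpha> ^ m * \<beta> ^ m) 1 = c" unfolding prod by (simp add: poly_monom)
      then show ?thesis using cases by (auto simp: poly_monom)
    qed
    have q: "q = m + (m - 1)" using m n_m n_q by linarith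
    obtain k where k: "m = Suc k" using m by (cases m) auto
    have pows: "x ^ m = x * x ^ (m - 1)" "x ^ q = x ^ m * x ^ (m - 1)" for x :: 'k
      unfolding q by (simp_all add: k power_add)
    show "r \<in> (\<lambda>z. const_fract z * X_fract) ` Z \<union> (\<lambda>z. const_fract z / X_fract) ` Z"
      using cases
    proof
      assume 1: "\<alpha> = Polynomial.monom a 1 \<and> \<beta> = [:b:]"
      have "Polynomial.coeff (form_comp n f \<alpha> \<beta>) 1 = (\<Sum>i\<le>n. if i = 1 then y * a * b ^ q else 0)"
        unfolding conjunct1[OF 1] conjunct2[OF 1] form_comp_monom(1) coeff_sum
        using numbers f1 by (intro sum.cong) auto
      also have "\<dots> = y * a * b ^ q" using numbers by simp
      finally have "Polynomial.coeff (form_comp n f \<alpha> \<beta>) 1 = y * a * b ^ q" .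
      then have "y * a * b ^ q = c * y" unfolding c(2) coeff_smult f1 by auto
      then have "a ^ (m - 1) = b ^ (m - 1)"
        using y nz \<open>a ^ m * b ^ m = c\<close> pows by auto
      then have "a / b \<in> Z" unfolding Z_def using nz by (simp add: power_divide)
      moreover have "r = const_fract (a / b) * X_fract"
        using 1 nz unfolding ab(1) const_fract_def X_fract_def by (simp add: eq_fract monom_altdef)
      ultimately show ?thesis by blast
    next
      assume 2: "\<alpha> = [:a:] \<and> \<beta> = Polynomial.monom b 1"
      have "Polynomial.coeff (form_comp n f \<alpha> \<beta>) 1 = (\<Sum>i\<le>n. if i = q then y * a ^ q * b else 0)"
        unfolding conjunct1[OF 2] conjunct2[OF 2] form_comp_monom(2) coeff_sum
      proof (intro sum.cong refl)
        fix i assume "i \<in> {..n}"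
        then have "n - i = 1 \<longleftrightarrow> i = q" "n - q = 1" using n_q by auto
        then show "Polynomial.coeff (Polynomial.monom (Polynomial.coeff f i * a ^ i * b ^ (n - i)) (n - i)) 1 =
          (if i = q then y * a ^ q * b else 0)"
          using f1 by auto
      qed
      then have "y * a ^ q * b = c * y" unfolding c(2) coeff_smult f1 using numbers by auto
      then have "a ^ (m - 1) = b ^ (m - 1)"
        using y nz \<open>a ^ m * b ^ m = c\<close> pows by auto
      then have "a / b \<in> Z" unfolding Z_def using nz by (simp add: power_divide)
      moreover have "r = const_fract (a / b) / X_fract"
        using 2 nz unfolding ab(1) const_fract_def X_fract_def by (simp add: eq_fract monom_altdef)
      ultimately show ?thesis by blast
    qed
  qed
  moreover have Z: "finite Z" "card Z \<le> m - 1"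
  proof -
    define p where "p = Polynomial.monom (1::'k) (m - 1) - 1"
    have "Polynomial.degree p = m - 1"
      unfolding p_def using m by (subst degree_diff_eq_left) (auto simp: degree_monom_eq)
    then have "p \<noteq> 0" using m by auto
    have "Z = {x. poly p x = 0}" unfolding Z_def p_def by (simp add: poly_monom)
    then show "finite Z" "card Z \<le> m - 1"
      using poly_roots_finite[OF \<open>p \<noteq> 0\<close>] card_poly_roots_bound[OF \<open>p \<noteq> 0\<close>] \<open>Polynomial.degree p = m - 1\<close> by auto
  qed
  ultimately have "card S \<le> card ((\<lambda>z. const_fract z * X_fract) ` Z \<union> (\<lambda>z. const_fract z / X_fract) ` Z)"
    by (intro card_mono) auto
  also have "\<dots> \<le> card Z + card Z"
    using Z(1) by (intro order_trans[OF card_Un_le] add_mono card_image_le)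
  finally show False using Z(2) split m n_m by simp
qed

text \<open>
  The number \<open>n = q + 1\<close> is coprime to \<open>q\<close> and larger than \<open>4\<close>.
\<close>

lemma n_not_dvd_small_multiple:
  assumes "n dvd 2 * q * k" "k = 1 \<or> k = 2"
  shows False
proof -
  have "coprime n q" unfolding n_q by simp
  then have "n dvd 2 * k" using assms(1) by (metis coprime_dvd_mult_left_iff mult.commute mult.left_commute)
  then show False using assms(2) numbers by (auto dest: dvd_imp_le)
qed

text \<open>
  The ramified points are the zeros of the Wronskian \<open>J\<close>. The set \<open>T\<close> of those other than \<open>-1\<close> and
  \<open>\<gamma>\<close> consists of ordinary double points of their fibres, so \<open>n\<close> divides \<open>2 |T|\<close>. On the other hand
  \<open>|T|\<close> is \<open>2 q\<close> if neither \<open>b\<close> nor \<open>d\<close> is zero; if one of them is zero, then \<open>J\<close> is the product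
  of the \<open>q\<close>-th power of \<open>u + 1\<close> or \<open>u - \<gamma>\<close> with a polynomial of degree \<open>q\<close>, and \<open>|T| = q\<close>.
\<close>

lemma split_pencil_without_A:
  assumes sp: "split_pencil n (B - Polynomial.smult b A) (D - Polynomial.smult d A)"
  shows "b = 0 \<and> d = 0"
proof (rule ccontr)
  assume bd: "\<not> (b = 0 \<and> d = 0)"
  define f where "f = B - Polynomial.smult b A"
  define g where "g = D - Polynomial.smult d A"
  interpret split_pencil n f g using sp unfolding f_def g_def .
  let ?v = "[:1, 1 :: 'k:]" and ?w = "[:- \<gamma>, 1:]"
  let ?\<mu> = "of_nat m :: 'k"
  have f'g': "pderiv f = ?v ^ q - Polynomial.smult b (pderiv A)" "pderiv g = ?w ^ q - Polynomial.smult d (pderiv A)"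
    "pderiv (pderiv f) = - Polynomial.smult b (pderiv (pderiv A))" "pderiv (pderiv g) = - Polynomial.smult d (pderiv (pderiv A))"
    unfolding f_def g_def by (simp_all only: pderiv_diff pderiv_smult pderivs(2-5)) simp_all
  define J where "J = f * pderiv g - g * pderiv f"
  have J: "ramified Q \<longleftrightarrow> poly J Q = 0" for Q
    unfolding ramified_iff member_def J_def by (simp add: pderiv_diff pderiv_smult)
  have um: "u ^ m = u * u ^ (m - 1)" for u :: 'k using m by (simp flip: power_Suc)
  \<comment> \<open>The terms with \<open>u\<^sup>m\<close> cancel because \<open>2 m = 1\<close> in \<open>k\<close>.\<close>
  have Jval: "poly J u = (1 + \<gamma>) * (u + 1) ^ q * (u - \<gamma>) ^ q - d * ?\<mu> * (u + 1) ^ q * u ^ (m - 1) * (1 - u) 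
      - b * ?\<mu> * (u - \<gamma>) ^ q * u ^ (m - 1) * (u + \<gamma>)" for u
  proof -
    define V W U M where "V = (u + 1) ^ q" and "W = (u - \<gamma>) ^ q" and "U = u ^ (m - 1)" and "M = ?\<mu>"
    have M: "2 * M = 1" unfolding M_def by (rule of_nat_m)
    have "poly J u = ((u + 1) * V - b * (u * U)) * (W - d * (M * U)) - ((u - \<gamma>) * W - d * (u * U)) * (V - b * (M * U))"
      unfolding J_def f'g' pderivs(1) V_def W_def U_def M_def
      by (simp add: f_def g_def poly_ABCD poly_monom um power_n add.commute)
    also have "\<dots> = (1 + \<gamma>) * V * W - d * V * U * (M * (u + 1) - u) + b * W * U * (M * (u - \<gamma>) - u)"
      by (simp add: algebra_simps)
    also have "M * (u + 1) - u = M * (1 - u) + u * (2 * M - 1)" by (simp add: algebra_simps)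
    also have "M * (u - \<gamma>) - u = - (M * (u + \<gamma>)) + u * (2 * M - 1)" by (simp add: algebra_simps)
    finally show ?thesis unfolding M V_def[symmetric] W_def[symmetric] U_def[symmetric] M_def[symmetric]
      by (simp add: algebra_simps)
  qed
  \<comment> \<open>Infinity is a simple zero of its member.\<close>
  have inf: "Polynomial.coeff member_inf (n - 1) \<noteq> 0"
  proof -
    have "Polynomial.coeff member_inf (n - 1) = - (1 + \<gamma>)"
      using numbers unfolding member_inf_def by (simp add: f_def g_def coeffs_ABC coeffs_D)
    then show ?thesis using one_plus_\<gamma> by (simp only: neg_equal_0_iff_equal not_False_eq_True)
  qed
  have q0: "q > 0" "m - 1 > 0" using numbers m by auto
  have J0: "poly J 0 \<noteq> 0"
    using q0 one_plus_\<gamma> \<gamma> by (simp add: Jval zero_power)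
  have signs: "- 1 - \<gamma> \<noteq> 0" "- 1 + \<gamma> \<noteq> 0"
    using one_plus_\<gamma> one_minus_\<gamma> by (auto simp: algebra_simps)
  \<comment> \<open>The point \<open>-1\<close> is ramified only if \<open>b = 0\<close>, and \<open>\<gamma>\<close> only if \<open>d = 0\<close>.\<close>
  have Jm1: "poly J (-1) \<noteq> 0" if "b \<noteq> 0"
  proof -
    have "poly J (-1) = - (b * ?\<mu> * (- 1 - \<gamma>) ^ q * (- 1) ^ (m - 1) * (- 1 + \<gamma>))"
      unfolding Jval using q0(1) by simp
    moreover have "b * ?\<mu> * (- 1 - \<gamma>) ^ q * (- 1) ^ (m - 1) * (- 1 + \<gamma>) \<noteq> 0"
      using that signs of_nat_m_nonzero unfolding mult_eq_0_iff power_eq_0_iff by simp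
    ultimately show ?thesis by (simp only: neg_equal_0_iff_equal not_False_eq_True)
  qed
  have J\<gamma>: "poly J \<gamma> \<noteq> 0" if "d \<noteq> 0"
  proof -
    have "poly J \<gamma> = - (d * ?\<mu> * (\<gamma> + 1) ^ q * \<gamma> ^ (m - 1) * (1 - \<gamma>))"
      unfolding Jval using q0(1) by simp
    moreover have "d * ?\<mu> * (\<gamma> + 1) ^ q * \<gamma> ^ (m - 1) * (1 - \<gamma>) \<noteq> 0"
      using that one_plus_\<gamma> one_minus_\<gamma> \<gamma> of_nat_m_nonzero unfolding mult_eq_0_iff power_eq_0_iff
      by (simp add: add.commute)
    ultimately show ?thesis by (simp only: neg_equal_0_iff_equal not_False_eq_True)
  qed
  define T where "T = {Q. poly J Q = 0 \<and> Q \<noteq> -1 \<and> Q \<noteq> \<gamma>}"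
  have Jnz: "J \<noteq> 0" using J0 by auto
  have finT: "finite T" unfolding T_def using poly_roots_finite[OF Jnz] by (rule rev_finite_subset) auto
  \<comment> \<open>If \<open>-1\<close> is ramified, it is the only point of its fibre, which is the zero set of \<open>B\<close>; likewise \<open>\<gamma>\<close> and \<open>D\<close>.\<close>
  have closed: "R \<in> T" if Q: "Q \<in> T" and R: "poly (member Q) R = 0" "ramified R" for Q R
  proof -
    have "R \<noteq> -1"
    proof
      assume R1: "R = -1"
      then have "b = 0" using R(2) Jm1 J by blast
      then have fB: "f = B" by (simp add: f_def)
      have "poly f R = 0" using R1 q0 by (simp add: fB poly_ABCD power_n)
      then have "poly f Q = 0" using R(1) cop[of R] by (simp add: member_def)
      then show False using Q unfolding T_def fB poly_ABCD by (auto simp: eq_neg_iff_add_eq_0)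
    qed
    moreover have "R \<noteq> \<gamma>"
    proof
      assume R1: "R = \<gamma>"
      then have "d = 0" using R(2) J\<gamma> J by blast
      then have gD: "g = D" by (simp add: g_def)
      have "poly g R = 0" using R1 q0 by (simp add: gD poly_ABCD power_n)
      then have "poly g Q = 0" using R(1) cop[of R] by (auto simp: member_def)
      then show False using Q unfolding T_def gD poly_ABCD by auto
    qed
    ultimately show ?thesis using R(2) unfolding T_def J by simp
  qed
  have mem'': "poly (pderiv (pderiv (member R))) R = poly (pderiv J) R" for R
    by (simp add: member_def J_def pderiv_diff pderiv_smult pderiv_mult algebra_simps)
  \<comment> \<open>If \<open>R\<close> is not an ordinary double point, then \<open>A\<close> drops out of the member through \<open>R\<close>. But a combination of
    the \<open>n\<close>-th powers \<open>B\<close> and \<open>D\<close> has no multiple roots except \<open>-1\<close> and \<open>\<gamma>\<close>.\<close>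
  have double: "poly (pderiv J) R \<noteq> 0" if R: "R \<in> T" for R
  proof
    assume z: "poly (pderiv J) R = 0"
    define x where "x = b * poly g R - d * poly f R"
    have R0: "R \<noteq> 0" "R + 1 \<noteq> 0" "R - \<gamma> \<noteq> 0" using R J0 unfolding T_def by (auto simp: eq_neg_iff_add_eq_0)
    have "poly (pderiv J) R = x * (?\<mu> * of_nat (m - 1) * R ^ (m - 2))"
      unfolding mem''[symmetric] x_def
      by (simp add: member_def pderiv_diff pderiv_smult f'g' pderivs(1,4,5) pderiv_monom poly_monom algebra_simps numeral_2_eq_2)
    moreover have "of_nat (m - 1) = - ?\<mu>"
      using of_nat_m m by (simp add: of_nat_diff algebra_simps)
    ultimately have "x = 0" using z R0 of_nat_m_nonzero by simp
    have "Polynomial.smult a g - Polynomial.smult c f = 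
        Polynomial.smult (b * c - d * a) A + Polynomial.smult a D - Polynomial.smult c B" for a c
      by (simp add: f_def g_def smult_diff_right smult_diff_left mult.commute)
    then have "member R = Polynomial.smult x A + Polynomial.smult (poly f R) D - Polynomial.smult (poly g R) B"
      unfolding member_def x_def .
    with \<open>x = 0\<close> have mR: "member R = Polynomial.smult (poly f R) D - Polynomial.smult (poly g R) B" by simp
    have mem: "poly (member R) R = poly f R * poly D R - poly g R * poly B R"
      "poly (pderiv (member R)) R = poly f R * poly (pderiv D) R - poly g R * poly (pderiv B) R"
      unfolding mR by (simp_all add: pderiv_diff pderiv_smult)
    have z1: "poly f R * ((R - \<gamma>) * (R - \<gamma>) ^ q) = poly g R * ((R + 1) * (R + 1) ^ q)"
      using member_self[of R] unfolding mem(1) by (simp add: poly_ABCD power_n)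
    have ram: "poly (pderiv (member R)) R = 0"
      using R unfolding T_def J[symmetric] ramified_iff by simp
    have z2: "poly f R * (R - \<gamma>) ^ q = poly g R * (R + 1) ^ q"
      using ram unfolding mem(2) pderivs(2,3) by (simp add: add.commute)
    have "(R - \<gamma>) * (poly f R * (R - \<gamma>) ^ q) = (R + 1) * (poly f R * (R - \<gamma>) ^ q)"
      using z1 unfolding z2 by (simp only: mult_ac z2[symmetric])
    then have "(1 + \<gamma>) * (poly f R * (R - \<gamma>) ^ q) = 0"
      by (simp add: algebra_simps)
    then have "poly f R = 0" using one_plus_\<gamma> R0 by simp
    moreover from this have "poly g R = 0" using z2 R0 by simp
    ultimately show False using cop by blast
  qed
  have main: "n dvd 2 * card T"
  proof (rule card_ramified_set[OF finT _ inf closed])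
    show "ramified Q" if "Q \<in> T" for Q using that unfolding T_def J by blast
    show "poly (pderiv (pderiv (member R))) R \<noteq> 0" if "R \<in> T" for R
      unfolding mem'' by (rule double[OF that])
  qed
  have simple: "Polynomial.order Q p = 1" if "J = s * p" "poly s Q \<noteq> 0" "poly p Q = 0" "Q \<in> T" for s p Q
  proof (rule order_eq_1)
    have "poly (pderiv J) Q = poly s Q * poly (pderiv p) Q"
      using that(3) unfolding that(1) by (simp add: pderiv_mult)
    then show "poly (pderiv p) Q \<noteq> 0" using double[OF that(4)] by auto
  qed (rule that(3))
  have card_T: "card T = Polynomial.degree p"
    if p: "J = s * p" "p \<noteq> 0" "\<And>Q. poly p Q = 0 \<Longrightarrow> poly s Q \<noteq> 0 \<and> Q \<noteq> -1 \<and> Q \<noteq> \<gamma>"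
      "\<And>Q. poly s Q = 0 \<Longrightarrow> Q = -1 \<or> Q = \<gamma>" for s p
  proof -
    have T: "T = {Q. poly p Q = 0}" unfolding T_def using p(1,3,4) by auto
    then have "1 * card {Q. poly p Q = 0} = Polynomial.degree p"
      using simple[OF p(1)] p(3) by (intro card_roots_uniform_order p(2)) auto
    then show ?thesis using T by simp
  qed
  have degs: "Polynomial.degree (?v ^ q) = q" "Polynomial.degree (?w ^ q) = q" "Polynomial.degree (?v ^ q * ?w ^ q) = 2 * q"
    by (simp_all add: degree_power_eq degree_mult_eq)
  define N1 where "N1 = Polynomial.smult (1 + \<gamma>) (?w ^ q) - Polynomial.monom (d * ?\<mu>) (m - 1) * [:1, -1:]"
  define N2 where "N2 = Polynomial.smult (1 + \<gamma>) (?v ^ q) - Polynomial.monom (b * ?\<mu>) (m - 1) * [:\<gamma>, 1:]"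
  have small: "Polynomial.degree (Polynomial.monom c (m - 1) * [:c', c'':]) < q" for c c' c'' :: 'k
    using degree_mult_le[of "Polynomial.monom c (m - 1)" "[:c', c'':]"] degree_monom_le[of c "m - 1"] degree_pCons_le[of c' "[:c'':]"] numbers m
    by simp
  have N: "Polynomial.degree N1 = q" "Polynomial.degree N2 = q"
  proof -
    have deg: "Polynomial.degree (Polynomial.smult (1 + \<gamma>) p - E) = q"
      if "Polynomial.degree p = q" "Polynomial.degree E < q" for p E :: "'k poly"
      using that one_plus_\<gamma> by (simp add: degree_diff_eq_left)
    show "Polynomial.degree N1 = q" "Polynomial.degree N2 = q"
      unfolding N1_def N2_def by (intro deg degs small)+
  qed
  have N0: "N1 \<noteq> 0" "N2 \<noteq> 0" using N q0 by auto
  have Nval: "poly N1 u = (1 + \<gamma>) * (u - \<gamma>) ^ q - d * ?\<mu> * u ^ (m - 1) * (1 - u)"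
    "poly N2 u = (1 + \<gamma>) * (u + 1) ^ q - b * ?\<mu> * u ^ (m - 1) * (u + \<gamma>)" for u
  proof -
    have lin: "poly ?v u = u + 1" "poly ?w u = u - \<gamma>" "poly [:1, -1:] u = 1 - u" "poly [:\<gamma>, 1:] u = u + \<gamma>"
      by simp_all
    show "poly N1 u = (1 + \<gamma>) * (u - \<gamma>) ^ q - d * ?\<mu> * u ^ (m - 1) * (1 - u)"
      "poly N2 u = (1 + \<gamma>) * (u + 1) ^ q - b * ?\<mu> * u ^ (m - 1) * (u + \<gamma>)"
      unfolding N1_def N2_def poly_diff poly_smult poly_mult poly_power poly_monom lin by simp_all
  qed
  consider "b \<noteq> 0" "d \<noteq> 0" | "b = 0" "d \<noteq> 0" | "b \<noteq> 0" "d = 0" using bd by blast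
  then show False
  proof cases
    case 1
    have "J = Polynomial.smult (1 + \<gamma>) (?v ^ q * ?w ^ q) - (?v ^ q * (Polynomial.monom (d * ?\<mu>) (m - 1) * [:1, -1:]) + ?w ^ q * (Polynomial.monom (b * ?\<mu>) (m - 1) * [:\<gamma>, 1:]))"
    proof (intro iffD1[OF poly_eq_iff_infinite] allI)
      fix u
      have lin: "poly ?v u = u + 1" "poly ?w u = u - \<gamma>" "poly [:1, -1:] u = 1 - u" "poly [:\<gamma>, 1:] u = u + \<gamma>"
        by simp_all
      show "poly J u = poly (Polynomial.smult (1 + \<gamma>) (?v ^ q * ?w ^ q) - (?v ^ q * (Polynomial.monom (d * ?\<mu>) (m - 1) * [:1, -1:]) + ?w ^ q * (Polynomial.monom (b * ?\<mu>) (m - 1) * [:\<gamma>, 1:]))) u"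
        unfolding poly_diff poly_add poly_smult poly_mult poly_power poly_monom lin Jval by (simp add: mult_ac)
    qed
    moreover have "Polynomial.degree (?v ^ q * (Polynomial.monom (d * ?\<mu>) (m - 1) * [:1, -1:]) + ?w ^ q * (Polynomial.monom (b * ?\<mu>) (m - 1) * [:\<gamma>, 1:])) < 2 * q"
    proof -
      have bound: "Polynomial.degree (p * E) < 2 * q" if "Polynomial.degree p = q" "Polynomial.degree E < q" for p E :: "'k poly"
        using degree_mult_le[of p E] that by linarith
      show ?thesis by (intro degree_add_less bound degs(1,2) small)
    qed
    ultimately have "Polynomial.degree J = 2 * q"
      using one_plus_\<gamma> degs(3) degree_smult_eq[of "1 + \<gamma>" "?v ^ q * ?w ^ q"]
      by (metis degree_diff_eq_left)
    moreover have "card T = Polynomial.degree J"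
      using Jnz Jm1 J\<gamma> 1 by (intro card_T[of 1]) auto
    ultimately show False using main n_not_dvd_small_multiple[of 2] by (simp add: mult.commute)
  next
    case 2
    have JN: "J = ?v ^ q * N1"
    proof (intro iffD1[OF poly_eq_iff_infinite] allI)
      fix u
      have v: "poly ?v u = u + 1" by simp
      show "poly J u = poly (?v ^ q * N1) u"
        unfolding poly_mult poly_power v Nval Jval 2(1) by (simp add: right_diff_distrib mult_ac)
    qed
    have "J = ?v ^ q * (?v * pderiv g - g)"
    proof -
      have fV: "f = ?v * ?v ^ q" "pderiv f = ?v ^ q"
        using 2 pderivs(2) unfolding f_def by (simp_all only: B_def power_n smult_0_left diff_zero)
      have alg: "(x * V) * a - c * V = V * (x * a - c)" for x V a c :: "'k poly" by (simp add: algebra_simps)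
      have "J = (?v * ?v ^ q) * pderiv g - g * ?v ^ q" unfolding J_def fV(2) by (subst fV(1)) (rule refl)
      then show ?thesis unfolding alg .
    qed
    then have "?v ^ q * N1 = ?v ^ q * (?v * pderiv g - g)" unfolding JN .
    moreover have "?v ^ q \<noteq> 0" by simp
    ultimately have N1: "N1 = ?v * pderiv g - g" by (rule mult_left_cancel[THEN iffD1, rotated])
    have "poly ?v (-1) = 0" by simp
    then have "poly N1 (-1) = - poly g (-1)" unfolding N1 poly_diff poly_mult by simp
    moreover have "poly f (-1) = 0" using 2 q0 by (simp add: f_def poly_ABCD power_n)
    ultimately have n1: "poly N1 (-1) \<noteq> 0" using cop by simp
    have n2: "poly N1 \<gamma> \<noteq> 0"
    proof
      assume "poly N1 \<gamma> = 0"
      then have "poly J \<gamma> = 0" unfolding JN by simp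
      then show False using J\<gamma> 2 by blast
    qed
    have "card T = Polynomial.degree N1"
    proof (rule card_T[OF JN N0(1)])
      fix Q
      show "poly (?v ^ q) Q \<noteq> 0 \<and> Q \<noteq> -1 \<and> Q \<noteq> \<gamma>" if "poly N1 Q = 0"
      proof -
        have "Q \<noteq> -1" "Q \<noteq> \<gamma>" using that n1 n2 by auto
        then show ?thesis using eq_neg_iff_add_eq_0[of Q 1] by (simp add: add.commute)
      qed
      show "Q = -1 \<or> Q = \<gamma>" if "poly (?v ^ q) Q = 0"
        using that eq_neg_iff_add_eq_0[of Q 1] by (simp add: add.commute)
    qed
    then show False using main n_not_dvd_small_multiple[of 1] N by simp
  next
    case 3
    have JN: "J = ?w ^ q * N2"
    proof (intro iffD1[OF poly_eq_iff_infinite] allI)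
      fix u
      have w: "poly ?w u = u - \<gamma>" by simp
      show "poly J u = poly (?w ^ q * N2) u"
        unfolding poly_mult poly_power w Nval Jval 3(2) by (simp add: right_diff_distrib mult_ac)
    qed
    have "J = ?w ^ q * (f - ?w * pderiv f)"
    proof -
      have gW: "g = ?w * ?w ^ q" "pderiv g = ?w ^ q"
        using 3 pderivs(3) unfolding g_def by (simp_all only: D_def power_n smult_0_left diff_zero)
      have alg: "c * V - (x * V) * a = V * (c - x * a)" for x V a c :: "'k poly" by (simp add: algebra_simps)
      have "J = f * ?w ^ q - (?w * ?w ^ q) * pderiv f" unfolding J_def gW(2) by (subst gW(1)) (rule refl)
      then show ?thesis unfolding alg .
    qed
    then have "?w ^ q * N2 = ?w ^ q * (f - ?w * pderiv f)" unfolding JN .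
    moreover have "?w ^ q \<noteq> 0" by simp
    ultimately have N2: "N2 = f - ?w * pderiv f" by (rule mult_left_cancel[THEN iffD1, rotated])
    have "poly ?w \<gamma> = 0" by simp
    then have "poly N2 \<gamma> = poly f \<gamma>" unfolding N2 poly_diff poly_mult by simp
    moreover have "poly g \<gamma> = 0" using 3 q0 by (simp add: g_def poly_ABCD power_n)
    ultimately have n1: "poly N2 \<gamma> \<noteq> 0" using cop[of \<gamma>] by auto
    have n2: "poly N2 (-1) \<noteq> 0"
    proof
      assume "poly N2 (-1) = 0"
      then have "poly J (-1) = 0" unfolding JN by simp
      then show False using Jm1 3 by blast
    qed
    have "card T = Polynomial.degree N2"
    proof (rule card_T[OF JN N0(2)])
      fix Q
      show "poly (?w ^ q) Q \<noteq> 0 \<and> Q \<noteq> -1 \<and> Q \<noteq> \<gamma>" if "poly N2 Q = 0"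
      proof -
        have "Q \<noteq> -1" "Q \<noteq> \<gamma>" using that n1 n2 by auto
        then show ?thesis by simp
      qed
      show "Q = -1 \<or> Q = \<gamma>" if "poly (?w ^ q) Q = 0"
        using that by simp
    qed
    then show False using main n_not_dvd_small_multiple[of 1] N by simp
  qed
qed

end

section \<open>Roots of unity\<close>

lemma card_power_roots:
  fixes e :: "'k::alg_closed_field"
  assumes "of_nat n \<noteq> (0 :: 'k)" "e \<noteq> 0"
  shows "card {c. c ^ n = e} = n"
proof -
  have n: "n > 0" using assms(1) by (cases n) auto
  define p where "p = Polynomial.monom 1 n - [:e:]"
  have deg: "Polynomial.degree p = n"
    unfolding p_def using n by (subst degree_diff_eq_left) (simp_all add: degree_monom_eq)
  have roots: "poly p c = 0 \<longleftrightarrow> c ^ n = e" for c by (simp add: p_def poly_monom)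
  have "Polynomial.order c p = 1" if "poly p c = 0" for c
  proof (rule order_eq_1[OF that])
    have "c \<noteq> 0" using that assms(2) n by (auto simp: roots)
    then show "poly (pderiv p) c \<noteq> 0"
      using assms(1) by (simp add: p_def pderiv_diff pderiv_monom pderiv_pCons poly_monom)
  qed
  then have "1 * card {c. poly p c = 0} = Polynomial.degree p"
    using deg n by (intro card_roots_uniform_order) auto
  then show ?thesis using deg roots by simp
qed

text \<open>The field \<open>k\<close> is algebraically closed in \<open>k(u)\<close>.\<close>

lemma const_of_power_const:
  fixes z :: "'k::alg_closed_field poly fract"
  assumes "z ^ n = const_fract e" "n > 0"
  obtains c where "z = const_fract c" "c ^ n = e"
proof -
  have "\<exists>c. z = const_fract c"
  proof (rule ccontr)
    assume "\<nexists>c. z = const_fract c"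
    moreover have "eval_fract (Polynomial.monom 1 n - [:e:]) z = 0"
      using assms(1) by (simp add: eval_fract_monom const_fract_hom)
    ultimately have "Polynomial.monom 1 n - [:e:] = 0" using eval_fract_eq_0 by blast
    then have "Polynomial.coeff (Polynomial.monom 1 n - [:e:]) n = 0" by simp
    then show False using assms(2) by (simp add: coeff_pCons split: nat.splits)
  qed
  then obtain c where c: "z = const_fract c" by blast
  have "const_fract (c ^ n) = const_fract e" using assms(1) unfolding c const_fract_power .
  then have "c ^ n = e" using const_fract_eq_0[of "c ^ n - e"] by (simp add: const_fract_hom)
  then show ?thesis using that c by blast
qed

text \<open>The multiplicative group of the field with \<open>q\<^sup>2\<close> elements is cyclic of order \<open>(q + 1)(q - 1)\<close>.\<close>

lemma primitive_root_exists:
  fixes q :: nat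
  assumes q: "q > 1" "of_nat q = (0 :: 'k::alg_closed_field)" and frob: "\<And>x y :: 'k::alg_closed_field. (x + y) ^ q = x ^ q + y ^ q"
    and odd: "odd q"
  obtains \<zeta> :: "'k::alg_closed_field" where "\<zeta> ^ (q + 1) = 1" "\<And>i. 0 < i \<Longrightarrow> i < q + 1 \<Longrightarrow> \<zeta> ^ i \<noteq> 1"
proof -
  define N where "N = q * q"
  have N: "N > 1" using q(1) unfolding N_def by (metis less_1_mult)
  define F where "F = {x :: 'k. x ^ N = x}"
  have frobN: "(x + y) ^ N = x ^ N + y ^ N" for x y :: 'k
    unfolding N_def power_mult frob ..
  have minusN: "(- x) ^ N = - (x ^ N)" for x :: 'k using odd unfolding N_def by simp
  let ?U = "ring_of_type_algebra :: 'k ring"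
  interpret U: field ?U by (rule field_from_type_algebra)
  have Us: "carrier ?U = UNIV" "\<one>\<^bsub>?U\<^esub> = 1" "\<zero>\<^bsub>?U\<^esub> = 0" "x \<otimes>\<^bsub>?U\<^esub> y = x * y" "x \<oplus>\<^bsub>?U\<^esub> y = x + y" for x y
    by (simp_all add: ring_of_type_algebra_def)
  interpret id: field_copy ?U "\<lambda>x. x"
    by unfold_locales (auto simp: Us bij_betw_def)
  have "subfield_of_type F"
    unfolding subfield_of_type_def F_def using N
    by (auto simp: frobN minusN power_mult_distrib power_inverse zero_power)
  then have F: "subfield F ?U" using id.subfield_iff[of F] by (simp add: Us)
  have cardF: "card F = N"
  proof -
    define p where "p = Polynomial.monom (1::'k) N - Polynomial.monom 1 1"
    have deg: "Polynomial.degree p = N"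
      unfolding p_def using N by (subst degree_diff_eq_left) (simp_all add: degree_monom_eq)
    have roots: "{x. poly p x = 0} = F" by (simp add: p_def poly_monom F_def)
    have "poly (pderiv p) c \<noteq> 0" for c
      using q(2) by (simp add: p_def pderiv_diff pderiv_monom poly_monom N_def)
    then have "1 * card {x. poly p x = 0} = Polynomial.degree p"
      using deg N by (intro card_roots_uniform_order order_eq_1) auto
    then show ?thesis using deg roots by simp
  qed
  interpret FF: field "?U\<lparr>carrier := F\<rparr>" using U.subfield_iff(2)[OF F] .
  have finF: "finite F" using cardF N by (metis card.infinite not_one_less_zero)
  obtain g where g: "g \<in> carrier (mult_of (?U\<lparr>carrier := F\<rparr>))"
    "carrier (mult_of (?U\<lparr>carrier := F\<rparr>)) = {g [^]\<^bsub>?U\<lparr>carrier := F\<rparr>\<^esub> i | i::nat. i \<in> UNIV}"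
    using FF.finite_field_mult_group_has_gen finF by auto
  have pow: "g [^]\<^bsub>?U\<lparr>carrier := F\<rparr>\<^esub> i = g ^ i" for i :: nat
    by (induction i) (simp_all add: nat_pow_def Us mult.commute)
  have cm: "carrier (mult_of (?U\<lparr>carrier := F\<rparr>)) = F - {0}" by (simp add: Us)
  have gen: "F - {0} = range (\<lambda>i. g ^ i)"
    using g(2) unfolding cm pow by auto
  have gF: "g \<in> F" "g \<noteq> 0" using g(1) unfolding cm by auto
  have "g ^ N = g" using gF(1) unfolding F_def by simp
  moreover have "g ^ N = g * g ^ (N - 1)" using N by (simp flip: power_Suc)
  ultimately have g1: "g ^ (N - 1) = 1" using gF(2) by simp
  have ord: "N - 1 \<le> j" if "j > 0" "g ^ j = 1" for j
  proof -
    have "range (\<lambda>i. g ^ i) \<subseteq> (\<lambda>i. g ^ i) ` {..<j}"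
    proof
      fix x assume "x \<in> range (\<lambda>i. g ^ i)"
      then obtain i where "x = g ^ i" by blast
      also have "g ^ i = g ^ (j * (i div j) + i mod j)" by simp
      also have "\<dots> = g ^ (i mod j)" unfolding power_add power_mult that(2) by simp
      finally show "x \<in> (\<lambda>i. g ^ i) ` {..<j}" using that(1) by simp
    qed
    then have "card (F - {0}) \<le> card ((\<lambda>i. g ^ i) ` {..<j})" unfolding gen by (intro card_mono) auto
    also have "\<dots> \<le> j" using card_image_le[of "{..<j}" "\<lambda>i. g ^ i"] by simp
    finally have "card (F - {0}) \<le> j" .
    moreover have "0 \<in> F" unfolding F_def using N by simp
    ultimately show ?thesis using cardF finF by simp
  qed
  have fac: "N - 1 = (q - 1) * (q + 1)" using q(1) unfolding N_def by (simp add: algebra_simps diff_mult_distrib)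
  show ?thesis
  proof (rule that[of "g ^ (q - 1)"])
    show "(g ^ (q - 1)) ^ (q + 1) = 1" unfolding power_mult[symmetric] fac[symmetric] by (rule g1)
    show "(g ^ (q - 1)) ^ i \<noteq> 1" if i: "0 < i" "i < q + 1" for i
    proof
      assume "(g ^ (q - 1)) ^ i = 1"
      then have "N - 1 \<le> (q - 1) * i"
        using ord[of "(q - 1) * i"] i q(1) by (simp add: power_mult)
      then have "q + 1 \<le> i" unfolding fac mult_le_cancel1 using q(1) by simp
      then show False using i(2) by simp
    qed
  qed
qed

section \<open>A common root criterion\<close>

text \<open>
  If two polynomials over \<open>K\<close> have exactly one common root and the first has simple roots, then
  that root lies in \<open>K\<close>: its minimal polynomial divides both and is therefore linear.
\<close>

lemma unique_common_root:
  fixes P Q :: "'a::field poly"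
  assumes K: "subfield_of_type K" and P: "poly_over K P" "P \<noteq> 0" "poly P x0 = 0" "Polynomial.degree P \<le> card {x. poly P x = 0}"
    and Q: "poly_over K Q" "poly Q x0 = 0" and unique: "\<And>x. poly P x = 0 \<Longrightarrow> poly Q x = 0 \<Longrightarrow> x = x0"
  shows "x0 \<in> K"
proof -
  define S where "S = {d. \<exists>E. poly_over K E \<and> E \<noteq> 0 \<and> poly E x0 = 0 \<and> Polynomial.degree E = d}"
  have "Polynomial.degree P \<in> S" unfolding S_def using P by blast
  then have "(LEAST d. d \<in> S) \<in> S" by (rule LeastI)
  then obtain E where E: "poly_over K E" "E \<noteq> 0" "poly E x0 = 0" "Polynomial.degree E = (LEAST d. d \<in> S)"
    unfolding S_def by blast
  have dvd: "E dvd W" if W: "poly_over K W" "poly W x0 = 0" for W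
  proof -
    obtain A B where AB: "poly_over K A" "poly_over K B" "W = A * E + B" "B = 0 \<or> Polynomial.degree B < Polynomial.degree E"
      using poly_over_division[OF K E(1,2) W(1)] by blast
    have "B = 0"
    proof (rule ccontr)
      assume B: "B \<noteq> 0"
      have "poly B x0 = 0" using W(2) AB(3) E(3) by simp
      then have "Polynomial.degree B \<in> S" unfolding S_def using AB(2) B by blast
      then have "Polynomial.degree E \<le> Polynomial.degree B" unfolding E(4) by (rule Least_le)
      then show False using AB(4) B by simp
    qed
    then show ?thesis using AB(3) by simp
  qed
  obtain A where A: "P = E * A" using dvd[OF P(1,3)] by (elim dvdE)
  then have A0: "A \<noteq> 0" using P(2) by auto
  have "{x. poly P x = 0} = {x. poly E x = 0} \<union> {x. poly A x = 0}" unfolding A by auto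
  then have "card {x. poly P x = 0} \<le> card {x. poly E x = 0} + card {x. poly A x = 0}" by (simp add: card_Un_le)
  moreover have "{x. poly E x = 0} \<subseteq> {x0}"
    using unique dvd[OF P(1,3)] dvd[OF Q] by (auto elim!: dvdE)
  then have "card {x. poly E x = 0} \<le> 1" using card_mono[of "{x0}"] by fastforce
  moreover have "card {x. poly A x = 0} \<le> Polynomial.degree A" by (rule card_poly_roots_bound[OF A0])
  moreover have "Polynomial.degree P = Polynomial.degree E + Polynomial.degree A"
    unfolding A using E(2) A0 by (rule degree_mult_eq)
  ultimately have "Polynomial.degree E \<le> 1" using P(4) by linarith
  moreover have "Polynomial.degree E \<noteq> 0" using E(2,3) by (metis degree_eq_zeroE poly_const_conv pCons_0_0)
  ultimately have d: "Polynomial.degree E = 1" by linarith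
  have "poly E x0 = Polynomial.coeff E 0 + Polynomial.coeff E 1 * x0"
    unfolding poly_altdef d by simp
  then have "Polynomial.coeff E 1 * x0 = - Polynomial.coeff E 0"
    using E(3) by (simp add: eq_neg_iff_add_eq_0 add.commute)
  moreover have "Polynomial.coeff E 1 \<noteq> 0" using E(2) d by (metis leading_coeff_0_iff)
  ultimately have "x0 = - Polynomial.coeff E 0 / Polynomial.coeff E 1"
    by (simp only: nonzero_eq_divide_eq mult.commute not_False_eq_True)
  then show ?thesis
    using E(1) subfield_of_typeD(5,8)[OF K] unfolding poly_over_def by metis
qed

section \<open>The curve is rational\<close>

context curve3
begin

lemma form_values:
  "form_value n A s t = s ^ m * t ^ m" "form_value n B s t = (s + t) ^ n" "form_value n C s t = s ^ n + \<gamma> * t ^ n"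
proof -
  show "form_value n A s t = s ^ m * t ^ m"
    unfolding A_def using numbers by (simp add: form_value_monom)
  show "form_value n B s t = (s + t) ^ n"
    unfolding B_def by (subst form_value_power) (simp_all add: form_value_def add.commute)
  have "[:\<gamma>:] = Polynomial.monom \<gamma> 0" by (simp add: monom_0)
  then show "form_value n C s t = s ^ n + \<gamma> * t ^ n"
    unfolding C_def by (simp add: form_value_add form_value_monom)
qed

definition curve :: "('k \<times> 'k \<times> 'k) set set" where "curve = curve_C3 q \<gamma>"

lemma curve_eq: "curve = {proj_point (form_value n A s t, form_value n B s t, form_value n C s t) | s t. (s, t) \<noteq> (0, 0)}"
proof -
  have "(q + 1) div 2 = m" "q + 1 = n" using n_m n_q by linarith+
  then show ?thesis unfolding curve_def curve_C3_def form_values by simp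
qed

lemma X_fract_nonzero: "X_fract \<noteq> (0 :: 'k poly fract)"
  by (simp add: X_fract_def Zero_fract_def eq_fract)

lemma X_fract_nonconst: "X_fract \<notin> range (const_fract :: 'k \<Rightarrow> _)"
  by (auto simp: X_fract_def const_fract_def eq_fract)

lemma nonconst:
  fixes z :: 'k
  assumes "z \<noteq> 0"
  shows "const_fract z * X_fract \<notin> range const_fract" "const_fract z / X_fract \<notin> range const_fract"
proof -
  have z: "const_fract z \<noteq> 0" using assms by (simp add: const_fract_eq_0)
  have cz: "const_fract c / const_fract z = const_fract (c / z)" for c
  proof -
    have "const_fract (c / z) * const_fract z = const_fract c" using assms by (simp flip: const_fract_hom)
    then show ?thesis using z by (simp add: field_simps)
  qed
  show "const_fract z * X_fract \<notin> range const_fract"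
  proof
    assume "const_fract z * X_fract \<in> range const_fract"
    then obtain c where "const_fract z * X_fract = const_fract c" by blast
    then have "X_fract = const_fract c / const_fract z" using z by (simp add: field_simps)
    then show False using X_fract_nonconst unfolding cz by blast
  qed
  show "const_fract z / X_fract \<notin> range const_fract"
  proof
    assume "const_fract z / X_fract \<in> range const_fract"
    then obtain c where c: "const_fract z / X_fract = const_fract c" by blast
    then have "const_fract c \<noteq> 0" using z X_fract_nonzero by (metis divide_eq_0_iff)
    then have c0: "c \<noteq> 0" by (simp add: const_fract_eq_0)
    have "X_fract = const_fract z / const_fract c" using c X_fract_nonzero \<open>const_fract c \<noteq> 0\<close> by (simp add: field_simps)
    moreover have "const_fract z / const_fract c = const_fract (z / c)"
    proof -
      have "const_fract (z / c) * const_fract c = const_fract z" using c0 by (simp flip: const_fract_hom)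
      then show ?thesis using \<open>const_fract c \<noteq> 0\<close> by (simp add: field_simps)
    qed
    ultimately show False using X_fract_nonconst by auto
  qed
qed

lemma evals: "eval_fract A r = r ^ m" "eval_fract B r = (r + 1) ^ n" "eval_fract C r = r ^ n + const_fract \<gamma>"
  by (simp_all add: A_def B_def C_def eval_fract_monom const_fract_hom add.commute)

lemma Fract_ABC: "Fract A 1 = X_fract ^ m" "Fract B 1 = (X_fract + 1) ^ n" "Fract C 1 = X_fract ^ n + const_fract \<gamma>"
  unfolding eval_fract_X[symmetric] evals by (rule refl)+

lemma ABC_nonzero: "A \<noteq> 0" "B \<noteq> 0" "C \<noteq> 0"
  using degrees numbers m by auto

text \<open>The conjugates of \<open>u\<close> with respect to the projection from \<open>(0 : 1 : 0)\<close>.\<close>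

lemma fibre_CA:
  "poly (fibre_poly C A) r = 0 \<longleftrightarrow> (r ^ m - X_fract ^ m) * (r ^ m * X_fract ^ m - const_fract \<gamma>) = 0"
proof -
  have "x ^ n = x ^ m * x ^ m" for x :: "'k poly fract" by (simp add: n_m mult_2 power_add)
  then show ?thesis
    unfolding fibre_poly_roots[OF ABC_nonzero(1)] evals Fract_ABC by (simp add: algebra_simps)
qed

lemma fibre_CA_cases:
  assumes "poly (fibre_poly C A) r = 0"
  obtains z where "z ^ m = 1" "r = const_fract z * X_fract" | z where "z ^ m = \<gamma>" "r = const_fract z / X_fract"
proof -
  have m0: "m > 0" using m by simp
  consider "r ^ m = X_fract ^ m" | "r ^ m * X_fract ^ m = const_fract \<gamma>"
    using assms unfolding fibre_CA by auto
  then show ?thesis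
  proof cases
    case 1
    then have "(r / X_fract) ^ m = const_fract 1" using X_fract_nonzero by (simp add: power_divide const_fract_hom)
    then obtain z where "r / X_fract = const_fract z" "z ^ m = 1" using const_of_power_const m0 by blast
    then show ?thesis using that(1)[of z] X_fract_nonzero by (simp add: field_simps)
  next
    case 2
    then have "(r * X_fract) ^ m = const_fract \<gamma>" by (simp add: power_mult_distrib)
    then obtain z where "r * X_fract = const_fract z" "z ^ m = \<gamma>" using const_of_power_const m0 by blast
    then show ?thesis using that(2)[of z] X_fract_nonzero by (simp add: field_simps)
  qed
qed

lemma const_fract_inj: "const_fract x = const_fract y \<longleftrightarrow> x = (y :: 'k)"
  using const_fract_eq_0[of "x - y"] by (simp add: const_fract_hom)

lemma card_fibre_CA: "n \<le> card {r. poly (fibre_poly C A) r = 0}"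
proof -
  define Z1 where "Z1 = {z::'k. z ^ m = 1}"
  define Z2 where "Z2 = {z::'k. z ^ m = \<gamma>}"
  have Z: "card Z1 = m" "card Z2 = m"
    unfolding Z1_def Z2_def using card_power_roots[OF of_nat_m_nonzero] \<gamma>(1) by simp_all
  have fin: "finite Z1" "finite Z2" using Z m by (metis card.infinite not_numeral_le_zero)+
  have "fibre_poly C A \<noteq> 0"
  proof
    assume "fibre_poly C A = 0"
    then have "poly (fibre_poly C A) 0 = 0" by simp
    then show False using m \<gamma>(1) X_fract_nonzero by (simp add: fibre_CA zero_power const_fract_eq_0)
  qed
  then have finR: "finite {r. poly (fibre_poly C A) r = 0}" by (rule poly_roots_finite)
  let ?f1 = "\<lambda>z. const_fract z * X_fract :: 'k poly fract" and ?f2 = "\<lambda>z. const_fract z / X_fract :: 'k poly fract"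
  have "?f1 ` Z1 \<union> ?f2 ` Z2 \<subseteq> {r. poly (fibre_poly C A) r = 0}"
    using X_fract_nonzero
    by (auto simp: fibre_CA Z1_def Z2_def power_mult_distrib power_divide const_fract_hom simp flip: const_fract_power)
  then have "card (?f1 ` Z1 \<union> ?f2 ` Z2) \<le> card {r. poly (fibre_poly C A) r = 0}"
    by (rule card_mono[OF finR])
  moreover have "card (?f1 ` Z1 \<union> ?f2 ` Z2) = card (?f1 ` Z1) + card (?f2 ` Z2)"
  proof (rule card_Un_disjoint)
    show "?f1 ` Z1 \<inter> ?f2 ` Z2 = {}"
    proof (rule ccontr)
      assume "?f1 ` Z1 \<inter> ?f2 ` Z2 \<noteq> {}"
      then obtain z z' where z: "z ^ m = 1" "const_fract z * X_fract = const_fract z' / (X_fract :: 'k poly fract)"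
        unfolding Z1_def by auto
      then have "const_fract z * X_fract ^ 2 = (const_fract z' :: 'k poly fract)"
        using X_fract_nonzero by (simp add: field_simps power2_eq_square)
      then have "eval_fract (Polynomial.monom z 2 - [:z':]) X_fract = 0" by (simp add: eval_fract_monom)
      then have "Polynomial.monom z 2 - [:z':] = 0" using eval_fract_eq_0[OF X_fract_nonconst] by blast
      then have "Polynomial.coeff (Polynomial.monom z 2 - [:z':]) 2 = 0" by simp
      then have "z = 0" by (simp add: coeff_pCons split: nat.splits)
      then show False using z(1) m by (simp add: zero_power)
    qed
  qed (use fin in auto)
  moreover have "card (?f1 ` Z1) = m" "card (?f2 ` Z2) = m"
  proof -
    have "inj_on ?f1 Z1" "inj_on ?f2 Z2" using X_fract_nonzero by (auto intro!: inj_onI simp: const_fract_inj)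
    then show "card (?f1 ` Z1) = m" "card (?f2 ` Z2) = m" using Z by (simp_all only: card_image)
  qed
  ultimately show ?thesis using n_m by simp
qed

lemma degree_fibre_CA: "Polynomial.degree (fibre_poly C A) \<le> n"
  using numbers by (intro degree_fibre_poly) (simp_all add: degrees)

text \<open>
  The element \<open>u\<close> is the only common root of the fibre polynomials of \<open>C/A\<close> and \<open>B/A\<close>. Indeed, a root
  of the former is \<open>z u\<close> or \<open>z/u\<close>. Inserting it into the latter shows that \<open>(z u + 1)\<^sup>n\<close> or
  \<open>(u + z)\<^sup>n\<close> is a constant multiple of \<open>(u + 1)\<^sup>n\<close>. Evaluation at \<open>-1\<close> gives \<open>z = 1\<close>, and in the
  second case \<open>z\<^sup>m = \<gamma>\<close> contradicts \<open>\<gamma> \<noteq> 1\<close>.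
\<close>

lemma birational_criterion:
  assumes S: "subfield_of_type S" "\<And>k. const_fract k \<in> S" and CA: "Fract C A \<in> S" and BA: "Fract B A \<in> S"
  shows "X_fract \<in> (S :: 'k poly fract set)"
proof (rule unique_common_root[OF S(1), where P = "fibre_poly C A" and Q = "fibre_poly B A"])
  have over: "poly_over S (fibre_poly f A)" if "Fract f A \<in> S" for f
    using fibre_poly_over[of f A] simple_field(4)[OF S that] unfolding poly_over_def by blast
  show "poly_over S (fibre_poly C A)" "poly_over S (fibre_poly B A)" by (rule over[OF CA], rule over[OF BA])
  show "fibre_poly C A \<noteq> 0"
  proof
    assume "fibre_poly C A = 0"
    then have "poly (fibre_poly C A) 0 = 0" by simp
    then show False using m \<gamma>(1) X_fract_nonzero by (simp add: fibre_CA zero_power const_fract_eq_0)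
  qed
  show "poly (fibre_poly C A) X_fract = 0" "poly (fibre_poly B A) X_fract = 0"
    using fibre_poly_X[OF ABC_nonzero(1)] by auto
  show "Polynomial.degree (fibre_poly C A) \<le> card {x. poly (fibre_poly C A) x = 0}"
    using card_fibre_CA degree_fibre_CA by linarith
  fix r assume r: "poly (fibre_poly C A) r = 0" "poly (fibre_poly B A) r = 0"
  have B: "(r + 1) ^ n * X_fract ^ m = r ^ m * (X_fract + 1) ^ n"
    using r(2) unfolding fibre_poly_roots[OF ABC_nonzero(1)] evals Fract_ABC .
  have at: "poly p (-1) = 0" if "eval_fract p X_fract = eval_fract ([:1, 1 :: 'k:] ^ n) X_fract * const_fract c" for p c
  proof -
    have "eval_fract (p - Polynomial.smult c ([:1, 1 :: 'k:] ^ n)) X_fract = 0" using that by (simp add: mult.commute)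
    then have "p = Polynomial.smult c ([:1, 1 :: 'k:] ^ n)" using eval_fract_eq_0[OF X_fract_nonconst] by fastforce
    then show ?thesis using numbers(1) by simp
  qed
  show "r = X_fract"
    using r(1)
  proof (cases rule: fibre_CA_cases)
    case (1 z)
    have "(const_fract z * X_fract + 1) ^ n * X_fract ^ m = X_fract ^ m * (X_fract + 1) ^ n"
      using B unfolding 1(2) power_mult_distrib by (simp add: 1(1) const_fract_hom flip: const_fract_power)
    then have "(const_fract z * X_fract + 1) ^ n = (X_fract + 1) ^ n" using X_fract_nonzero by simp
    then have "poly ([:1, z:] ^ n) (-1) = 0"
      by (intro at[where c = 1]) (simp add: const_fract_hom algebra_simps)
    then have "z = 1" by simp
    then show ?thesis unfolding 1(2) by (simp add: const_fract_hom)
  next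
    case (2 z)
    have "(r + 1) * X_fract = const_fract z + X_fract" unfolding 2(2) using X_fract_nonzero by (simp add: field_simps)
    then have "(const_fract z + X_fract) ^ n * X_fract ^ m = X_fract ^ n * ((r + 1) ^ n * X_fract ^ m)"
      by (simp only: power_mult_distrib[symmetric] mult_ac flip: mult.assoc)
    then have 3: "(const_fract z + X_fract) ^ n * X_fract ^ m = X_fract ^ n * (r ^ m * (X_fract + 1) ^ n)"
      unfolding B .
    have 4: "X_fract ^ n * r ^ m = X_fract ^ m * const_fract \<gamma>"
      unfolding 2(2) using X_fract_nonzero by (simp add: power_divide n_m mult_2 power_add 2(1) flip: const_fract_power)
    have "X_fract ^ m * (const_fract z + X_fract) ^ n = (X_fract ^ n * r ^ m) * (X_fract + 1) ^ n"
      using 3 by (simp only: mult.commute mult.left_commute mult.assoc)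
    also have "\<dots> = X_fract ^ m * ((X_fract + 1) ^ n * const_fract \<gamma>)"
      unfolding 4 by (simp only: mult.commute mult.left_commute mult.assoc)
    finally have "X_fract ^ m * (const_fract z + X_fract) ^ n = X_fract ^ m * ((X_fract + 1) ^ n * const_fract \<gamma>)" .
    then have "(const_fract z + X_fract) ^ n = (X_fract + 1) ^ n * const_fract \<gamma>" using X_fract_nonzero by simp
    then have "poly ([:z, 1:] ^ n) (-1) = 0"
      by (intro at[where c = \<gamma>]) (simp add: const_fract_hom algebra_simps)
    then have "z = 1" using numbers by simp
    then show ?thesis using 2(1) \<gamma>(2) by simp
  qed
qed

sublocale rational_curve n A B C curve
proof
  show "Polynomial.degree A \<le> n" "Polynomial.degree B \<le> n" "Polynomial.degree C \<le> n"
    using degrees numbers by simp_all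
  show "(form_value n A s t, form_value n B s t, form_value n C s t) \<noteq> (0, 0, 0)" if "(s, t) \<noteq> (0, 0)" for s t :: 'k
  proof
    assume "(form_value n A s t, form_value n B s t, form_value n C s t) = (0, 0, 0)"
    then have "s ^ m * t ^ m = 0" "(s + t) ^ n = 0" unfolding form_values by simp_all
    then have "s = 0 \<or> t = 0" "s + t = 0" by auto
    then show False using that by auto
  qed
  show "curve = {proj_point (form_value n A s t, form_value n B s t, form_value n C s t) | s t. (s, t) \<noteq> (0, 0)}"
    by (rule curve_eq)
  show "X_fract \<in> S" if "subfield_of_type S" "\<And>k. const_fract k \<in> S"
    "\<And>f g. f \<in> {A, B, C} \<Longrightarrow> g \<in> {A, B, C} \<Longrightarrow> g \<noteq> 0 \<Longrightarrow> Fract f g \<in> S" for S :: "'k poly fract set"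
    using that ABC_nonzero by (intro birational_criterion) auto
qed

end

section \<open>The centres outside the curve\<close>

lemma proj_point_scale:
  assumes "c \<noteq> 0"
  shows "proj_point (c * x, c * y, c * z) = proj_point (x, y, z)"
proof (intro equalityI subsetI)
  fix w assume "w \<in> proj_point (c * x, c * y, c * z)"
  then obtain d where "w = (d * (c * x), d * (c * y), d * (c * z))" "d \<noteq> 0" unfolding proj_point_def by auto
  then show "w \<in> proj_point (x, y, z)"
    unfolding proj_point_def prod.case using assms by (intro CollectI exI[of _ "d * c"]) simp
next
  fix w assume "w \<in> proj_point (x, y, z)"
  then obtain d where "w = (d * x, d * y, d * z)" "d \<noteq> 0" unfolding proj_point_def by auto
  then show "w \<in> proj_point (c * x, c * y, c * z)"
    unfolding proj_point_def prod.case using assms by (intro CollectI exI[of _ "d / c"]) simp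
qed

context curve3
begin

abbreviation "cX \<equiv> [:0, 1:] :: 'k poly3"
abbreviation "cY \<equiv> [:[:0, 1:]:] :: 'k poly3"
abbreviation "cZ \<equiv> [:[:[:0, 1:]:]:] :: 'k poly3"

lemma pull_linear:
  assumes "\<And>x y z. eval3 L (x, y, z) = l1 * x + l2 * y + l3 * z"
  shows "\<phi> L = Polynomial.smult l1 A + Polynomial.smult l2 B + Polynomial.smult l3 C"
  by (rule pull_eqI) (simp add: assms)

lemma form_value_pull:
  assumes "homogeneous 1 L"
  shows "eval3 L (form_value n A s t, form_value n B s t, form_value n C s t) = form_value n (\<phi> L) s t"
proof -
  obtain l1 l2 l3 where L: "\<And>x y z. eval3 L (x, y, z) = l1 * x + l2 * y + l3 * z"
    using linear_form[OF assms] by blast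
  show ?thesis unfolding pull_linear[OF L] L by (simp add: form_value_add form_value_smult)
qed

text \<open>
  A base point of the pencil would be a point of the curve at which both forms vanish, hence \<open>P\<close>.
\<close>

lemma outer_no_base_point:
  assumes P: "P = proj_point p" "P \<notin> curve" and lp: "linear_projection P L M" and st: "(s, t) \<noteq> (0, 0)"
  shows "form_value n (\<phi> L) s t \<noteq> 0 \<or> form_value n (\<phi> M) s t \<noteq> 0"
proof (rule ccontr)
  assume neg: "\<not> ?thesis"
  let ?v = "(form_value n A s t, form_value n B s t, form_value n C s t)"
  have "eval3 L ?v = 0" "eval3 M ?v = 0"
    using neg lp form_value_pull unfolding linear_projection_def by auto
  then have "?v \<in> P" using lp no_base_point[OF st] unfolding linear_projection_def by blast
  then obtain c x y z where c: "c \<noteq> 0" "p = (x, y, z)" "?v = (c * x, c * y, c * z)"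
    unfolding P(1) proj_point_def by (cases p) auto
  have "proj_point ?v = P" unfolding c(3) P(1) c(2) by (rule proj_point_scale[OF c(1)])
  moreover have "proj_point ?v \<in> curve" unfolding curve_eq using st by blast
  ultimately show False using P(2) by simp
qed

lemma outer_coprime:
  assumes P: "P = proj_point p" "P \<notin> curve" and lp: "linear_projection P L M"
    and f: "\<phi> L = f" "Polynomial.degree f \<le> n" and g: "\<phi> M = g" "Polynomial.degree g \<le> n"
  shows "poly f x = 0 \<Longrightarrow> poly g x \<noteq> 0"
proof -
  show "poly f x = 0 \<Longrightarrow> poly g x \<noteq> 0"
    using outer_no_base_point[OF P lp, of x 1] form_value_affine[OF f(2), of 1 x] form_value_affine[OF g(2), of 1 x]
    unfolding f(1) g(1) by simp
qed

lemma projection_line: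
  fixes p2 p3 :: 'k
  assumes p: "p2 \<noteq> 0 \<or> p3 \<noteq> 0"
  defines "L \<equiv> const3 p3 * cY - const3 p2 * cZ" and "P \<equiv> proj_point (0, p2, p3)"
  shows "linear_projection P L cX" "\<phi> L = Polynomial.smult p3 B - Polynomial.smult p2 C" "\<phi> cX = A"
    and "\<psi> ` projection_subfield curve P = simple_field (Fract (Polynomial.smult p3 B - Polynomial.smult p2 C) A)"
proof -
  have eL: "eval3 L (x, y, z) = p3 * y - p2 * z" for x y z
    unfolding L_def by (simp only: eval3_simps eval3_variables)
  have hom: "homogeneous 1 L" "homogeneous 1 cX"
    unfolding L_def by (intro homogeneous_diff homogeneous_scale homogeneous_variables)+
  have "{v. v \<noteq> (0, 0, 0) \<and> eval3 L v = 0 \<and> eval3 cX v = 0} = P"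
  proof (intro equalityI subsetI)
    fix v assume "v \<in> {v. v \<noteq> (0, 0, 0) \<and> eval3 L v = 0 \<and> eval3 cX v = 0}"
    moreover obtain x y z where v: "v = (x, y, z)" by (cases v)
    ultimately have *: "(y, z) \<noteq> (0, 0)" "p3 * y = p2 * z" "x = 0" by (auto simp: eL eval3_variables)
    define c where "c = (if p2 \<noteq> 0 then y / p2 else z / p3)"
    have "y = c * p2 \<and> z = c * p3" using *(2) p unfolding c_def by (auto simp: field_simps)
    moreover from this have "c \<noteq> 0" using *(1) by auto
    ultimately show "v \<in> P" unfolding v P_def proj_point_def using *(3) by auto
  next
    fix v assume "v \<in> P"
    then show "v \<in> {v. v \<noteq> (0, 0, 0) \<and> eval3 L v = 0 \<and> eval3 cX v = 0}"
      using p by (auto simp: P_def proj_point_def eL eval3_variables mult_ac)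
  qed
  then show lp: "linear_projection P L cX" unfolding linear_projection_def using hom by simp
  show fL: "\<phi> L = Polynomial.smult p3 B - Polynomial.smult p2 C"
    using pull_linear[of L 0 p3 "- p2"] by (simp add: eL)
  show fX: "\<phi> cX = A" by simp
  show "\<psi> ` projection_subfield curve P = simple_field (Fract (Polynomial.smult p3 B - Polynomial.smult p2 C) A)"
  proof (rule projection_subfield[OF lp fL[symmetric] fX[symmetric] ABC_nonzero(1)])
    fix L' assume L': "homogeneous 1 L'" "\<And>v. v \<in> P \<Longrightarrow> eval3 L' v = 0"
    obtain l1 l2 l3 where l: "\<And>x y z. eval3 L' (x, y, z) = l1 * x + l2 * y + l3 * z"
      using linear_form[OF L'(1)] by blast
    have "(0, p2, p3) \<in> P" unfolding P_def proj_point_def by (auto intro: exI[of _ 1])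
    then have 0: "l2 * p2 + l3 * p3 = 0" using L'(2) l by fastforce
    define e where "e = (if p3 \<noteq> 0 then l2 / p3 else - l3 / p2)"
    have e: "l2 = e * p3" "l3 = - (e * p2)"
      using 0 p unfolding e_def by (auto simp: field_simps eq_neg_iff_add_eq_0)
    have "\<phi> L' = Polynomial.smult e (Polynomial.smult p3 B - Polynomial.smult p2 C) + Polynomial.smult l1 A"
      unfolding pull_linear[OF l] unfolding e by (simp add: algebra_simps smult_diff_right)
    then show "\<exists>\<alpha> \<beta>. \<phi> L' = Polynomial.smult \<alpha> (Polynomial.smult p3 B - Polynomial.smult p2 C) + Polynomial.smult \<beta> A"
      by blast
  qed
qed

text \<open>
  For a centre off the line \<open>X = 0\<close> the second form is chosen such that it restricts to \<open>D - d A\<close>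
  rather than \<open>C - z0 A\<close>, because \<open>B\<close> and \<open>D\<close> are \<open>n\<close>-th powers.
\<close>

lemma projection_affine:
  fixes b z0 :: 'k
  defines "L \<equiv> cY - const3 b * cX" and "P \<equiv> proj_point (1, b, z0)"
  defines "M \<equiv> const3 (1 + \<gamma>) * (cZ - const3 z0 * cX) - const3 \<gamma> * L" and "d \<equiv> (1 + \<gamma>) * z0 - \<gamma> * b"
  shows "linear_projection P L M" "\<phi> L = B - Polynomial.smult b A" "\<phi> M = D - Polynomial.smult d A"
    and "\<psi> ` projection_subfield curve P = simple_field (Fract (B - Polynomial.smult b A) (D - Polynomial.smult d A))"
proof -
  have eL: "eval3 L (x, y, z) = y - b * x" for x y z
    unfolding L_def by (simp only: eval3_simps eval3_variables)
  have eM: "eval3 M (x, y, z) = (1 + \<gamma>) * (z - z0 * x) - \<gamma> * (y - b * x)" for x y z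
    unfolding M_def by (simp only: eval3_simps eval3_variables eL)
  have hom: "homogeneous 1 L" "homogeneous 1 M"
    unfolding M_def L_def by (intro homogeneous_diff homogeneous_scale homogeneous_variables)+
  have "{v. v \<noteq> (0, 0, 0) \<and> eval3 L v = 0 \<and> eval3 M v = 0} = P"
  proof (intro equalityI subsetI)
    fix v assume "v \<in> {v. v \<noteq> (0, 0, 0) \<and> eval3 L v = 0 \<and> eval3 M v = 0}"
    moreover obtain x y z where v: "v = (x, y, z)" by (cases v)
    ultimately have *: "(x, y, z) \<noteq> (0, 0, 0)" "y = x * b" "(1 + \<gamma>) * (z - z0 * x) = 0" by (auto simp: eL eM)
    have "z = x * z0" using *(3) one_plus_\<gamma> by simp
    then show "v \<in> P" unfolding v P_def proj_point_def using *(1,2) by auto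
  next
    fix v assume "v \<in> P"
    then show "v \<in> {v. v \<noteq> (0, 0, 0) \<and> eval3 L v = 0 \<and> eval3 M v = 0}"
      by (auto simp: P_def proj_point_def eL eM mult_ac)
  qed
  then show lp: "linear_projection P L M" unfolding linear_projection_def using hom by simp
  show fL: "\<phi> L = B - Polynomial.smult b A"
    using pull_linear[of L "- b" 1 0] by (simp add: eL)
  show fM: "\<phi> M = D - Polynomial.smult d A"
  proof (rule pull_eqI)
    fix u
    show "eval3 M (poly A u, poly B u, poly C u) = poly (D - Polynomial.smult d A) u"
      unfolding D_combination eM d_def by (simp add: algebra_simps)
  qed
  have "Polynomial.coeff (D - Polynomial.smult d A) n = 1"
    using numbers by (simp add: coeffs_ABC coeffs_D)
  then have nz: "D - Polynomial.smult d A \<noteq> 0" by (metis coeff_0 zero_neq_one)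
  show "\<psi> ` projection_subfield curve P = simple_field (Fract (B - Polynomial.smult b A) (D - Polynomial.smult d A))"
  proof (rule projection_subfield[OF lp fL[symmetric] fM[symmetric] nz])
    fix L' assume L': "homogeneous 1 L'" "\<And>v. v \<in> P \<Longrightarrow> eval3 L' v = 0"
    obtain l1 l2 l3 where l: "\<And>x y z. eval3 L' (x, y, z) = l1 * x + l2 * y + l3 * z"
      using linear_form[OF L'(1)] by blast
    have "(1, b, z0) \<in> P" unfolding P_def proj_point_def by (auto intro: exI[of _ 1])
    then have "l1 + l2 * b + l3 * z0 = 0" using L'(2) l by fastforce
    then have l1: "l1 = - (l2 * b + l3 * z0)" by (metis eq_neg_iff_add_eq_0 add.assoc)
    define e where "e = l3 / (1 + \<gamma>)"
    have e: "l3 = e * (1 + \<gamma>)" unfolding e_def using one_plus_\<gamma> by simp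
    have "\<phi> L' = Polynomial.smult (l2 + e * \<gamma>) (B - Polynomial.smult b A) + Polynomial.smult e (D - Polynomial.smult d A)"
    proof (rule pull_eqI)
      fix u
      show "eval3 L' (poly A u, poly B u, poly C u) =
        poly (Polynomial.smult (l2 + e * \<gamma>) (B - Polynomial.smult b A) + Polynomial.smult e (D - Polynomial.smult d A)) u"
        unfolding D_combination l l1 e d_def by (simp add: algebra_simps)
    qed
    then show "\<exists>\<alpha> \<beta>. \<phi> L' = Polynomial.smult \<alpha> (B - Polynomial.smult b A) + Polynomial.smult \<beta> (D - Polynomial.smult d A)"
      by blast
  qed
qed

text \<open>
  At an outer Galois point the pencil of lines through it restricts to a totally split pencil.
\<close>

lemma outer_galois_point_cases:
  assumes "outer_galois_point curve P"
  shows "P = proj_point (0, 1, 0) \<or> P = proj_point (1, 0, 0)"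
proof -
  have G: "galois_extension (function_field curve) (projection_subfield curve P)" and out: "P \<notin> curve"
    and "P \<in> proj_plane"
    using assms unfolding outer_galois_point_def galois_point_def by auto
  then obtain p1 p2 p3 where p: "P = proj_point (p1, p2, p3)" "(p1, p2, p3) \<noteq> (0, 0, 0)"
    unfolding proj_plane_def by auto
  have dA: "Polynomial.degree (Polynomial.smult b A) < n" for b
    using curve3.degrees(1)[OF curve3_axioms] numbers(2,3) degree_smult_le[of b A] by simp
  note dBCD = curve3.degrees(2-4)[OF curve3_axioms]
  show ?thesis
  proof (cases "p1 = 0")
    case True
    then have p23: "p2 \<noteq> 0 \<or> p3 \<noteq> 0" using p(2) by simp
    define f where "f = Polynomial.smult p3 B - Polynomial.smult p2 C"
    note pr = projection_line[OF p23, folded f_def]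
    have P: "P = proj_point (0, p2, p3)" using p(1) True by simp
    have df: "Polynomial.degree f \<le> n" unfolding f_def
      by (intro degree_diff_le order.trans[OF degree_smult_le]) (simp_all add: dBCD)
    have dA': "Polynomial.degree A < n" using dA[of 1] by simp
    note cop = outer_coprime[OF P out pr(1)[folded P] pr(2) df pr(3) less_imp_le[OF dA']]
    have "Polynomial.coeff f n \<noteq> 0"
    proof -
      have "Polynomial.coeff A n = 0" using numbers by (simp add: coeffs_ABC)
      then show ?thesis
        using outer_no_base_point[OF P out pr(1)[folded P], of 1 0] unfolding pr(2,3) form_value_infinity by simp
    qed
    then have fn: "Polynomial.degree f = n" "f \<noteq> 0" using df le_degree[of f n] by auto
    have "split_pencil n f A"
      using galois_imp_fibre_splits[OF G pr(4)[folded P] fn ABC_nonzero(1) less_imp_le[OF dA'] cop numbers(1)]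
        cop fn(1) ABC_nonzero(1) less_imp_le[OF dA'] numbers(1)
      by (intro split_pencil.intro) auto
    then have "p3 = 0" unfolding f_def by (rule split_pencil_with_A)
    then have "P = proj_point (p2 * 0, p2 * 1, p2 * 0)" "p2 \<noteq> 0" using P p23 by auto
    then show ?thesis using proj_point_scale[of p2 0 1 0] by simp
  next
    case False
    define b where "b = p2 / p1"
    define z0 where "z0 = p3 / p1"
    define d where "d = (1 + \<gamma>) * z0 - \<gamma> * b"
    have P: "P = proj_point (1, b, z0)"
      using proj_point_scale[of p1 1 b z0] False unfolding p(1) b_def z0_def by simp
    note pr = projection_affine(1)[where b = b and ?z0.0 = z0] projection_affine(2)[of b] projection_affine(3,4)[where b = b and ?z0.0 = z0, folded d_def]
    define f where "f = B - Polynomial.smult b A"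
    define g where "g = D - Polynomial.smult d A"
    have deg: "Polynomial.degree f = n" "Polynomial.degree g = n"
      unfolding f_def g_def using dA dBCD by (simp_all add: degree_diff_eq_left)
    have nz: "f \<noteq> 0" "g \<noteq> 0" using deg numbers(1) by auto
    note pr = pr[folded f_def g_def]
    note le = deg[THEN eq_imp_le]
    note cop = outer_coprime[OF P out pr(1)[folded P] pr(2) le(1) pr(3) le(2)]
    have "split_pencil n f g"
      using galois_imp_fibre_splits[OF G pr(4)[folded P] deg(1) nz le(2) cop numbers(1)]
        cop deg(1) nz le(2) numbers(1)
      by (intro split_pencil.intro) auto
    then have "b = 0 \<and> d = 0" unfolding f_def g_def by (rule split_pencil_without_A)
    then have "b = 0" "z0 = 0" using one_plus_\<gamma> unfolding d_def by auto
    then show ?thesis using P by simp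
  qed
qed

lemma centres_not_on_curve: "proj_point (0, 1, 0) \<notin> curve" "proj_point (1, 0, 0) \<notin> curve"
proof -
  have mem: "(x, y, z) \<in> proj_point (x, y, z)" for x y z :: 'k
    unfolding proj_point_def by (auto intro: exI[of _ 1])
  have hit: "\<exists>s t c. (s, t) \<noteq> (0, 0) \<and> s ^ m * t ^ m = c * x \<and> (s + t) ^ n = c * y \<and> s ^ n + \<gamma> * t ^ n = c * z \<and> c \<noteq> 0"
    if pt: "proj_point (x, y, z) \<in> curve" for x y z
  proof -
    obtain s t where st: "(s, t) \<noteq> (0, 0)" "proj_point (x, y, z) = proj_point (s ^ m * t ^ m, (s + t) ^ n, s ^ n + \<gamma> * t ^ n)"
      using pt unfolding curve_eq form_values mem_Collect_eq by metis
    then have "(s ^ m * t ^ m, (s + t) ^ n, s ^ n + \<gamma> * t ^ n) \<in> proj_point (x, y, z)" using mem by simp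
    then show ?thesis using st(1) unfolding proj_point_def prod.case mem_Collect_eq prod.inject by blast
  qed
  show "proj_point (0, 1, 0) \<notin> curve"
  proof
    assume "proj_point (0, 1, 0) \<in> curve"
    then obtain s t c where st: "(s, t) \<noteq> (0, 0)" "s ^ m * t ^ m = 0" "s ^ n + \<gamma> * t ^ n = 0"
      using hit[of 0 1 0] by auto
    then have "s = 0 \<or> t = 0" by auto
    then show False using st(1,3) \<gamma>(1) numbers(1) by (auto simp: zero_power)
  qed
  show "proj_point (1, 0, 0) \<notin> curve"
  proof
    assume "proj_point (1, 0, 0) \<in> curve"
    then obtain s t where st: "(s, t) \<noteq> (0, 0)" "(s + t) ^ n = 0" "s ^ n + \<gamma> * t ^ n = 0"
      using hit[of 1 0 0] by auto
    then have s: "s = - t" using eq_neg_iff_add_eq_0 by auto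
    have "even n" using n_m by simp
    then have "(1 + \<gamma>) * t ^ n = 0" using st(3) unfolding s by (simp add: algebra_simps)
    then have "t = 0" using one_plus_\<gamma> by simp
    then show False using st(1) s by simp
  qed
qed

end

section \<open>The Galois groups\<close>

lemma powi_mod:
  fixes \<zeta> :: "'k::field"
  assumes "\<zeta> ^ N = 1" "\<zeta> \<noteq> 0"
  shows "\<zeta> powi (k mod int N) = \<zeta> powi k"
proof -
  have "\<zeta> powi k = \<zeta> powi (int N * (k div int N) + k mod int N)" by simp
  also have "\<dots> = (\<zeta> powi int N) powi (k div int N) * \<zeta> powi (k mod int N)"
    unfolding power_int_mult[symmetric] using assms(2) by (intro power_int_add) simp
  finally show ?thesis using assms(1) by simp
qed

lemma powi_inj:
  fixes \<zeta> :: "'k::field"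
  assumes \<zeta>: "\<zeta> \<noteq> 0" "\<And>i. 0 < i \<Longrightarrow> i < N \<Longrightarrow> \<zeta> ^ i \<noteq> 1"
    and ij: "0 \<le> i" "i < int N" "0 \<le> j" "j < int N" "\<zeta> powi i = \<zeta> powi j"
  shows "i = j"
proof -
  have "\<not> a < b" if ab: "0 \<le> a" "b < int N" "\<zeta> powi a = \<zeta> powi b" for a b
  proof
    assume "a < b"
    have "\<zeta> powi (b - a) = 1" using \<zeta>(1) ab(3) by (simp add: power_int_diff)
    moreover have "b - a = int (nat (b - a))" using \<open>a < b\<close> by simp
    ultimately have "\<zeta> ^ nat (b - a) = 1" by (metis power_int_of_nat)
    then show False using \<zeta>(2)[of "nat (b - a)"] ab \<open>a < b\<close> by simp
  qed
  from this[of i j] this[of j i] show ?thesis using ij by simp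
qed

context curve3
begin

lemma primitive_root:
  obtains \<zeta> :: 'k where "\<zeta> \<noteq> 0" "\<zeta> ^ n = 1" "\<And>i. 0 < i \<Longrightarrow> i < n \<Longrightarrow> \<zeta> ^ i \<noteq> 1"
proof -
  obtain \<zeta> :: 'k where \<zeta>: "\<zeta> ^ (q + 1) = 1" "\<And>i. 0 < i \<Longrightarrow> i < q + 1 \<Longrightarrow> \<zeta> ^ i \<noteq> 1"
    using primitive_root_exists[of q] numbers(4) char_q frobenius q_odd by auto
  have n: "q + 1 = n" using n_q by simp
  have "\<zeta> \<noteq> 0" using \<zeta>(1) unfolding n using numbers(1) by (metis zero_neq_one zero_power)
  then show ?thesis using that \<zeta> unfolding n by blast
qed

text \<open>
  The group acts by \<open>u \<mapsto> z u\<close> with \<open>z\<^sup>m = 1\<close> and \<open>u \<mapsto> c/(z u)\<close> with a fixed \<open>c\<close> such that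
  \<open>c\<^sup>m = \<gamma>\<close>. These maps fix \<open>C/A = u\<^sup>m + \<gamma> u\<^sup>-\<^sup>m\<close>.
\<close>

lemma dihedral_galois:
  shows "galois_extension (function_field curve) (projection_subfield curve (proj_point (0, 1, 0)))"
    and "galois_group (function_field curve) (projection_subfield curve (proj_point (0, 1, 0))) \<cong> dihedral_group m"
proof -
  let ?K = "projection_subfield curve (proj_point (0, 1, 0))"
  let ?H = "dihedral_group m"
  obtain \<zeta>0 :: 'k where \<zeta>0: "\<zeta>0 \<noteq> 0" "\<zeta>0 ^ n = 1" "\<And>i. 0 < i \<Longrightarrow> i < n \<Longrightarrow> \<zeta>0 ^ i \<noteq> 1"
    using primitive_root by blast
  define \<zeta> where "\<zeta> = \<zeta>0 ^ 2"
  have \<zeta>: "\<zeta> \<noteq> 0" "\<zeta> ^ m = 1" "\<And>i. 0 < i \<Longrightarrow> i < m \<Longrightarrow> \<zeta> ^ i \<noteq> 1"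
    using \<zeta>0 unfolding \<zeta>_def power_mult[symmetric] n_m by auto
  \<comment> \<open>Any \<open>m\<close>-th root of \<open>\<gamma>\<close> gives an involution \<open>u \<mapsto> c/u\<close>.\<close>
  obtain c0 where c0: "c0 ^ m = \<gamma>" using nth_root_exists[of m \<gamma>] m by auto
  have c0nz: "c0 \<noteq> 0" using c0 \<gamma>(1) m by (auto simp: zero_power)
  define Z where "Z k = const_fract (\<zeta> powi k)" for k
  define c where "c = const_fract c0"
  define r where "r h = (if snd h then const_fract (c0 / \<zeta> powi fst h) / X_fract
    else const_fract (\<zeta> powi fst h) * X_fract)" for h :: "int \<times> bool"
  have rZ: "r h = (if snd h then c / Z (fst h) / X_fract else Z (fst h) * X_fract)" for h
    unfolding r_def c_def Z_def const_fract_divide ..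
  have Znz: "Z k \<noteq> 0" for k unfolding Z_def using \<zeta>(1) by (simp add: const_fract_eq_0)
  have cnz: "c \<noteq> 0" unfolding c_def using c0nz by (simp add: const_fract_eq_0)
  have Zadd: "Z (i + j) = Z i * Z j" for i j
    unfolding Z_def using \<zeta>(1) by (simp add: power_int_add const_fract_hom)
  have Zdiff: "Z (i - j) = Z i / Z j" for i j
    unfolding Z_def using \<zeta>(1) by (simp add: power_int_diff const_fract_divide)
  have Zmod: "Z (i mod int m) = Z i" for i
    unfolding Z_def by (simp add: powi_mod[OF \<zeta>(2,1)])
  have Zm: "Z k ^ m = 1" for k
  proof -
    have "(\<zeta> powi k) ^ m = \<zeta> powi (int m * k)" by (simp only: mult.commute[of "int m"] power_int_mult power_int_of_nat)
    also have "\<dots> = 1" by (simp only: power_int_mult power_int_of_nat \<zeta>(2) power_int_1_left)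
    finally show ?thesis unfolding Z_def by (simp add: const_fract_hom flip: const_fract_power)
  qed
  have cm: "c ^ m = const_fract \<gamma>" unfolding c_def by (simp add: c0 flip: const_fract_power)
  have rnc: "r h \<notin> range const_fract" for h
    using nonconst[of "\<zeta> powi fst h"] nonconst[of "c0 / \<zeta> powi fst h"] \<zeta>(1) c0nz unfolding r_def by simp
  define act where "act h = subst_fract (r h)" for h
  have K: "\<psi> ` ?K = simple_field (Fract C A)"
  proof -
    have "Fract (Polynomial.smult 0 B - Polynomial.smult 1 C) A = - Fract C A" by simp
    then show ?thesis
      using projection_line(4)[of 1 0] simple_field_minus[of "Fract C A"] by simp
  qed
  have rm: "r h ^ m = X_fract ^ m \<or> r h ^ m * X_fract ^ m = const_fract \<gamma>" for h
    using X_fract_nonzero unfolding rZ by (auto simp: power_mult_distrib power_divide Zm cm)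
  have fixes_CA: "act h (Fract C A) = Fract C A" for h
  proof -
    have "poly (fibre_poly C A) (r h) = 0" unfolding fibre_CA using rm[of h] by auto
    then have 1: "eval_fract C (r h) = Fract C A * eval_fract A (r h)" by (simp add: poly_fibre_poly)
    have "eval_fract A (r h) \<noteq> 0" using eval_fract_eq_0[OF rnc] ABC_nonzero(1) by blast
    then show ?thesis unfolding act_def subst_Fract[OF rnc ABC_nonzero(1)] 1 by simp
  qed
  have ks: "subfield_of_type (\<psi> ` ?K)" unfolding K by (rule simple_field(1))
  have grp: "group ?H" using group_dihedral_group m by simp
  have cH: "carrier ?H = {0..<int m} \<times> UNIV" by (simp add: dihedral_group_def)
  have fin: "finite (carrier ?H)" unfolding cH by simp
  have add: "act h (x + y) = act h x + act h y" if "h \<in> carrier ?H" for h x y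
    unfolding act_def by (rule subst_fract_add[OF rnc])
  have mult: "act h (x * y) = act h x * act h y" if "h \<in> carrier ?H" for h x y
    unfolding act_def by (rule subst_fract_mult[OF rnc])
  have fx: "act h x = x" if "h \<in> carrier ?H" "x \<in> \<psi> ` ?K" for h x
    using subst_fract_fixes[OF rnc fixes_CA[unfolded act_def]] that(2) unfolding K act_def .
  have actX: "act h X_fract = r h" for h unfolding act_def by (rule subst_fract_X[OF rnc])
  have comp: "act (g \<otimes>\<^bsub>?H\<^esub> h) X_fract = act g (act h X_fract)" if "g \<in> carrier ?H" "h \<in> carrier ?H" for g h
  proof -
    obtain i e j f where gh: "g = (i, e)" "h = (j, f)" by (cases g; cases h) auto
    have 1: "g \<otimes>\<^bsub>?H\<^esub> h = ((if e then i - j else i + j) mod int m, e \<noteq> f)"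
      unfolding gh dihedral_group_def by simp
    have aZ: "act g (Z k) = Z k" "act g c = c" for k
      unfolding act_def Z_def c_def by (rule subst_fract_const[OF rnc])+
    have "act g (r h) = (if f then c / Z j / r g else Z j * r g)"
      unfolding gh(2) unfolding rZ[of "(j, f)"] using aZ actX[of g]
      by (auto simp: act_def subst_fract_mult[OF rnc] subst_fract_divide[OF rnc])
    then show ?thesis
      unfolding actX 1 unfolding rZ gh using Znz X_fract_nonzero cnz
      by (cases e; cases f) (simp_all add: Zmod Zadd Zdiff)
  qed
  have inj: "inj_on (\<lambda>h. act h X_fract) (carrier ?H)"
  proof (rule inj_onI)
    have mixed: "const_fract a * X_fract \<noteq> const_fract b / X_fract" if "a \<noteq> 0" for a b :: 'k
    proof
      assume "const_fract a * X_fract = const_fract b / X_fract"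
      then have sq: "(X_fract :: 'k poly fract) ^ 2 = const_fract (b / a)"
        using X_fract_nonzero that by (simp add: const_fract_divide const_fract_eq_0 field_simps power2_eq_square)
      obtain c :: 'k where "X_fract = const_fract c" by (rule const_of_power_const[OF sq]) auto
      then show False using X_fract_nonconst by blast
    qed
    fix g h assume gh: "g \<in> carrier ?H" "h \<in> carrier ?H" "act g X_fract = act h X_fract"
    obtain i e j f where ij: "g = (i, e)" "h = (j, f)" by (cases g; cases h) auto
    have eq: "r (i, e) = r (j, f)" using gh(3) unfolding actX ij .
    have pz: "\<zeta> powi k \<noteq> 0" for k using \<zeta>(1) by simp
    have ef: "e = f"
      using eq mixed[OF pz] mixed[OF pz, THEN not_sym] unfolding r_def by (auto split: if_splits)
    have "\<zeta> powi i = \<zeta> powi j"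
    proof (cases f)
      case True
      then have "c0 / \<zeta> powi i = c0 / \<zeta> powi j" using eq ef X_fract_nonzero unfolding r_def by (simp add: const_fract_inj)
      then show ?thesis using c0nz pz by (simp add: field_simps)
    next
      case False
      then show ?thesis using eq ef X_fract_nonzero unfolding r_def by (simp add: const_fract_inj)
    qed
    then have "i = j" using powi_inj[OF \<zeta>(1,3)] gh(1,2) unfolding ij cH by auto
    then show "g = h" using ef ij by simp
  qed
  have over: "poly_over (\<psi> ` ?K) (fibre_poly C A)" unfolding K by (rule fibre_poly_over)
  have nz: "fibre_poly C A \<noteq> 0"
  proof
    assume "fibre_poly C A = 0"
    then have "poly (fibre_poly C A) 0 = 0" by simp
    then show False using m \<gamma>(1) X_fract_nonzero by (simp add: fibre_CA zero_power const_fract_eq_0)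
  qed
  have deg: "Polynomial.degree (fibre_poly C A) \<le> card (carrier ?H)"
    using degree_fibre_CA unfolding card_dihedral_group n_m .
  have px: "poly (fibre_poly C A) X_fract = 0" by (rule fibre_poly_X[OF ABC_nonzero(1)])
  have gen: "S = UNIV" if "subfield_of_type S" "\<psi> ` ?K \<subseteq> S" "X_fract \<in> S" for S
    using subfield_with_X[OF that(1) _ that(3)] that(2) simple_field(2) unfolding K by blast
  note main = function_field.galois_by_group_action[OF projection_subfield_carrier ks grp fin add mult fx comp inj over nz deg px gen]
  show "galois_extension (function_field curve) ?K" by (rule main(1))
  show "galois_group (function_field curve) ?K \<cong> ?H" by (rule main(2))
qed

text \<open>
  The quotient \<open>D/B\<close> is the \<open>n\<close>-th power of \<open>y = (u - \<gamma>)/(u + 1)\<close>, which generates \<open>k(u)\<close>. Multiplication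
  of \<open>y\<close> by the \<open>n\<close>-th roots of unity gives the action, so \<open>y\<close> serves as the generator and
  \<open>T\<^sup>n - y\<^sup>n\<close> as its equation.
\<close>

lemma cyclic_galois:
  shows "galois_extension (function_field curve) (projection_subfield curve (proj_point (1, 0, 0)))"
    and "galois_group (function_field curve) (projection_subfield curve (proj_point (1, 0, 0))) \<cong> integer_mod_group n"
proof -
  let ?K = "projection_subfield curve (proj_point (1, 0, 0))"
  let ?H = "integer_mod_group n"
  obtain \<zeta> :: 'k where \<zeta>: "\<zeta> \<noteq> 0" "\<zeta> ^ n = 1" "\<And>i. 0 < i \<Longrightarrow> i < n \<Longrightarrow> \<zeta> ^ i \<noteq> 1"
    using primitive_root by blast
  have pz: "\<zeta> powi k \<noteq> 0" for k using \<zeta>(1) by simp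
  have pn: "(\<zeta> powi k) ^ n = 1" for k
  proof -
    have "(\<zeta> powi k) ^ n = \<zeta> powi (int n * k)" by (simp only: mult.commute[of "int n"] power_int_mult power_int_of_nat)
    also have "\<dots> = 1" by (simp only: power_int_mult power_int_of_nat \<zeta>(2) power_int_1_left)
    finally show ?thesis .
  qed
  have c1: "const_fract 1 = (1 :: 'k poly fract)" by (simp add: const_fract_hom)
  define y where "y = (X_fract - const_fract \<gamma>) / (X_fract + 1)"
  have X1: "X_fract + 1 \<noteq> (0 :: 'k poly fract)"
  proof
    assume "X_fract + 1 = (0 :: 'k poly fract)"
    then have "X_fract = const_fract (- 1 :: 'k)" unfolding const_fract_hom by (simp add: eq_neg_iff_add_eq_0)
    then show False using X_fract_nonconst by blast
  qed
  have c1g: "1 + const_fract \<gamma> \<noteq> (0 :: 'k poly fract)"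
    using one_plus_\<gamma> const_fract_eq_0[of "1 + \<gamma>"] by (simp add: const_fract_hom)
  \<comment> \<open>The inverse of \<open>v \<mapsto> (v - \<gamma>)/(v + 1)\<close> is \<open>w \<mapsto> (\<gamma> + w)/(1 - w)\<close>.\<close>
  have inverse_map: "(v - const_fract \<gamma>) / (v + 1) = w" if "v = (const_fract \<gamma> + w) / (1 - w)" "w \<noteq> 1"
    for v w :: "'k poly fract"
  proof -
    have w: "1 - w \<noteq> 0" using that(2) by simp
    have "v - const_fract \<gamma> = w * (1 + const_fract \<gamma>) / (1 - w)" "v + 1 = (1 + const_fract \<gamma>) / (1 - w)"
      unfolding that(1) using w by (simp_all add: field_simps)
    then show ?thesis using c1g w by simp
  qed
  have y_inverse: "X_fract = (const_fract \<gamma> + y) / (1 - y)" "y \<noteq> 1"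
  proof -
    have 1: "1 - y = (1 + const_fract \<gamma>) / (X_fract + 1)" 
      unfolding y_def using X1 by (simp add: field_simps)
    have 2: "const_fract \<gamma> + y = X_fract * (1 + const_fract \<gamma>) / (X_fract + 1)" 
      unfolding y_def using X1 by (simp add: field_simps)
    show "X_fract = (const_fract \<gamma> + y) / (1 - y)" unfolding 1 2 using c1g X1 by simp
    show "y \<noteq> 1" using 1 c1g X1 by auto
  qed
  have y_nonconst: "y \<noteq> const_fract c" for c
  proof
    assume "y = const_fract c"
    then have "X_fract = const_fract ((\<gamma> + c) / (1 - c))"
      using y_inverse(1) unfolding const_fract_divide by (simp add: const_fract_hom)
    then show False using X_fract_nonconst by blast
  qed
  define w where "w k = const_fract (\<zeta> powi k) * y" for k
  have w_nonconst: "w k \<noteq> const_fract c" for k c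
  proof
    assume "w k = const_fract c"
    then have "y = const_fract (c / \<zeta> powi k)"
      unfolding const_fract_divide w_def using pz[of k] by (simp add: field_simps const_fract_eq_0)
    then show False using y_nonconst by blast
  qed
  define r where "r k = (const_fract \<gamma> + w k) / (1 - w k)" for k
  have rw: "(r k - const_fract \<gamma>) / (r k + 1) = w k" for k
    using inverse_map[OF r_def] w_nonconst[of k 1] unfolding c1 .
  have rnc: "r k \<notin> range const_fract" for k
  proof
    assume "r k \<in> range const_fract"
    then obtain c where "r k = const_fract c" by blast
    then have "w k = const_fract ((c - \<gamma>) / (c + 1))"
      using rw[of k] unfolding const_fract_divide by (simp add: const_fract_hom)
    then show False using w_nonconst by blast
  qed
  define act where "act k = subst_fract (r k)" for k
  have acty: "act k y = w k" for k
    unfolding act_def y_def rw[of k, symmetric]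
    by (simp add: subst_fract_divide[OF rnc] subst_fract_diff[OF rnc] subst_fract_add[OF rnc] subst_fract_X[OF rnc] subst_fract_const[OF rnc] subst_fract_numerals[OF rnc])
  have BD: "Fract B D = inverse (y ^ n)"
  proof -
    have D0: "D \<noteq> 0" using curve3.degrees(4)[OF curve3_axioms] numbers(1) by auto
    have "Fract D 1 = (X_fract - const_fract \<gamma>) ^ n"
      unfolding eval_fract_X[symmetric] D_def by (simp add: const_fract_hom)
    then show ?thesis
      unfolding Fract_eq_divide[OF D0] Fract_ABC y_def power_divide by simp
  qed
  have K: "\<psi> ` ?K = simple_field (Fract B D)"
    using projection_affine(4)[of 0 0] by simp
  have w_n: "w k ^ n = y ^ n" for k
    unfolding w_def power_mult_distrib by (simp add: pn c1 flip: const_fract_power)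
  have ks: "subfield_of_type (\<psi> ` ?K)" unfolding K by (rule simple_field(1))
  have grp: "group ?H" by simp
  have cH: "carrier ?H = {0..<int n}" using numbers(1) by (simp add: carrier_integer_mod_group)
  have fin: "finite (carrier ?H)" unfolding cH by simp
  have add: "act h (x + z) = act h x + act h z" if "h \<in> carrier ?H" for h x z
    unfolding act_def by (rule subst_fract_add[OF rnc])
  have mult: "act h (x * z) = act h x * act h z" if "h \<in> carrier ?H" for h x z
    unfolding act_def by (rule subst_fract_mult[OF rnc])
  have fx: "act h x = x" if "h \<in> carrier ?H" "x \<in> \<psi> ` ?K" for h x
  proof -
    have "act h (Fract B D) = inverse (act h y ^ n)"
      unfolding BD act_def by (simp only: subst_fract_inverse[OF rnc] subst_fract_power[OF rnc])
    also have "\<dots> = Fract B D" unfolding BD acty w_n ..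
    finally show ?thesis using subst_fract_fixes[OF rnc] that(2) unfolding K act_def by blast
  qed
  have comp: "act (g \<otimes>\<^bsub>?H\<^esub> h) y = act g (act h y)" if "g \<in> carrier ?H" "h \<in> carrier ?H" for g h
  proof -
    have "act g (act h y) = const_fract (\<zeta> powi h) * w g"
      using acty[of g] unfolding acty[of h] unfolding w_def[of h] act_def
      by (simp only: subst_fract_mult[OF rnc] subst_fract_const[OF rnc])
    also have "\<dots> = const_fract (\<zeta> powi (g + h)) * y"
      unfolding w_def using \<zeta>(1) by (simp add: power_int_add const_fract_hom)
    also have "\<dots> = w ((g + h) mod int n)" unfolding w_def powi_mod[OF \<zeta>(2,1)] ..
    finally show ?thesis unfolding acty by (simp add: mult_integer_mod_group)
  qed
  have inj: "inj_on (\<lambda>h. act h y) (carrier ?H)"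
  proof (rule inj_onI)
    fix g h assume gh: "g \<in> carrier ?H" "h \<in> carrier ?H" "act g y = act h y"
    have "y \<noteq> 0" using y_nonconst[of 0] by (simp add: const_fract_hom)
    then have "\<zeta> powi g = \<zeta> powi h" using gh(3) unfolding acty w_def by (simp add: const_fract_inj)
    then show "g = h" using powi_inj[OF \<zeta>(1,3)] gh(1,2) unfolding cH by auto
  qed
  have yn: "y ^ n \<in> \<psi> ` ?K"
    using subfield_of_typeD(6)[OF simple_field(1) simple_field(3)[of "Fract B D"]] unfolding K BD by simp
  define P where "P = Polynomial.monom 1 n - [:y ^ n:]"
  have over: "poly_over (\<psi> ` ?K) P"
    unfolding P_def using yn subfield_of_typeD(1,2)[OF ks] by (intro poly_over_closed[OF ks])
  have degP: "Polynomial.degree P = n"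
    unfolding P_def using numbers(1) by (subst degree_diff_eq_left) (simp_all add: degree_monom_eq)
  then have nz: "P \<noteq> 0" using numbers(1) by auto
  have deg: "Polynomial.degree P \<le> card (carrier ?H)" unfolding cH degP by simp
  have px: "poly P y = 0" unfolding P_def by (simp add: poly_monom)
  have gen: "S = UNIV" if S: "subfield_of_type S" "\<psi> ` ?K \<subseteq> S" "y \<in> S" for S
  proof (rule subfield_with_X[OF S(1)])
    show const: "const_fract c \<in> S" for c using S(2) simple_field(2) unfolding K by blast
    show "X_fract \<in> S"
      unfolding y_inverse(1)
      by (intro subfield_of_typeD(8)[OF S(1)] subfield_of_typeD(3)[OF S(1)] subfield_of_typeD(7)[OF S(1)]
        const S(3) subfield_of_typeD(2)[OF S(1)])
  qed
  note main = function_field.galois_by_group_action[OF projection_subfield_carrier ks grp fin add mult fx comp inj over nz deg px gen]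
  show "galois_extension (function_field curve) ?K" by (rule main(1))
  show "galois_group (function_field curve) ?K \<cong> ?H" by (rule main(2))
qed

end

section \<open>The equation of the curve\<close>

text \<open>
  Degrees for which the outer variable has weight \<open>N\<close> and the inner one has weight \<open>1\<close>.
\<close>

lemma weighted_degree_mult:
  fixes F G :: "'a::idom poly poly"
  assumes F: "\<And>i j. Polynomial.coeff (Polynomial.coeff F i) j \<noteq> 0 \<Longrightarrow> N * i + j \<le> d"
    and G: "\<And>i j. Polynomial.coeff (Polynomial.coeff G i) j \<noteq> 0 \<Longrightarrow> N * i + j \<le> e"
    and nz: "Polynomial.coeff (Polynomial.coeff (F * G) i) j \<noteq> 0"
  shows "N * i + j \<le> d + e"
proof -
  have "(\<Sum>a\<le>i. Polynomial.coeff (Polynomial.coeff F a * Polynomial.coeff G (i - a)) j) \<noteq> 0"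
    using nz unfolding coeff_mult[of F] coeff_sum .
  then obtain a where a: "a \<le> i" "Polynomial.coeff (Polynomial.coeff F a * Polynomial.coeff G (i - a)) j \<noteq> 0"
    by (rule sum.not_neutral_contains_not_neutral) auto
  then obtain b where b: "b \<le> j" "Polynomial.coeff (Polynomial.coeff F a) b * Polynomial.coeff (Polynomial.coeff G (i - a)) (j - b) \<noteq> 0"
    unfolding coeff_mult by (elim sum.not_neutral_contains_not_neutral) auto
  have "N * a + b \<le> d" by (rule F) (use b(2) in auto)
  moreover have "N * (i - a) + (j - b) \<le> e" by (rule G) (use b(2) in auto)
  moreover have "N * i = N * a + N * (i - a)" using a(1) by (simp flip: distrib_left)
  ultimately show ?thesis using b(1) by linarith
qed

lemma prod_cyclic:
  fixes f :: "nat \<Rightarrow> 'a::comm_monoid_mult"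
  assumes "f (Suc q) = f 0"
  shows "(\<Prod>i<Suc q. f (Suc i)) = (\<Prod>i<Suc q. f i)"
proof -
  have "(\<Prod>i<Suc q. f (Suc i)) = (\<Prod>i<q. f (Suc i)) * f (Suc q)" by (rule prod.lessThan_Suc)
  also have "\<dots> = f 0 * (\<Prod>i<q. f (Suc i))" using assms by (simp add: mult.commute)
  also have "\<dots> = (\<Prod>i<Suc q. f i)" by (rule prod.lessThan_Suc_shift[symmetric])
  finally show ?thesis .
qed

lemma poly2_eqI:
  fixes F G :: "'k::alg_closed_field poly poly"
  assumes "\<And>x w. poly (poly F [:x:]) w = poly (poly G [:x:]) w"
  shows "F = G"
proof (rule poly_eqI, rule iffD1[OF poly_eq_iff_infinite], rule allI)
  have ev: "poly (poly E [:x:]) w = poly (map_poly (\<lambda>c. poly c w) E) x" for E :: "'k poly poly" and x w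
    by (induction E) (simp_all add: map_poly_pCons)
  fix i w
  have "map_poly (\<lambda>c. poly c w) F = map_poly (\<lambda>c. poly c w) G"
    using assms unfolding ev by (intro iffD1[OF poly_eq_iff_infinite]) blast
  then have "Polynomial.coeff (map_poly (\<lambda>c. poly c w) F) i = Polynomial.coeff (map_poly (\<lambda>c. poly c w) G) i" by simp
  then show "poly (Polynomial.coeff F i) w = poly (Polynomial.coeff G i) w" by (simp add: coeff_map_poly)
qed

lemma eval3_as_poly:
  fixes F :: "'k::field poly3"
  obtains P where "\<And>x. poly P x = eval3 F (x, y, z)" "Polynomial.degree P \<le> Polynomial.degree F"
    "\<And>i. Polynomial.coeff P i = poly (poly (Polynomial.coeff F i) [:y:]) z"
proof
  let ?P = "map_poly (\<lambda>c. poly (poly c [:y:]) z) F"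
  show "poly ?P x = eval3 F (x, y, z)" for x
    by (induction F) (simp_all add: map_poly_pCons eval3_def)
  show "Polynomial.degree ?P \<le> Polynomial.degree F" by (rule degree_le) (simp add: coeff_map_poly coeff_eq_0)
  show "Polynomial.coeff ?P i = poly (poly (Polynomial.coeff F i) [:y:]) z" for i
    by (simp add: coeff_map_poly)
qed

context curve3
begin

text \<open>
  The first coordinate of the point of the curve with \<open>s + t = v\<close> and \<open>s - \<gamma> t = w\<close>.
\<close>

definition H :: "'k \<Rightarrow> 'k \<Rightarrow> 'k" where "H v w = ((\<gamma> * v + w) * (v - w) / (1 + \<gamma>) ^ 2) ^ m"

lemma H_poly:
  obtains h where "\<And>w. poly h w = H 1 w" "Polynomial.degree h \<le> n"
proof
  let ?h = "Polynomial.smult (1 / (1 + \<gamma>) ^ 2) ([:\<gamma>, 1:] * [:1, - 1:]) ^ m"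
  show "poly ?h w = H 1 w" for w
    unfolding H_def poly_power poly_smult poly_mult by simp
  have "Polynomial.degree ([:\<gamma>, 1:] * [:1, - 1:]) \<le> 2"
    using degree_mult_le[of "[:\<gamma>, 1:]" "[:1, - 1:]"] by simp
  then have "Polynomial.degree (Polynomial.smult (1 / (1 + \<gamma>) ^ 2) ([:\<gamma>, 1:] * [:1, - 1:])) * m \<le> 2 * m"
    by (intro mult_right_mono order.trans[OF degree_smult_le]) simp_all
  then show "Polynomial.degree ?h \<le> n" unfolding n_m using degree_power_le order.trans by blast
qed

lemma H_scale: "v \<noteq> 0 \<Longrightarrow> H v w = v ^ n * H 1 (w / v)"
proof -
  assume v: "v \<noteq> 0"
  have eq: "(\<gamma> * v + w) * (v - w) / (1 + \<gamma>) ^ 2 = v ^ 2 * ((\<gamma> * 1 + w / v) * (1 - w / v) / (1 + \<gamma>) ^ 2)"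
  proof -
    have "\<gamma> * 1 + w / v = (\<gamma> * v + w) / v" "1 - w / v = (v - w) / v"
      using v by (simp_all add: add_divide_distrib diff_divide_distrib)
    then show ?thesis using v by (simp add: power2_eq_square)
  qed
  show ?thesis unfolding H_def eq power_mult_distrib[of "v ^ 2"] n_m power_mult[of v] ..
qed

lemma curve_param:
  fixes v w :: 'k
  defines "s \<equiv> (\<gamma> * v + w) / (1 + \<gamma>)" and "t \<equiv> (v - w) / (1 + \<gamma>)"
  shows "s + t = v" "s - \<gamma> * t = w" "s ^ m * t ^ m = H v w"
proof -
  have "\<gamma> * v + v = v * (1 + \<gamma>)" by (simp add: algebra_simps)
  then show "s + t = v" unfolding s_def t_def using one_plus_\<gamma> by (simp add: add_divide_distrib[symmetric])
  have "s - \<gamma> * t = (\<gamma> * v + w - \<gamma> * (v - w)) / (1 + \<gamma>)"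
    unfolding s_def t_def times_divide_eq_right by (rule diff_divide_distrib[symmetric])
  also have "\<gamma> * v + w - \<gamma> * (v - w) = w * (1 + \<gamma>)" by (simp add: algebra_simps)
  finally show "s - \<gamma> * t = w" using one_plus_\<gamma> by simp
  show "s ^ m * t ^ m = H v w"
    unfolding s_def t_def H_def power_mult_distrib[symmetric] by (simp add: power2_eq_square)
qed

text \<open>
  The second and third coordinate determine \<open>w = s - \<gamma> t\<close> up to \<open>n\<close>-th roots of unity.
\<close>

lemma D_form: "(s - \<gamma> * t) ^ n = (1 + \<gamma>) * (s ^ n + \<gamma> * t ^ n) - \<gamma> * (s + t) ^ n"
proof -
  have "form_value n D s t = (s - \<gamma> * t) ^ n"
    unfolding D_def by (subst form_value_power) (simp_all add: form_value_def)
  moreover have "form_value n D s t = (1 + \<gamma>) * (s ^ n + \<gamma> * t ^ n) - \<gamma> * (s + t) ^ n"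
    unfolding D_combination by (simp add: form_value_diff form_value_smult form_values)
  ultimately show ?thesis by simp
qed

text \<open>
  For \<open>v = 1\<close>, the product \<open>N = \<Prod>\<^sub>i (X - H(1, \<zeta>\<^sup>i w))\<close> is invariant under \<open>w \<mapsto> \<zeta> w\<close>, so it
  contains only powers of \<open>w\<^sup>n\<close>. As \<open>H(1, w)\<close> has degree at most \<open>n\<close> in \<open>w\<close>, every monomial
  \<open>X\<^sup>i w\<^sup>n\<^sup>j\<close> in it satisfies \<open>i + j \<le> n\<close>. Writing \<open>W = (1 + \<gamma>) Z - \<gamma> Y\<close> for \<open>w\<^sup>n\<close> and filling
  up with powers of \<open>Y\<close> gives the form \<open>F\<close>.
\<close>

lemma equation_exists:
  assumes \<zeta>: "\<zeta> \<noteq> (0 :: 'k)" "\<zeta> ^ n = 1" "\<And>i. 0 < i \<Longrightarrow> i < n \<Longrightarrow> \<zeta> ^ i \<noteq> 1"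
  obtains F where "homogeneous n F"
    "\<And>x v w z. (1 + \<gamma>) * z - \<gamma> * v ^ n = w ^ n \<Longrightarrow> eval3 F (x, v ^ n, z) = (\<Prod>i<n. (x - H v (\<zeta> ^ i * w)))"
proof -
  obtain h where h: "\<And>w. poly h w = H 1 w" "Polynomial.degree h \<le> n" using H_poly by blast
  define N where "N = (\<Prod>i<n. [:- pcompose h [:0, \<zeta> ^ i:], 1:])"
  have N_eval: "poly (poly N [:x:]) w = (\<Prod>i<n. (x - H 1 (\<zeta> ^ i * w)))" for x w
    unfolding N_def poly_prod by (simp add: poly_pcompose h(1) mult.commute)
  \<comment> \<open>Replacing \<open>w\<close> by \<open>\<zeta> w\<close> permutes the factors cyclically.\<close>
  have rotate: "poly (poly N [:x:]) (\<zeta> * w) = poly (poly N [:x:]) w" for x w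
  proof -
    define f where "f i = x - H 1 (\<zeta> ^ i * w)" for i
    have "f (Suc q) = f 0" unfolding f_def using \<zeta>(2) by (simp flip: n_q)
    then have "(\<Prod>i<Suc q. f (Suc i)) = (\<Prod>i<Suc q. f i)" by (rule prod_cyclic)
    then have 1: "(\<Prod>i<n. x - H 1 (\<zeta> ^ Suc i * w)) = (\<Prod>i<n. x - H 1 (\<zeta> ^ i * w))"
      unfolding f_def n_q[symmetric] .
    have "\<zeta> ^ i * (\<zeta> * w) = \<zeta> ^ Suc i * w" for i by simp
    then show ?thesis unfolding N_eval by (simp only: 1)
  qed
  have invariant: "Polynomial.coeff (Polynomial.coeff N i) l = 0" if "\<not> n dvd l" for i l
  proof -
    have "map_poly (\<lambda>p. pcompose p [:0, \<zeta>:]) N = N"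
    proof (rule poly2_eqI)
      fix x w
      have 1: "poly (poly (map_poly (\<lambda>p. pcompose p [:0, \<zeta>:]) E) [:x:]) w = poly (poly E [:x:]) (\<zeta> * w)" for E
        by (induction E) (simp_all add: map_poly_pCons poly_pcompose mult.commute)
      show "poly (poly (map_poly (\<lambda>p. pcompose p [:0, \<zeta>:]) N) [:x:]) w = poly (poly N [:x:]) w"
        unfolding 1 by (rule rotate)
    qed
    then have "Polynomial.coeff N i = pcompose (Polynomial.coeff N i) [:0, \<zeta>:]"
      by (metis coeff_map_poly pcompose_0)
    then have "Polynomial.coeff (Polynomial.coeff N i) l = \<zeta> ^ l * Polynomial.coeff (Polynomial.coeff N i) l"
      by (metis coeff_pcompose_linear)
    moreover have "\<zeta> ^ l \<noteq> 1"
    proof -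
      have "\<zeta> ^ l = \<zeta> ^ (n * (l div n) + l mod n)" by simp
      also have "\<dots> = \<zeta> ^ (l mod n)" unfolding power_add power_mult \<zeta>(2) by simp
      finally show ?thesis using \<zeta>(3)[of "l mod n"] that numbers(1) by (simp add: mod_greater_zero_iff_not_dvd)
    qed
    ultimately show ?thesis by simp
  qed
  have weight: "n * i + l \<le> n * n" if nz: "Polynomial.coeff (Polynomial.coeff N i) l \<noteq> 0" for i l
  proof -
    have "n * i + l \<le> n * k" if "Polynomial.coeff (Polynomial.coeff (\<Prod>i<k. [:- pcompose h [:0, \<zeta> ^ i:], 1:]) i) l \<noteq> 0" for k i l
      using that
    proof (induction k arbitrary: i l)
      case 0
      then show ?case by (auto simp: one_pCons coeff_pCons split: nat.splits)
    next
      case (Suc k)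
      have lin: "n * i + l \<le> n" if "Polynomial.coeff (Polynomial.coeff [:- pcompose h [:0, \<zeta> ^ k:], 1:] i) l \<noteq> 0" for i l
      proof -
        have "Polynomial.coeff h l = 0" if "l > n" using coeff_eq_0[of h l] h(2) that by simp
        then show ?thesis using that
          by (auto simp: one_pCons coeff_pCons coeff_pcompose_linear split: nat.splits intro: leI)
      qed
      show ?case
        using weighted_degree_mult[where F = "\<Prod>i<k. [:- pcompose h [:0, \<zeta> ^ i:], 1:]" and G = "[:- pcompose h [:0, \<zeta> ^ k:], 1:]" and N = n and d = "n * k" and e = n, OF Suc.IH lin]
          Suc.prems by (simp add: add.commute)
    qed
    then show ?thesis using nz unfolding N_def .
  qed
  define c where "c i j = Polynomial.coeff (Polynomial.coeff N i) (n * j)" for i j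
  have coeff_N: "poly (Polynomial.coeff N i) w = (\<Sum>j\<le>n - i. c i j * (w ^ n) ^ j)" if "i \<le> n" for i w
  proof -
    have deg: "Polynomial.degree (Polynomial.coeff N i) \<le> n * (n - i)"
    proof (rule degree_le, intro allI impI)
      fix l assume "n * (n - i) < l"
      then have "n * n < n * i + l" using that by (simp add: diff_mult_distrib2)
      then show "Polynomial.coeff (Polynomial.coeff N i) l = 0" using weight[of i l] by fastforce
    qed
    have "poly (Polynomial.coeff N i) w = (\<Sum>l\<le>n * (n - i). Polynomial.coeff (Polynomial.coeff N i) l * w ^ l)"
      unfolding poly_altdef using deg by (intro sum.mono_neutral_left) (auto simp: coeff_eq_0)
    also have "\<dots> = (\<Sum>l\<in>(\<lambda>j. n * j) ` {..n - i}. Polynomial.coeff (Polynomial.coeff N i) l * w ^ l)"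
    proof (intro sum.mono_neutral_right ballI)
      fix l assume "l \<in> {..n * (n - i)} - (\<lambda>j. n * j) ` {..n - i}"
      then have "\<not> n dvd l" using numbers(1) by (auto elim!: dvdE)
      then show "Polynomial.coeff (Polynomial.coeff N i) l * w ^ l = 0" using invariant by simp
    qed auto
    also have "\<dots> = (\<Sum>j\<le>n - i. c i j * (w ^ n) ^ j)"
      using numbers(1) by (subst sum.reindex) (auto simp: inj_on_def c_def power_mult)
    finally show ?thesis .
  qed
  have N_sum: "poly (poly N [:x:]) w = (\<Sum>i\<le>n. (\<Sum>j\<le>n - i. c i j * (w ^ n) ^ j) * x ^ i)" for x w
  proof -
    have deg: "Polynomial.degree N \<le> n"
    proof (rule degree_le, intro allI impI)
      fix i assume "n < i"
      then have "n * n < n * i" using numbers(1) by simp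
      then have nl: "\<not> n * i + l \<le> n * n" for l by linarith
      then show "Polynomial.coeff N i = 0" by (intro poly_eqI) (metis coeff_0 weight nl)
    qed
    have "poly N [:x:] = (\<Sum>i\<le>n. Polynomial.coeff N i * [:x:] ^ i)"
      unfolding poly_altdef using deg by (intro sum.mono_neutral_left) (auto simp: coeff_eq_0)
    then have "poly (poly N [:x:]) w = (\<Sum>i\<le>n. poly (Polynomial.coeff N i) w * x ^ i)" by (simp add: poly_sum)
    then show ?thesis by (simp add: coeff_N)
  qed
  define W where "W = const3 (1 + \<gamma>) * cZ - const3 \<gamma> * cY"
  have W: "homogeneous 1 W" "eval3 W (x, y, z) = (1 + \<gamma>) * z - \<gamma> * y" for x y z
    unfolding W_def
    by (intro homogeneous_diff homogeneous_scale homogeneous_variables)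
       (simp only: eval3_simps eval3_variables)
  define F where "F = (\<Sum>i\<le>n. \<Sum>j\<le>n - i. const3 (c i j) * (cX ^ i * (cY ^ (n - i - j) * W ^ j)))"
  have hom: "homogeneous n F"
    unfolding F_def
  proof (intro homogeneous_sum homogeneous_scale)
    fix i j assume "i \<in> {..n}" "j \<in> {..n - i}"
    then have d: "1 * i + (1 * (n - i - j) + 1 * j) = n" by simp
    show "homogeneous n (cX ^ i * (cY ^ (n - i - j) * W ^ j))"
      using homogeneous_mult[OF homogeneous_power[OF homogeneous_variables(1), of i]
        homogeneous_mult[OF homogeneous_power[OF homogeneous_variables(2), of "n - i - j"] homogeneous_power[OF W(1), of j]]]
      unfolding d .
  qed
  have F_eval: "eval3 F (x, y, z) = (\<Sum>i\<le>n. \<Sum>j\<le>n - i. c i j * (x ^ i * (y ^ (n - i - j) * ((1 + \<gamma>) * z - \<gamma> * y) ^ j)))" for x y z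
    unfolding F_def by (simp only: eval3_sum eval3_simps eval3_variables W(2))
  have F1: "eval3 F (x, 1, z) = (\<Prod>i<n. (x - H 1 (\<zeta> ^ i * w)))" if "(1 + \<gamma>) * z - \<gamma> = w ^ n" for x w z
  proof -
    have "eval3 F (x, 1, z) = poly (poly N [:x:]) w"
      unfolding F_eval N_sum using that by (simp add: sum_distrib_right sum_distrib_left mult_ac)
    then show ?thesis unfolding N_eval .
  qed
  have F_affine: "eval3 F (x, v ^ n, z) = (\<Prod>i<n. (x - H v (\<zeta> ^ i * w)))"
    if v: "v \<noteq> 0" and z: "(1 + \<gamma>) * z - \<gamma> * v ^ n = w ^ n" for x v w z
  proof -
    have vn: "v ^ n \<noteq> 0" using v by simp
    have "(1 + \<gamma>) * (z / v ^ n) - \<gamma> = (w / v) ^ n"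
      unfolding power_divide z[symmetric] using vn by (simp add: diff_divide_distrib)
    then have "eval3 F (x / v ^ n, 1, z / v ^ n) = (\<Prod>i<n. (x / v ^ n - H 1 (\<zeta> ^ i * (w / v))))" by (rule F1)
    moreover have "eval3 F (x, v ^ n, z) = (v ^ n) ^ n * eval3 F (x / v ^ n, 1, z / v ^ n)"
      using eval3_homogeneous[OF hom, of "v ^ n" "x / v ^ n" 1 "z / v ^ n"] v by simp
    moreover have "(v ^ n) ^ n * (\<Prod>i<n. (x / v ^ n - H 1 (\<zeta> ^ i * (w / v)))) = 
        (\<Prod>i<n. v ^ n * (x / v ^ n - H 1 (\<zeta> ^ i * (w / v))))" by (simp add: prod.distrib)
    moreover have "v ^ n * (x / v ^ n - H 1 (\<zeta> ^ i * (w / v))) = x - H v (\<zeta> ^ i * w)" for i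
      unfolding H_scale[OF v] using v by (simp add: right_diff_distrib)
    ultimately show ?thesis by simp
  qed
  have "eval3 F (x, v ^ n, z) = (\<Prod>i<n. (x - H v (\<zeta> ^ i * w)))"
    if z: "(1 + \<gamma>) * z - \<gamma> * v ^ n = w ^ n" for x v w z
  proof -
    \<comment> \<open>Both sides are polynomials in \<open>v\<close> if \<open>w\<close> is fixed and \<open>z\<close> is regarded as a function of \<open>v\<close>. They
      agree for \<open>v \<noteq> 0\<close>, hence also for \<open>v = 0\<close>.\<close>
    define zp where "zp = Polynomial.smult (1 / (1 + \<gamma>)) (Polynomial.monom \<gamma> n + [:w ^ n:])"
    have zp: "(1 + \<gamma>) * poly zp u - \<gamma> * u ^ n = w ^ n" for u
      unfolding zp_def using one_plus_\<gamma> by (simp add: poly_monom)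
    define l where "l = pull [:x:] (Polynomial.monom 1 n) zp F"
    define r where "r = (\<Prod>i<n. ([:x:] - Polynomial.smult (1 / (1 + \<gamma>) ^ 2) ([:\<zeta> ^ i * w, \<gamma>:] * [:- (\<zeta> ^ i * w), 1:]) ^ m))"
    have l: "poly l u = eval3 F (x, u ^ n, poly zp u)" for u
      unfolding l_def poly_pull by (simp add: poly_monom)
    have r: "poly r u = (\<Prod>i<n. (x - H u (\<zeta> ^ i * w)))" for u
      unfolding r_def poly_prod H_def poly_diff poly_power poly_smult poly_mult
      by (intro prod.cong refl) (simp add: add.commute mult.commute)
    have "l = r"
    proof (rule infinite_poly_eqI[OF infinite_alg_closed, of "{0}"])
      fix u :: 'k assume "u \<notin> {0}"
      then show "poly l u = poly r u" unfolding l r by (intro F_affine zp) simp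
    qed simp
    then have "poly l v = poly r v" by simp
    moreover have "poly zp v = z" 
    proof -
      have "(1 + \<gamma>) * poly zp v = (1 + \<gamma>) * z" using zp[of v] z by (metis diff_add_cancel)
      then show ?thesis using one_plus_\<gamma> by simp
    qed
    ultimately show ?thesis unfolding l r by simp
  qed
  then show ?thesis using hom that by blast
qed

end

section \<open>Irreducibility\<close>

context curve3
begin

lemma curve_param_inverse:
  "(\<gamma> * (s + t) + (s - \<gamma> * t)) / (1 + \<gamma>) = s" "((s + t) - (s - \<gamma> * t)) / (1 + \<gamma>) = t"
proof -
  have "\<gamma> * (s + t) + (s - \<gamma> * t) = s * (1 + \<gamma>)" "(s + t) - (s - \<gamma> * t) = t * (1 + \<gamma>)"
    by (simp_all add: algebra_simps)
  then show "(\<gamma> * (s + t) + (s - \<gamma> * t)) / (1 + \<gamma>) = s" "((s + t) - (s - \<gamma> * t)) / (1 + \<gamma>) = t"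
    using one_plus_\<gamma> by simp_all
qed

text \<open>
  A point \<open>(x : y : z)\<close> is the image of \<open>(s : t)\<close> iff \<open>s + t\<close> and \<open>s - \<gamma> t\<close> are suitable \<open>n\<close>-th roots \<open>v\<close> of
  \<open>y\<close> and \<open>w\<close> of \<open>(1 + \<gamma>) z - \<gamma> y\<close> with \<open>x = H v w\<close>; and \<open>F\<close> vanishes iff one of the \<open>n\<close> possible \<open>w\<close> has
  the last property.
\<close>

lemma curve_zero_locus:
  assumes \<zeta>: "\<zeta> ^ n = 1"
    and F: "\<And>x v w z. (1 + \<gamma>) * z - \<gamma> * v ^ n = w ^ n \<Longrightarrow> eval3 F (x, v ^ n, z) = (\<Prod>i<n. (x - H v (\<zeta> ^ i * w)))"
  shows "curve = zero_locus F"
proof (intro equalityI subsetI)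
  fix P assume "P \<in> curve"
  then have "\<exists>s t. P = proj_point (form_value n A s t, form_value n B s t, form_value n C s t) \<and> (s, t) \<noteq> (0, 0)"
    unfolding curve_eq mem_Collect_eq .
  then obtain s t where st: "(s, t) \<noteq> (0, 0)" "P = proj_point (form_value n A s t, form_value n B s t, form_value n C s t)"
    by metis
  have "eval3 F (s ^ m * t ^ m, (s + t) ^ n, s ^ n + \<gamma> * t ^ n) = (\<Prod>i<n. (s ^ m * t ^ m - H (s + t) (\<zeta> ^ i * (s - \<gamma> * t))))"
    by (rule F) (simp only: D_form)
  moreover have "H (s + t) (\<zeta> ^ 0 * (s - \<gamma> * t)) = s ^ m * t ^ m"
    using curve_param(3)[of "s + t" "s - \<gamma> * t"] unfolding curve_param_inverse by simp
  ultimately have "eval3 F (s ^ m * t ^ m, (s + t) ^ n, s ^ n + \<gamma> * t ^ n) = 0"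
    using numbers(1) by (metis (no_types, lifting) finite_lessThan lessThan_iff prod_zero right_minus_eq)
  then show "P \<in> zero_locus F"
    using st(2) no_base_point[OF st(1)] unfolding zero_locus_def form_values by blast
next
  fix P assume "P \<in> zero_locus F"
  then have "\<exists>v. P = proj_point v \<and> v \<noteq> (0, 0, 0) \<and> eval3 F v = 0" unfolding zero_locus_def mem_Collect_eq .
  then obtain x y z where P: "P = proj_point (x, y, z)" "(x, y, z) \<noteq> (0, 0, 0)" "eval3 F (x, y, z) = 0"
    by (metis prod_cases3)
  obtain v where v: "v ^ n = y" using nth_root_exists[of n y] numbers(1) by auto
  obtain w where w: "w ^ n = (1 + \<gamma>) * z - \<gamma> * y" using nth_root_exists[of n "(1 + \<gamma>) * z - \<gamma> * y"] numbers(1) by auto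
  have "(\<Prod>i<n. (x - H v (\<zeta> ^ i * w))) = 0" using P(3) F[of z v w x] w unfolding v by simp
  then obtain i where i: "x = H v (\<zeta> ^ i * w)" by auto
  define s where "s = (\<gamma> * v + \<zeta> ^ i * w) / (1 + \<gamma>)"
  define t where "t = (v - \<zeta> ^ i * w) / (1 + \<gamma>)"
  note st = curve_param[of v "\<zeta> ^ i * w", folded s_def t_def]
  have "(\<zeta> ^ i * w) ^ n = w ^ n" 
    unfolding power_mult_distrib power_mult[symmetric] mult.commute[of i] by (simp only: power_mult \<zeta> power_one mult_1_left)
  then have "(1 + \<gamma>) * (s ^ n + \<gamma> * t ^ n) - \<gamma> * y = (1 + \<gamma>) * z - \<gamma> * y"
    using D_form[of s t] unfolding st(1,2) v w by simp
  then have z: "s ^ n + \<gamma> * t ^ n = z" using one_plus_\<gamma> by simp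
  have xyz: "(form_value n A s t, form_value n B s t, form_value n C s t) = (x, y, z)"
    unfolding form_values z st(1,3) v i ..
  have "(s, t) \<noteq> (0, 0)"
  proof
    assume "(s, t) = (0, 0)"
    then have "(x, y, z) = (0, 0, 0)" using m numbers(1) unfolding xyz[symmetric] form_values by (simp add: zero_power)
    then show False using P(2) by simp
  qed
  then show "P \<in> curve" unfolding curve_eq P(1) using xyz by (metis (mono_tags, lifting) mem_Collect_eq)
qed

lemma H_eq_0: "H 1 w = 0 \<longleftrightarrow> w = 1 \<or> w = - \<gamma>"
proof -
  have "H 1 w = 0 \<longleftrightarrow> (\<gamma> + w) * (1 - w) = 0" unfolding H_def using m one_plus_\<gamma> by simp
  also have "\<dots> \<longleftrightarrow> w = 1 \<or> w = - \<gamma>" by (auto simp: eq_neg_iff_add_eq_0 add.commute)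
  finally show ?thesis .
qed

text \<open>
  If \<open>H(1, w)\<close> were invariant under \<open>w \<mapsto> \<eta> w\<close> with \<open>\<eta> \<noteq> 1\<close>, then the set of its zeros \<open>1\<close> and \<open>-\<gamma>\<close> would
  be stable under multiplication by \<open>\<eta>\<close>, so that \<open>\<eta> = -\<gamma>\<close> and \<open>\<gamma>\<^sup>2\<close> would be \<open>1\<close> or \<open>-\<gamma>\<close>. Hence
  each pair of exponents excludes only finitely many \<open>w\<close>.
\<close>

lemma separating_value_exists:
  assumes \<zeta>: "\<zeta> \<noteq> (0 :: 'k)" "\<And>i. 0 < i \<Longrightarrow> i < n \<Longrightarrow> \<zeta> ^ i \<noteq> 1"
  obtains w where "inj_on (\<lambda>i. H 1 (\<zeta> ^ i * w)) {..<n}"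
proof -
  obtain h where h: "\<And>w. poly h w = H 1 w" using H_poly by blast
  define d where "d i j = pcompose h [:0, \<zeta> ^ i:] - pcompose h [:0, \<zeta> ^ j:]" for i j
  have d: "poly (d i j) w = H 1 (\<zeta> ^ i * w) - H 1 (\<zeta> ^ j * w)" for i j w
    unfolding d_def by (simp add: poly_pcompose h mult.commute)
  have nz: "d i j \<noteq> 0" if ij: "i < j" "j < n" for i j
  proof
    assume "d i j = 0"
    then have eq: "H 1 (\<zeta> ^ i * w) = H 1 (\<zeta> ^ j * w)" for w using d[of i j w] by simp
    define \<eta> where "\<eta> = \<zeta> ^ (j - i)"
    have "\<zeta> ^ j = \<zeta> ^ i * \<eta>" unfolding \<eta>_def using ij by (simp flip: power_add)
    then have eta: "H 1 v = H 1 (\<eta> * v)" for v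
      using eq[of "v / \<zeta> ^ i"] \<zeta>(1) by (simp add: mult.assoc)
    have "\<eta> \<noteq> 1" unfolding \<eta>_def using \<zeta>(2)[of "j - i"] ij by simp
    moreover have "\<eta> = 1 \<or> \<eta> = - \<gamma>" using eta[of 1] H_eq_0[of 1] H_eq_0[of \<eta>] by simp
    ultimately have "\<eta> = - \<gamma>" by simp
    then have "\<gamma> * \<gamma> = 1 \<or> \<gamma> * \<gamma> = - \<gamma>" using eta[of "- \<gamma>"] H_eq_0[of "- \<gamma>"] H_eq_0[of "\<gamma> * \<gamma>"] by simp
    then have "(\<gamma> - 1) * (1 + \<gamma>) = 0 \<or> \<gamma> * (1 + \<gamma>) = 0" by (auto simp: algebra_simps)
    then show False using \<gamma>(1) one_plus_\<gamma> one_minus_\<gamma> by simp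
  qed
  define bad where "bad = (\<Union>j<n. \<Union>i<j. {w. poly (d i j) w = 0})"
  have "finite bad" unfolding bad_def using nz by (auto intro!: finite_UN_I poly_roots_finite)
  then obtain w where w: "w \<notin> bad" using ex_new_if_finite[OF infinite_alg_closed] by blast
  have ne: "H 1 (\<zeta> ^ i * w) \<noteq> H 1 (\<zeta> ^ j * w)" if "i < j" "j < n" for i j
    using w that d[of i j w] unfolding bad_def by auto
  show ?thesis
  proof (rule that[of w], rule inj_onI)
    fix i j assume ij: "i \<in> {..<n}" "j \<in> {..<n}" "H 1 (\<zeta> ^ i * w) = H 1 (\<zeta> ^ j * w)"
    then show "i = j" using ne[of i j] ne[of j i] by (cases i j rule: linorder_cases) auto
  qed
qed

text \<open>
  If \<open>F = G G'\<close>, then one factor, say \<open>G\<close>, vanishes on the curve. It has the \<open>n\<close> different zeros \<open>x = H(1, \<zeta>\<^sup>i w)\<close>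
  on the line \<open>Y = 1\<close>, \<open>Z = z\<close> for a general \<open>w\<close>, so its degree in \<open>X\<close> is \<open>n\<close>, like that of \<open>F\<close>.
  Thus \<open>G'\<close> does not contain \<open>X\<close> and divides the leading coefficient of \<open>F\<close>, which is a constant
  by homogeneity.
\<close>

lemma irreducible_equation:
  assumes \<zeta>: "\<zeta> \<noteq> (0 :: 'k)" "\<zeta> ^ n = 1" "\<And>i. 0 < i \<Longrightarrow> i < n \<Longrightarrow> \<zeta> ^ i \<noteq> 1"
    and hom: "homogeneous n F"
    and F: "\<And>x v w z. (1 + \<gamma>) * z - \<gamma> * v ^ n = w ^ n \<Longrightarrow> eval3 F (x, v ^ n, z) = (\<Prod>i<n. (x - H v (\<zeta> ^ i * w)))"
  shows "Factorial_Ring.irreducible F"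
proof -
  obtain h where h: "\<And>w. poly h w = H 1 w" using H_poly by blast
  define zp where "zp = Polynomial.smult (1 / (1 + \<gamma>)) (Polynomial.monom 1 n + [:\<gamma>:])"
  have zp: "(1 + \<gamma>) * poly zp w - \<gamma> = w ^ n" for w
    unfolding zp_def using one_plus_\<gamma> by (simp add: poly_monom)
  have F1: "eval3 F (x, 1, poly zp w) = (\<Prod>i<n. (x - H 1 (\<zeta> ^ i * w)))" for x w
    using F[of "poly zp w" 1 w x] zp[of w] by simp
  have rot: "(\<zeta> ^ i * w) ^ n = w ^ n" for i w
    unfolding power_mult_distrib power_mult[symmetric] mult.commute[of i] by (simp only: power_mult \<zeta>(2) power_one mult_1_left)
  have zp_rot: "poly zp (\<zeta> ^ i * w) = poly zp w" for i w
    unfolding zp_def by (simp add: poly_monom rot)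
  obtain w where w: "inj_on (\<lambda>i. H 1 (\<zeta> ^ i * w)) {..<n}"
    using separating_value_exists[OF \<zeta>(1,3)] by blast
  have coeff0: "Polynomial.coeff (Polynomial.coeff (Polynomial.coeff F i) j) l = 0" if "i + j + l \<noteq> n" for i j l
    using hom that unfolding homogeneous_def by blast
  have degF: "Polynomial.degree F \<le> n"
  proof (rule degree_le, intro allI impI)
    fix i assume "n < i"
    then show "Polynomial.coeff F i = 0" by (intro poly_eqI) (simp add: coeff0)
  qed
  obtain PF where PF: "\<And>x. poly PF x = eval3 F (x, 1, poly zp w)" "Polynomial.degree PF \<le> Polynomial.degree F"
    "\<And>i. Polynomial.coeff PF i = poly (poly (Polynomial.coeff F i) [:1:]) (poly zp w)"
    using eval3_as_poly by blast
  have "PF = (\<Prod>i<n. [:- H 1 (\<zeta> ^ i * w), 1:])"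
    by (intro iffD1[OF poly_eq_iff_infinite] allI) (simp add: PF(1) F1 poly_prod)
  then have dPF: "Polynomial.degree PF = n" by (simp add: degree_prod_sum_eq)
  then have PF0: "PF \<noteq> 0" using numbers(1) by auto
  have dF: "Polynomial.degree F = n" using PF(2) degF dPF by simp
  have F0: "F \<noteq> 0" using dF numbers(1) by auto
  have lead: "Polynomial.coeff F n dvd 1"
  proof -
    have 0: "Polynomial.coeff (Polynomial.coeff (Polynomial.coeff F n) j) l = 0" if "j \<noteq> 0 \<or> l \<noteq> 0" for j l
      using coeff0[of n j l] that by auto
    define c where "c = Polynomial.coeff (Polynomial.coeff (Polynomial.coeff F n) 0) 0"
    have "Polynomial.coeff F n = [:[:c:]:]"
      by (intro poly_eqI) (auto simp: coeff_pCons c_def 0 split: nat.splits)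
    moreover have "Polynomial.coeff F n \<noteq> 0" using dF F0 by (metis leading_coeff_0_iff)
    ultimately show ?thesis by (simp add: is_unit_const_poly_iff dvd_field_iff)
  qed
  have key: "G' dvd 1" if FG: "F = G * G'" and v: "pull h 1 zp G = 0" for G G'
  proof -
    obtain PG where PG: "\<And>x. poly PG x = eval3 G (x, 1, poly zp w)" "Polynomial.degree PG \<le> Polynomial.degree G"
      using eval3_as_poly by blast
    obtain PG' where PG': "\<And>x. poly PG' x = eval3 G' (x, 1, poly zp w)"
      using eval3_as_poly by blast
    have "PF = PG * PG'"
      by (intro iffD1[OF poly_eq_iff_infinite] allI) (simp add: PF(1) PG PG' FG)
    then have PG0: "PG \<noteq> 0" using PF0 by auto
    have "(\<lambda>i. H 1 (\<zeta> ^ i * w)) ` {..<n} \<subseteq> {x. poly PG x = 0}"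
    proof clarsimp
      fix i
      have "poly (pull h 1 zp G) (\<zeta> ^ i * w) = 0" using v by simp
      then show "poly PG (H 1 (\<zeta> ^ i * w)) = 0" unfolding poly_pull PG(1) h zp_rot by simp
    qed
    then have "card ((\<lambda>i. H 1 (\<zeta> ^ i * w)) ` {..<n}) \<le> card {x. poly PG x = 0}"
      by (intro card_mono poly_roots_finite PG0)
    also have "\<dots> \<le> Polynomial.degree PG" by (rule card_poly_roots_bound[OF PG0])
    finally have "n \<le> Polynomial.degree G" using PG(2) by (simp add: card_image[OF w])
    moreover have "Polynomial.degree G + Polynomial.degree G' = n"
      using dF F0 unfolding FG by (simp add: degree_mult_eq)
    ultimately have "Polynomial.degree G' = 0" by simp
    then obtain g where g: "G' = [:g:]" by (rule degree_eq_zeroE)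
    have "Polynomial.coeff F n = Polynomial.coeff G n * g" unfolding FG g by simp
    then have "g dvd 1" using lead by (metis dvd_triv_right dvd_trans)
    then show ?thesis unfolding g by (simp add: is_unit_const_poly_iff)
  qed
  show ?thesis
  proof (rule irreducibleI[OF F0])
    show "\<not> F dvd 1"
    proof
      assume "F dvd 1"
      then obtain E where E: "1 = F * E" by (rule dvdE)
      then have "E \<noteq> 0" by auto
      then have "Polynomial.degree (1 :: 'k poly3) = n + Polynomial.degree E" unfolding E using F0 dF by (simp add: degree_mult_eq)
      then show False using numbers(1) by simp
    qed
    fix G G' assume FG: "F = G * G'"
    \<comment> \<open>The curve is parametrized by \<open>w\<close> in the chart \<open>Y = 1\<close>.\<close>
    have "pull h 1 zp F = 0"
    proof (rule pull_eqI)
      fix u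
      have "H 1 u - H 1 (\<zeta> ^ 0 * u) = 0" by simp
      then show "eval3 F (poly h u, poly 1 u, poly zp u) = poly 0 u"
        unfolding h poly_1 F1 using numbers(1) by (metis (no_types, lifting) finite_lessThan lessThan_iff prod_zero poly_0)
    qed
    then have "pull h 1 zp G = 0 \<or> pull h 1 zp G' = 0" unfolding FG by simp
    then show "G dvd 1 \<or> G' dvd 1" using key[of G G'] key[of G' G] FG by (auto simp: mult.commute)
  qed
qed

lemma irreducible_curve: "irreducible_plane_curve n curve"
proof -
  obtain \<zeta> :: 'k where \<zeta>: "\<zeta> \<noteq> 0" "\<zeta> ^ n = 1" "\<And>i. 0 < i \<Longrightarrow> i < n \<Longrightarrow> \<zeta> ^ i \<noteq> 1"
    using primitive_root by blast
  obtain F where F: "homogeneous n F"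
    "\<And>x v w z. (1 + \<gamma>) * z - \<gamma> * v ^ n = w ^ n \<Longrightarrow> eval3 F (x, v ^ n, z) = (\<Prod>i<n. (x - H v (\<zeta> ^ i * w)))"
    using equation_exists[OF \<zeta>] by blast
  show ?thesis
    unfolding irreducible_plane_curve_def
    using F(1) irreducible_equation[OF \<zeta> F] curve_zero_locus[OF \<zeta>(2) F(2)] by blast
qed

end

section \<open>Finite subfields\<close>

text \<open>
  Multiplication by \<open>x\<close> permutes the nonzero elements, so it does not change their product.
\<close>

lemma finite_subfield_power_card:
  fixes K :: "'a::field set"
  assumes K: "subfield_of_type K" "finite K" and x: "x \<in> K"
  shows "x ^ card K = x"
proof (cases "x = 0")
  case True
  have "card K > 0" using K(2) x by (auto simp: card_gt_0_iff)
  then show ?thesis using True by (simp add: zero_power)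
next
  case False
  let ?U = "K - {0}"
  have "(\<lambda>y. x * y) ` ?U = ?U"
  proof (intro equalityI subsetI)
    fix y assume "y \<in> (\<lambda>y. x * y) ` ?U"
    then show "y \<in> ?U" using False x subfield_of_typeD(4)[OF K(1)] by auto
  next
    fix y assume "y \<in> ?U"
    then have "y / x \<in> ?U" "y = x * (y / x)" using False x subfield_of_typeD(8)[OF K(1)] by auto
    then show "y \<in> (\<lambda>y. x * y) ` ?U" by blast
  qed
  then have "\<Prod>?U = (\<Prod>y\<in>(\<lambda>y. x * y) ` ?U. y)" by simp
  also have "\<dots> = (\<Prod>y\<in>?U. x * y)" using False by (subst prod.reindex) (auto intro: inj_onI)
  also have "\<dots> = x ^ card ?U * \<Prod>?U" by (simp add: prod.distrib)
  finally have "x ^ card ?U = 1" using K(2) by simp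
  moreover have "card K = Suc (card ?U)"
    by (rule card.remove[OF K(2) subfield_of_typeD(1)[OF K(1)]])
  ultimately show ?thesis by simp
qed

section \<open>The outer Galois points of the curve\<close>

theorem theorem3:
  fixes p q :: nat and Fq :: "'k::alg_closed_field set" and \<gamma> :: 'k
  assumes "CHAR('k) = p" and "p \<ge> 3"
    and "\<exists>n. q = p ^ n" and "q \<ge> 5"
    and "subfield Fq (ring_of_type_algebra :: 'k ring)" and "card Fq = q"
    and "\<gamma> \<in> Fq - {0, 1, -1}"
  shows "irreducible_plane_curve (q + 1) (curve_C3 q \<gamma>) \<and>
    outer_galois_point (curve_C3 q \<gamma>) (proj_point (0, 1, 0)) \<and>
    galois_point_group (curve_C3 q \<gamma>) (proj_point (0, 1, 0)) \<cong> dihedral_group ((q + 1) div 2) \<and>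
    outer_galois_point (curve_C3 q \<gamma>) (proj_point (1, 0, 0)) \<and>
    galois_point_group (curve_C3 q \<gamma>) (proj_point (1, 0, 0)) \<cong> integer_mod_group (q + 1) \<and>
    card {P. outer_galois_point (curve_C3 q \<gamma>) P} = 2"
proof -
  define m where "m = (q + 1) div 2"
  obtain k where k: "q = p ^ k" using assms(3) by blast
  have k0: "k \<noteq> 0" using k assms(4) by (cases "k = 0") auto
  have prime: "prime CHAR('k)" using prime_CHAR_semidom[where ?'a = 'k] assms(1,2) by simp
  then have "odd p" using assms(1,2) prime_odd_nat by auto
  then have odd: "odd q" unfolding k by simp
  have "p dvd q" unfolding k using k0 by simp
  then have char_q: "of_nat q = (0 :: 'k)" using of_nat_eq_0_iff_char_dvd[where ?'a = 'k] assms(1) by blast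
  have frob: "(x + y) ^ q = x ^ q + y ^ q" for x y :: 'k
    by (rule freshmans_dream'[OF prime, where n = k]) (simp add: k assms(1))
  let ?U = "ring_of_type_algebra :: 'k ring"
  interpret U: field ?U by (rule field_from_type_algebra)
  interpret id: field_copy ?U "\<lambda>x. x"
    by unfold_locales (auto simp: ring_of_type_algebra_def bij_betw_def)
  have "subfield_of_type Fq"
    using id.subfield_iff[of Fq] assms(5) by (simp add: ring_of_type_algebra_def)
  moreover have "finite Fq" using assms(4,6) by (intro card_ge_0_finite) simp
  ultimately have \<gamma>q: "\<gamma> ^ q = \<gamma>" using finite_subfield_power_card[of Fq \<gamma>] assms(6,7) by simp
  interpret curve3 q m "q + 1" \<gamma>
  proof
    show "m \<ge> 3" "q + 1 = 2 * m" unfolding m_def using assms(4) odd by presburger+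
  qed (use char_q frob \<gamma>q assms(7) in auto)
  note defs = outer_galois_point_def galois_point_def galois_point_group_def
  have plane: "proj_point (0, 1, 0) \<in> proj_plane" "proj_point (1, 0, 0) \<in> (proj_plane :: ('k \<times> 'k \<times> 'k) set set)"
    unfolding proj_plane_def by auto
  have outer: "outer_galois_point curve (proj_point (0, 1, 0))" "outer_galois_point curve (proj_point (1, 0, 0))"
    unfolding defs using plane dihedral_galois(1) cyclic_galois(1) centres_not_on_curve by auto
  have "proj_point (0, 1, 0) \<noteq> proj_point (1, 0, 0 :: 'k)"
  proof
    assume "proj_point (0, 1, 0) = proj_point (1, 0, 0 :: 'k)"
    moreover have "(0, 1, 0 :: 'k) \<in> proj_point (0, 1, 0)" unfolding proj_point_def by auto
    ultimately show False unfolding proj_point_def by auto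
  qed
  moreover have "{P. outer_galois_point curve P} = {proj_point (0, 1, 0), proj_point (1, 0, 0)}"
    using outer outer_galois_point_cases by blast
  ultimately have "card {P. outer_galois_point curve P} = 2" by simp
  then show ?thesis
    using irreducible_curve outer dihedral_galois(2) cyclic_galois(2)
    unfolding curve_def m_def galois_point_group_def by blast
qed

end
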